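(* Let $E\in E_k(N,\chi)$ have rational Fourier coefficients and not be identically zero. Then $\chi$ is either trivial or quadratic. Moreover, $E$ can be written uniquely as a sum of shifts of functions each of which is either a trace $\mathrm{Tr}(\alpha f)$ of a newform $f$ in $E_k(N,\chi)$ (with $\alpha\in\mathbf{Q}(f)$), or a rational multiple of a newform $E(\chi_1,\chi_2,k)\in E_k(N,\chi)$ where $\chi_1$ and $\chi_2$ are real-valued Dirichlet characters.
   Context: $E_k(N,\chi)$ denotes the space of Eisenstein series of integer weight $k\ge2$ and character $\chi$ on $\Gamma_0(N)$. For (possibly complex-valued) Dirichlet characters $\chi_1,\chi_2$ modulo $N_1,N_2$ and an integer $k\ge 2$ with $\chi_1\chi_2(-1)=(-1)^k$, excluding the case where $k=2$ and $\chi_1,\chi_2$ are both principal modulo $1$, put $$E(\chi_1,\chi_2,k)(z)=\frac{\delta(\chi_1)}{2}L(1-k,\chi_2)+\sum_{n\ge1}\sigma_{\chi_1,\chi_2}^{k-1}(n)q^n,\quad q=e^{2\pi i z},\qquad \sigma_{\chi_1,\chi_2}^{k-1}(n)=\sum_{d\mid n}\chi_1(n/d)\chi_2(d)d^{k-1},$$ where $\delta(\chi_1)=1$ if $\chi_1$ is principal and $0$ otherwise. A newform of level $M$ and character $\chi$ is a function $E(\chi_1,\chi_2,k)$ with $\chi_1,\chi_2$ both primitive, $M=N_1N_2$ and $\chi=\chi_1\chi_2$ (the latter character being extended to modulus $N$ when $M\mid N$). The shift by a positive integer $d$ is $(f\mid B_d)(z)=f(dz)$. The paper's standing convention (Weisinger's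 newform theory) is that $E_k(N,\chi)$ has a basis consisting of newforms of level $M\mid N$ with character $\chi$ and their shifts by divisors $d$ of $N/M$; so every $E\in E_k(N,\chi)$ has a unique decomposition $E=\sum_i c_i(E_i\mid B_{d_i})$ with nonzero $c_i\in\mathbf{C}$ and $E_i$ newforms. In the claim, "newforms in $E_k(N,\chi)$" means newforms of level $M\mid N$ and character $\chi$, and shifts are by divisors $d$ of $N/M$ (including $d=1$). For a newform $f$, $\mathbf{Q}(f)$ is the field generated over $\mathbf{Q}$ by its Fourier coefficients $a_f(n)$ (a finite Galois extension of $\mathbf{Q}$), $f^\sigma$ is the form with $a_{f^\sigma}(n)=\sigma(a_f(n))$ for all $n$, and for $\alpha\in\mathbf{Q}(f)$, $$\mathrm{Tr}(\alpha f)=\sum_{\sigma\in\mathrm{Gal}(\mathbf{Q}(f)/\mathbf{Q})}\sigma(\alpha)f^\sigma.$$ *)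

theory Defs
  imports "HOL-Complex_Analysis.Complex_Analysis" "HOL-Library.Function_Algebras"
begin

section \<open>Dirichlet characters and their L-functions\<close>

definition dirichlet_char :: "nat \<Rightarrow> (int \<Rightarrow> complex) \<Rightarrow> bool" where
  "dirichlet_char m \<eta> \<longleftrightarrow> m > 0 \<and>
     (\<forall>a b. \<eta> (a * b) = \<eta> a * \<eta> b) \<and>
     (\<forall>a. \<eta> (a + int m) = \<eta> a) \<and>
     (\<forall>a. \<eta> a \<noteq> 0 \<longleftrightarrow> coprime a (int m))"

text \<open>A character modulo \<open>m\<close> is nonzero exactly on the integers coprime to \<open>m\<close>, so being
  principal (or quadratic) can be expressed without mentioning the modulus.\<close>

definition principal_char :: "(int \<Rightarrow> complex) \<Rightarrow> bool" where
  "principal_char \<eta> \<longleftrightarrow> (\<forall>a. \<eta> a \<noteq> 0 \<longrightarrow> \<eta> a = 1)"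

definition quadratic_char :: "(int \<Rightarrow> complex) \<Rightarrow> bool" where
  "quadratic_char \<eta> \<longleftrightarrow> \<not> principal_char \<eta> \<and> principal_char (\<lambda>a. \<eta> a ^ 2)"

definition real_valued_char :: "(int \<Rightarrow> complex) \<Rightarrow> bool" where
  "real_valued_char \<eta> \<longleftrightarrow> (\<forall>a. \<eta> a \<in> \<real>)"

definition primitive_char :: "nat \<Rightarrow> (int \<Rightarrow> complex) \<Rightarrow> bool" where
  "primitive_char m \<eta> \<longleftrightarrow> dirichlet_char m \<eta> \<and>
     (\<forall>d. d dvd m \<and> d < m \<longrightarrow>
        \<not> (\<exists>\<psi>. dirichlet_char d \<psi> \<and> (\<forall>a. coprime a (int m) \<longrightarrow> \<eta> a = \<psi> a)))"

text \<open>The analytic continuation of the Dirichlet series to the plane without \<open>s = 1\<close>; its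
  values there do not depend on the choice, by the identity theorem. The value at \<open>s = 1\<close>
  is unspecified.\<close>

definition dirichlet_L :: "(int \<Rightarrow> complex) \<Rightarrow> complex \<Rightarrow> complex" where
  "dirichlet_L \<eta> = (SOME F. F holomorphic_on (- {1}) \<and>
     (\<forall>s. Re s > 1 \<longrightarrow> (\<lambda>n. \<eta> (int (Suc n)) / of_nat (Suc n) powr s) sums F s))"


section \<open>Functions on the upper half-plane\<close>

text \<open>A function on the upper half-plane is encoded as a function on \<open>\<complex>\<close> that vanishes
  outside the upper half-plane; thus equality of functions is equality in the logic.\<close>

definition nome :: "complex \<Rightarrow> complex" where
  "nome z = exp (2 * of_real pi * \<i> * z)"

definition q_series :: "(nat \<Rightarrow> complex) \<Rightarrow> complex \<Rightarrow> complex" where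
  "q_series a z = (if Im z > 0 then (\<Sum>n. a n * nome z ^ n) else 0)"

definition fourier_coeff :: "(complex \<Rightarrow> complex) \<Rightarrow> nat \<Rightarrow> complex" where
  "fourier_coeff f = (THE a. \<forall>z. Im z > 0 \<longrightarrow> (\<lambda>n. a n * nome z ^ n) sums f z)"

definition cscale :: "complex \<Rightarrow> (complex \<Rightarrow> complex) \<Rightarrow> complex \<Rightarrow> complex" where
  "cscale c f = (\<lambda>z. c * f z)"

lemma vector_space_cscale: "vector_space cscale"
  by unfold_locales (auto simp: cscale_def fun_eq_iff algebra_simps)

definition shift :: "nat \<Rightarrow> (complex \<Rightarrow> complex) \<Rightarrow> complex \<Rightarrow> complex" where
  "shift d f = (\<lambda>z. f (of_nat d * z))"


section \<open>Eisenstein series\<close>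

definition twisted_sigma ::
    "(int \<Rightarrow> complex) \<Rightarrow> (int \<Rightarrow> complex) \<Rightarrow> nat \<Rightarrow> nat \<Rightarrow> complex" where
  "twisted_sigma \<phi>1 \<phi>2 j n =
     (\<Sum>d | d dvd n. \<phi>1 (int (n div d)) * \<phi>2 (int d) * of_nat d ^ j)"

definition eisenstein ::
    "(int \<Rightarrow> complex) \<Rightarrow> (int \<Rightarrow> complex) \<Rightarrow> nat \<Rightarrow> complex \<Rightarrow> complex" where
  "eisenstein \<phi>1 \<phi>2 k z =
     (if Im z > 0 then
        (if principal_char \<phi>1 then 1 else 0) / 2 * dirichlet_L \<phi>2 (1 - of_nat k)
          + (\<Sum>n. twisted_sigma \<phi>1 \<phi>2 (k - 1) (Suc n) * nome z ^ Suc n)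
      else 0)"

text \<open>The series \<open>eisenstein \<phi>1 \<phi>2 k\<close> is a newform of weight \<open>k\<close> and level \<open>N1 * N2\<close> dividing \<open>N\<close> whose
  character \<open>\<phi>1 \<phi>2\<close>, extended to modulus \<open>N\<close>, is \<open>\<eta>\<close>.\<close>

definition newform_chars ::
    "nat \<Rightarrow> nat \<Rightarrow> (int \<Rightarrow> complex) \<Rightarrow>
     nat \<Rightarrow> (int \<Rightarrow> complex) \<Rightarrow> nat \<Rightarrow> (int \<Rightarrow> complex) \<Rightarrow> bool" where
  "newform_chars k N \<eta> N1 \<phi>1 N2 \<phi>2 \<longleftrightarrow>
     primitive_char N1 \<phi>1 \<and> primitive_char N2 \<phi>2 \<and>
     \<phi>1 (-1) * \<phi>2 (-1) = (-1) ^ k \<and>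
     \<not> (k = 2 \<and> N1 = 1 \<and> N2 = 1) \<and>
     N1 * N2 dvd N \<and>
     (\<forall>a. coprime a (int N) \<longrightarrow> \<phi>1 a * \<phi>2 a = \<eta> a)"

text \<open>The Eisenstein space in the sense of Weisinger's newform theory: the span of the newforms
  of level \<open>M\<close> dividing \<open>N\<close> with character \<open>\<eta>\<close> and their shifts by the divisors of \<open>N / M\<close>.
  In weight 2 with trivial character this leaves out the combinations of the quasimodular
  series of level 1 with its shifts.\<close>

definition eisenstein_space ::
    "nat \<Rightarrow> nat \<Rightarrow> (int \<Rightarrow> complex) \<Rightarrow> (complex \<Rightarrow> complex) set" where
  "eisenstein_space k N \<eta> = module.span cscale
     {shift d (eisenstein \<phi>1 \<phi>2 k) | d N1 \<phi>1 N2 \<phi>2.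
        newform_chars k N \<eta> N1 \<phi>1 N2 \<phi>2 \<and> d dvd N div (N1 * N2)}"


section \<open>Coefficient fields and traces\<close>

definition complex_subfield :: "complex set \<Rightarrow> bool" where
  "complex_subfield K \<longleftrightarrow> 0 \<in> K \<and> 1 \<in> K \<and>
     (\<forall>x\<in>K. \<forall>y\<in>K. x + y \<in> K \<and> x * y \<in> K) \<and> (\<forall>x\<in>K. - x \<in> K \<and> inverse x \<in> K)"

definition coeff_field :: "(complex \<Rightarrow> complex) \<Rightarrow> complex set" where
  "coeff_field f = complex_subfield hull range (fourier_coeff f)"

text \<open>Automorphisms of \<open>K\<close> over the rationals. Extensionality makes distinct elements of this
  set distinct as maps on \<open>K\<close>, so that sums over it count each automorphism once.\<close>

definition galois_group :: "complex set \<Rightarrow> (complex \<Rightarrow> complex) set" where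
  "galois_group K = {\<sigma> \<in> extensional K. bij_betw \<sigma> K K \<and> (\<forall>x\<in>\<rat>. \<sigma> x = x) \<and>
     (\<forall>x\<in>K. \<forall>y\<in>K. \<sigma> (x + y) = \<sigma> x + \<sigma> y \<and> \<sigma> (x * y) = \<sigma> x * \<sigma> y)}"

definition conj_form :: "(complex \<Rightarrow> complex) \<Rightarrow> (complex \<Rightarrow> complex) \<Rightarrow> complex \<Rightarrow> complex" where
  "conj_form \<sigma> f = q_series (\<lambda>n. \<sigma> (fourier_coeff f n))"

definition trace_form :: "complex \<Rightarrow> (complex \<Rightarrow> complex) \<Rightarrow> complex \<Rightarrow> complex" where
  "trace_form \<alpha> f = (\<Sum>\<sigma>\<in>galois_group (coeff_field f). cscale (\<sigma> \<alpha>) (conj_form \<sigma> f))"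

definition galois_conjugate :: "(complex \<Rightarrow> complex) \<Rightarrow> (complex \<Rightarrow> complex) \<Rightarrow> bool" where
  "galois_conjugate f f' \<longleftrightarrow> (\<exists>\<sigma>\<in>galois_group (coeff_field f). f' = conj_form \<sigma> f)"


section \<open>Decompositions into shifts of traces\<close>

text \<open>The function \<open>g\<close> is built from the newform \<open>f\<close>, and \<open>d\<close> is an admissible shift for \<open>f\<close>.\<close>

definition constituent ::
    "nat \<Rightarrow> nat \<Rightarrow> (int \<Rightarrow> complex) \<Rightarrow>
     (complex \<Rightarrow> complex) \<Rightarrow> nat \<Rightarrow> (complex \<Rightarrow> complex) \<Rightarrow> bool" where
  "constituent k N \<eta> f d g \<longleftrightarrow>
     (\<exists>N1 \<phi>1 N2 \<phi>2. newform_chars k N \<eta> N1 \<phi>1 N2 \<phi>2 \<and>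
        f = eisenstein \<phi>1 \<phi>2 k \<and> d dvd N div (N1 * N2) \<and>
        ((\<exists>\<alpha>\<in>coeff_field f. g = trace_form \<alpha> f) \<or>
         (real_valued_char \<phi>1 \<and> real_valued_char \<phi>2 \<and> (\<exists>c\<in>\<rat>. g = cscale c f))))"

text \<open>The pair \<open>(g, d)\<close> stands for the summand \<open>shift d g\<close>. Traces of \<open>\<alpha> f\<close> and \<open>\<beta> f\<close> add up to
  the trace of \<open>(\<alpha> + \<beta>) f\<close>, and conjugate newforms have the same traces. A decomposition
  can therefore only be unique if zero terms are omitted and if, for each shift, all terms that
  come from one Galois orbit of newforms are collected into a single one.\<close>

definition decomposition ::
    "nat \<Rightarrow> nat \<Rightarrow> (int \<Rightarrow> complex) \<Rightarrow> (complex \<Rightarrow> complex) \<Rightarrow>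
     ((complex \<Rightarrow> complex) \<times> nat) set \<Rightarrow> bool" where
  "decomposition k N \<eta> E S \<longleftrightarrow> finite S \<and>
     (\<forall>(g, d)\<in>S. g \<noteq> 0 \<and> (\<exists>f. constituent k N \<eta> f d g)) \<and>
     (\<forall>g g' d f f'. (g, d) \<in> S \<and> (g', d) \<in> S \<and> g \<noteq> g' \<and>
        constituent k N \<eta> f d g \<and> constituent k N \<eta> f' d g' \<longrightarrow> \<not> galois_conjugate f f') \<and>
     E = (\<Sum>(g, d)\<in>S. shift d g)"

end

theory Submission
  imports Defs "HOL-Number_Theory.Cong" "HOL-Computational_Algebra.Fundamental_Theorem_Algebra"
begin


text \<open>Write \<open>E\<close> as a combination of shifts of newforms \<open>E(\<phi>, \<psi>, k)\<close> with coefficients \<open>c(\<phi>, \<psi>, d)\<close>.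
  These shifts are linearly independent, even for varying characters \<open>\<eta>\<close> of level \<open>N\<close>: at a prime \<open>p\<close>
  not dividing \<open>N\<close>, the coefficients at powers of \<open>p\<close> satisfy a linear recurrence with roots \<open>\<phi>(p)\<close> and
  \<open>\<psi>(p) p\<^sup>k\<^sup>-\<^sup>1\<close>, which differ in absolute value, and two different pairs of primitive characters differ at
  infinitely many primes. Hence the \<open>c(\<phi>, \<psi>, d)\<close> solve a linear system with cyclotomic coefficients and are
  cyclotomic themselves. An embedding \<open>\<tau>\<close> of the cyclotomic field fixes \<open>E\<close>, so independence gives
  \<open>c(\<phi>\<^sup>\<tau>, \<psi>\<^sup>\<tau>, d) = c(\<phi>, \<psi>, d)\<^sup>\<tau>\<close>. Consequently \<open>\<eta>\<close> is fixed by all embeddings, thus rational, and \<open>c(f, d)\<close>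
  lies in \<open>Q(f)\<close>, so that the terms belonging to a Galois orbit of newforms add up to a trace. For the constant
  terms one needs that \<open>L(1 - k, \<psi>)\<close> is a combination of values of \<open>\<psi>\<close> with rational weights independent of \<open>\<psi>\<close>.\<close>

section \<open>Dirichlet characters\<close>

text \<open>Conjugation by \<tau> may leave the space: a newform with character \<eta> becomes one
  whose character is the conjugate of \<eta>. This is why the independence ranges over all pairs of
  primitive characters whose product of moduli divides \<open>N\<close>; only afterwards does \<eta>
  turn out to be rational, and only then does the Galois group act on the basis. Independence needs
  positive indices only; the constant terms matter for identifying the coefficient field with the
  field of character values and the conjugate forms with Eisenstein series. The cyclotomic field is
  realised by adjoining a root of unity of order \<open>N!\<close>, a common exponent for all
  characters of modulus at most \<open>N\<close>, to a base field \<open>K\<close>: the rationals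
  when \<eta> is studied, the field of values of a pair when its coefficient is. For real-valued
  characters the Galois group is trivial and a rational multiple of the newform is already a trace,
  so every summand can be treated as a trace. Uniqueness then says that the summands correspond to
  the Galois orbits of basis elements with nonzero coefficient.\<close>

lemma dirichlet_char_pos: "dirichlet_char m \<phi> \<Longrightarrow> m > 0"
  and dirichlet_char_mult: "dirichlet_char m \<phi> \<Longrightarrow> \<phi> (a * b) = \<phi> a * \<phi> b"
  and dirichlet_char_nonzero_iff: "dirichlet_char m \<phi> \<Longrightarrow> \<phi> a \<noteq> 0 \<longleftrightarrow> coprime a (int m)"
  by (auto simp: dirichlet_char_def)

lemma dirichlet_char_1: "dirichlet_char m \<phi> \<Longrightarrow> \<phi> 1 = 1"
  using dirichlet_char_mult[of m \<phi> 1 1] dirichlet_char_nonzero_iff[of m \<phi> 1] by simp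

lemma dirichlet_char_cong:
  assumes "dirichlet_char m \<phi>" "[a = b] (mod int m)"
  shows "\<phi> a = \<phi> b"
proof -
  have step: "\<phi> (a + int m) = \<phi> a" for a
    using assms(1) by (auto simp: dirichlet_char_def)
  have nat: "\<phi> (a + int n * int m) = \<phi> a" for a n
  proof (induction n)
    case (Suc n)
    then show ?case
      using step[of "a + int n * int m"] by (simp add: algebra_simps)
  qed simp
  obtain t where t: "b = a + t * int m"
    using assms(2) by (metis cong_iff_lin mult.commute)
  show ?thesis
  proof (cases "t \<ge> 0")
    case True
    then show ?thesis using nat[of a "nat t"] t by simp
  next
    case False
    then show ?thesis using nat[of b "nat (- t)"] t by simp
  qed
qed

lemma dirichlet_char_power: "dirichlet_char m \<phi> \<Longrightarrow> \<phi> (a ^ n) = \<phi> a ^ n"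
  by (induction n) (auto simp: dirichlet_char_1 dirichlet_char_mult)

text \<open>By the pigeonhole principle two of the powers \<open>a ^ 0, ..., a ^ m\<close> agree
  modulo \<open>m\<close>, so \<phi> a has order at most \<open>m\<close>. The factorial is an
  exponent that serves all moduli up to \<open>M\<close> at once.\<close>

lemma dirichlet_char_root_of_unity:
  assumes \<phi>: "dirichlet_char m \<phi>" and "\<phi> a \<noteq> 0" "m \<le> M"
  shows "\<phi> a ^ fact M = 1"
proof -
  have m: "m > 0" using \<phi> by (rule dirichlet_char_pos)
  let ?f = "\<lambda>i::nat. a ^ i mod int m"
  have "?f ` {..m} \<subseteq> {0..<int m}" using m by auto
  then have "card (?f ` {..m}) \<le> card {0..<int m}" by (intro card_mono) auto
  then have "\<not> inj_on ?f {..m}" using card_image[of ?f "{..m}"] by auto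
  then obtain i j where "i < j" "j \<le> m" and ij: "?f i = ?f j"
    unfolding inj_on_def by (metis atMost_iff linorder_neqE_nat)
  have "\<phi> a ^ i = \<phi> a ^ j"
    using dirichlet_char_cong[OF \<phi>, of "a ^ i" "a ^ j"] ij
    by (simp add: cong_def dirichlet_char_power[OF \<phi>])
  also have "\<dots> = \<phi> a ^ i * \<phi> a ^ (j - i)"
    using \<open>i < j\<close> by (simp flip: power_add)
  finally have "\<phi> a ^ (j - i) = 1" using \<open>\<phi> a \<noteq> 0\<close> by simp
  moreover have "j - i dvd fact M"
    using \<open>i < j\<close> \<open>j \<le> m\<close> \<open>m \<le> M\<close> by (intro dvd_fact) auto
  ultimately show ?thesis by (auto simp: dvd_def power_mult)
qed

lemma dirichlet_char_norm:
  assumes \<phi>: "dirichlet_char m \<phi>" and "\<phi> a \<noteq> 0"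
  shows "cmod (\<phi> a) = 1"
proof -
  have "cmod (\<phi> a) ^ fact m = 1"
    using dirichlet_char_root_of_unity[OF assms order_refl] by (metis norm_one norm_power)
  then show ?thesis by (intro power_eq_imp_eq_base[of _ "fact m" 1]) auto
qed

lemma dirichlet_char_norm_le: "dirichlet_char m \<phi> \<Longrightarrow> cmod (\<phi> a) \<le> 1"
  using dirichlet_char_norm[of m \<phi> a] by (cases "\<phi> a = 0") auto

text \<open>Take \<open>a + g * t\<close> with \<open>t\<close> the product of the primes dividing
  \<open>n\<close> but not \<open>a\<close>. A prime divisor of \<open>n\<close> then divides
  exactly one of the two terms, since it cannot divide both \<open>a\<close> and
  \<open>g\<close>.\<close>

lemma exists_cong_coprime:
  fixes a g n :: int
  assumes "coprime a g" "n \<noteq> 0"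
  shows "\<exists>b. [b = a] (mod g) \<and> coprime b n"
proof -
  let ?P = "{p. prime p \<and> p dvd n \<and> \<not> p dvd a}"
  have fin: "finite ?P"
    using assms(2) finite_prime_divisors[of n] by (auto intro: finite_subset)
  let ?t = "\<Prod>?P"
  have "coprime (a + g * ?t) n"
  proof (rule ccontr)
    assume "\<not> ?thesis"
    then have "\<not> is_unit (gcd (a + g * ?t) n)" unfolding is_unit_gcd .
    then obtain p where "prime p" "p dvd gcd (a + g * ?t) n"
      using assms(2) prime_divisor_exists[of "gcd (a + g * ?t) n"] by auto
    then have p: "prime p" "p dvd a + g * ?t" "p dvd n" by auto
    show False
    proof (cases "p dvd a")
      case True
      then have "p dvd g * ?t" using p(2) by (simp add: dvd_add_right_iff)
      moreover have "\<not> p dvd g"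
        using True assms(1) p(1) by (meson coprime_common_divisor not_prime_unit)
      ultimately have "p dvd ?t" using p(1) prime_dvd_multD by blast
      then obtain q where "q \<in> ?P" "p dvd q"
        using prime_dvd_prod_iff[OF fin p(1)] by auto
      then have "p = q" using p(1) primes_dvd_imp_eq by blast
      then show False using True \<open>q \<in> ?P\<close> by auto
    next
      case False
      then have "p dvd ?t" using p fin by (intro dvd_prodI) auto
      then show False using p(2) False by (simp add: dvd_add_left_iff)
    qed
  qed
  moreover have "[a + g * ?t = a] (mod g)" by (simp add: cong_def)
  ultimately show ?thesis by blast
qed

lemma exists_cong_coprime_both:
  fixes x y :: int
  assumes "[x = y] (mod int (gcd m n))" "coprime x (int m)" "coprime y (int n)" "N > 0"
  shows "\<exists>z. [z = x] (mod int m) \<and> [z = y] (mod int n) \<and> coprime z (int N)"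
proof -
  obtain u v where uv: "u * int m + v * int n = gcd (int m) (int n)"
    using bezout_int by blast
  obtain t where t: "y = x + gcd (int m) (int n) * t"
    using assms(1) by (auto simp: cong_iff_lin)
  \<comment> \<open>As \<open>u * m\<close> is \<open>0\<close> modulo \<open>m\<close> and
    \<open>gcd m n\<close> modulo \<open>n\<close>, this is the Chinese remainder solution for
    moduli that need not be coprime.\<close>
  define w where "w = x + u * int m * t"
  have w': "w = y - v * int n * t"
    unfolding w_def t uv[symmetric] by (simp add: algebra_simps)
  have wm: "[w = x] (mod int m)" by (simp add: w_def cong_iff_dvd_diff)
  have wn: "[w = y] (mod int n)" by (simp add: w' cong_iff_dvd_diff)
  have "coprime w (int m)" "coprime w (int n)"
    using wm wn assms(2,3) by (meson cong_imp_coprime cong_sym)+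
  then have "coprime w (int m * int n)" by simp
  then obtain z where z: "[z = w] (mod int m * int n)" "coprime z (int N)"
    using exists_cong_coprime[of w "int m * int n" "int N"] \<open>N > 0\<close> by auto
  have "[z = w] (mod int m)" "[z = w] (mod int n)"
    using z(1) by (auto intro: cong_dvd_modulus)
  then show ?thesis using wm wn z(2) cong_trans by blast
qed

text \<open>The induced character sends \<open>a\<close> to the value of \<phi> at any integer
  congruent to \<open>a\<close> modulo \<open>d\<close> that is a unit modulo \<open>m\<close>. Such
  integers exist by \<open>exists_cong_coprime\<close>, and the assumption \<open>cong\<close> makes
  the choice irrelevant.\<close>

lemma induced_charI:
  assumes \<phi>: "dirichlet_char m \<phi>" and d: "d dvd m"
    and cong: "\<And>a b. coprime a (int m) \<Longrightarrow> coprime b (int m) \<Longrightarrow> [a = b] (mod int d) \<Longrightarrow> \<phi> a = \<phi> b"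
  shows "\<exists>\<psi>. dirichlet_char d \<psi> \<and> (\<forall>a. coprime a (int m) \<longrightarrow> \<phi> a = \<psi> a)"
proof -
  have m: "m > 0" using \<phi> by (rule dirichlet_char_pos)
  define r where "r a = (SOME b. [b = a] (mod int d) \<and> coprime b (int m))" for a :: int
  have r: "[r a = a] (mod int d)" "coprime (r a) (int m)" if "coprime a (int d)" for a
    using someI_ex[OF exists_cong_coprime[OF that, of "int m"]] m by (auto simp: r_def)
  define \<psi> where "\<psi> a = (if coprime a (int d) then \<phi> (r a) else 0)" for a
  have \<psi>: "\<psi> a = \<phi> b" if "coprime b (int m)" "[b = a] (mod int d)" for a b
  proof -
    have "coprime b (int d)"
      using that(1) d by (metis coprime_divisors dvd_refl of_nat_dvd_iff)
    then have "coprime a (int d)" using that(2) by (rule cong_imp_coprime[rotated])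
    then show ?thesis
      using r[of a] that cong[of "r a" b] by (auto simp: \<psi>_def intro: cong_trans cong_sym)
  qed
  have "\<psi> (a * b) = \<psi> a * \<psi> b" for a b
  proof (cases "coprime a (int d) \<and> coprime b (int d)")
    case True
    then have "\<psi> (a * b) = \<phi> (r a * r b)"
      by (intro \<psi>) (auto intro: r cong_mult)
    then show ?thesis using True by (simp add: \<psi>_def dirichlet_char_mult[OF \<phi>])
  next
    case False
    then show ?thesis by (auto simp: \<psi>_def)
  qed
  moreover have "\<psi> (a + int d) = \<psi> a" for a
  proof (cases "coprime a (int d)")
    case True
    have "[r a = a + int d] (mod int d)" using r(1)[OF True] by (simp add: cong_def)
    then have "\<psi> (a + int d) = \<phi> (r a)" using r(2)[OF True] by (intro \<psi>)
    then show ?thesis using True by (simp add: \<psi>_def)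
  next
    case False
    then have "\<not> coprime (a + int d) (int d)"
      by (simp add: coprime_iff_gcd_eq_1)
    with False show ?thesis by (simp add: \<psi>_def)
  qed
  moreover have "\<psi> a \<noteq> 0 \<longleftrightarrow> coprime a (int d)" for a
    using r(2)[of a] dirichlet_char_nonzero_iff[OF \<phi>] by (auto simp: \<psi>_def)
  moreover have "d > 0" using d m by (auto intro: Nat.gr0I)
  ultimately have "dirichlet_char d \<psi>" by (auto simp: dirichlet_char_def)
  then show ?thesis using \<psi> by (metis cong_refl)
qed

text \<open>Primitivity in terms of the character alone, so that it is visibly preserved when an
  injective map is applied to the values.\<close>

lemma primitive_char_iff:
  "primitive_char m \<phi> \<longleftrightarrow> dirichlet_char m \<phi> \<and>
     (\<forall>d. d dvd m \<and> d < m \<longrightarrow> (\<exists>a b. coprime a (int m) \<and> coprime b (int m) \<and>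
        [a = b] (mod int d) \<and> \<phi> a \<noteq> \<phi> b))"
  (is "_ = (_ \<and> ?R)")
proof (intro iffI conjI)
  assume p: "primitive_char m \<phi>"
  show "dirichlet_char m \<phi>" using p by (simp add: primitive_char_def)
  then show ?R using p induced_charI[of m \<phi>] unfolding primitive_char_def by metis
next
  assume a: "dirichlet_char m \<phi> \<and> ?R"
  show "primitive_char m \<phi>"
    unfolding primitive_char_def
  proof (intro conjI allI impI notI)
    fix d assume d: "d dvd m \<and> d < m"
      and "\<exists>\<psi>. dirichlet_char d \<psi> \<and> (\<forall>a. coprime a (int m) \<longrightarrow> \<phi> a = \<psi> a)"
    then obtain \<psi> where \<psi>: "dirichlet_char d \<psi>" "\<And>a. coprime a (int m) \<Longrightarrow> \<phi> a = \<psi> a" by blast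
    obtain x y where "coprime x (int m)" "coprime y (int m)" "[x = y] (mod int d)" "\<phi> x \<noteq> \<phi> y"
      using a d by blast
    then show False using \<psi> dirichlet_char_cong by metis
  qed (use a in auto)
qed

text \<open>On units modulo \<open>N\<close> the common function depends on its argument modulo
  \<open>m\<close> and modulo \<open>n\<close>, hence only modulo \<open>gcd m n\<close>. If
  \<open>m\<close> did not divide \<open>n\<close>, this would contradict the primitivity of
  \<phi>.\<close>

lemma primitive_char_modulus_dvd:
  assumes \<phi>: "primitive_char m \<phi>" and \<psi>: "dirichlet_char n \<psi>"
    and N: "N > 0" "m dvd N" "n dvd N"
    and eq: "\<And>a. coprime a (int N) \<Longrightarrow> \<phi> a = \<psi> a"
  shows "m dvd n"
proof (rule ccontr)
  assume "\<not> m dvd n"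
  have \<phi>': "dirichlet_char m \<phi>" using \<phi> by (simp add: primitive_char_def)
  have cN: "coprime z (int m)" if "coprime z (int N)" for z
    using that N(2) by (metis coprime_divisors dvd_refl of_nat_dvd_iff)
  have cN': "coprime z (int n)" if "coprime z (int N)" for z
    using that N(3) by (metis coprime_divisors dvd_refl of_nat_dvd_iff)
  let ?g = "gcd m n"
  have "m > 0" using \<phi>' by (rule dirichlet_char_pos)
  then have "?g dvd m \<and> ?g < m"
    using \<open>\<not> m dvd n\<close> by (metis dvd_imp_le gcd_dvd1 gcd_dvd2 le_neq_implies_less)
  then obtain x y where xy: "coprime x (int m)" "coprime y (int m)" "[x = y] (mod int ?g)" "\<phi> x \<noteq> \<phi> y"
    using \<phi> unfolding primitive_char_iff by blast
  obtain y' where y': "[y' = y] (mod int m)" "coprime y' (int N)"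
    using exists_cong_coprime[OF xy(2), of "int N"] N(1) by auto
  have "[y' = y] (mod int ?g)" using y'(1) by (rule cong_dvd_modulus) auto
  then have "[x = y'] (mod int ?g)" using xy(3) by (meson cong_sym cong_trans)
  then obtain z where z: "[z = x] (mod int m)" "[z = y'] (mod int n)" "coprime z (int N)"
    using exists_cong_coprime_both[of x y' m n N] xy(1) cN'[OF y'(2)] N(1) by blast
  have "\<phi> x = \<phi> z" using dirichlet_char_cong[OF \<phi>' z(1)] by simp
  also have "\<dots> = \<psi> y'" using eq[OF z(3)] dirichlet_char_cong[OF \<psi> z(2)] by simp
  also have "\<dots> = \<phi> y" using eq[OF y'(2)] dirichlet_char_cong[OF \<phi>' y'(1)] by simp
  finally show False using xy(4) by simp
qed

text \<open>Mutual divisibility makes the moduli equal. Every unit modulo \<open>m\<close> is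
  congruent to a unit modulo \<open>N\<close>, where the values agree, and both characters vanish
  off the units.\<close>

lemma primitive_char_eqI:
  assumes \<phi>: "primitive_char m \<phi>" and \<psi>: "primitive_char n \<psi>"
    and N: "N > 0" "m dvd N" "n dvd N"
    and eq: "\<And>a. coprime a (int N) \<Longrightarrow> \<phi> a = \<psi> a"
  shows "\<phi> = \<psi>"
proof
  fix a
  have \<phi>': "dirichlet_char m \<phi>" and \<psi>': "dirichlet_char n \<psi>"
    using \<phi> \<psi> by (simp_all add: primitive_char_def)
  have "m = n"
    using primitive_char_modulus_dvd[OF \<phi> \<psi>' N eq] primitive_char_modulus_dvd[OF \<psi> \<phi>' N(1,3,2)] eq
    by (simp add: dvd_antisym)
  show "\<phi> a = \<psi> a"
  proof (cases "coprime a (int m)")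
    case True
    then obtain b where "[b = a] (mod int m)" "coprime b (int N)"
      using exists_cong_coprime[of a "int m" "int N"] N(1) by auto
    then show ?thesis
      using dirichlet_char_cong[OF \<phi>'] dirichlet_char_cong[OF \<psi>'] eq \<open>m = n\<close> by metis
  next
    case False
    then show ?thesis
      using dirichlet_char_nonzero_iff[OF \<phi>'] dirichlet_char_nonzero_iff[OF \<psi>'] \<open>m = n\<close> by metis
  qed
qed

lemma dirichlet_char_eq_if_eq_at_primes:
  assumes \<phi>: "dirichlet_char m \<phi>" and \<psi>: "dirichlet_char m' \<psi>" and "n > 0"
    and "\<And>p::nat. prime p \<Longrightarrow> p dvd n \<Longrightarrow> \<phi> (int p) = \<psi> (int p)"
  shows "\<phi> (int n) = \<psi> (int n)"
  using assms(3,4)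
proof (induction n rule: prime_divisors_induct)
  case (factor p x)
  then have "\<phi> (int x) = \<psi> (int x)" "\<phi> (int p) = \<psi> (int p)" by auto
  then show ?case
    by (simp add: dirichlet_char_mult[OF \<phi>] dirichlet_char_mult[OF \<psi>])
qed (use dirichlet_char_1[OF \<phi>] dirichlet_char_1[OF \<psi>] in auto)

text \<open>If \<open>\<phi>\<close> and \<open>\<psi>\<close> differed at finitely many primes only, then a number congruent to \<open>1\<close>
  modulo all these primes and to \<open>a\<close> modulo \<open>N\<close> would show that they agree at \<open>a\<close>.\<close>

lemma primitive_chars_differ_at_prime:
  assumes \<phi>: "primitive_char m \<phi>" and \<psi>: "primitive_char n \<psi>" and "\<phi> \<noteq> \<psi>"
    and N: "N > 0" "m dvd N" "n dvd N" and "M > 0"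
  shows "\<exists>p. prime p \<and> \<not> p dvd N \<and> \<not> p dvd M \<and> \<phi> (int p) \<noteq> \<psi> (int p)"
proof (rule ccontr)
  assume *: "\<not> ?thesis"
  have \<phi>': "dirichlet_char m \<phi>" and \<psi>': "dirichlet_char n \<psi>"
    using \<phi> \<psi> by (simp_all add: primitive_char_def)
  have "\<phi> a = \<psi> a" if a: "coprime a (int N)" for a
  proof -
    \<comment> \<open>\<open>M\<close> encodes the finitely many primes to be avoided. Those
      dividing \<open>N\<close> need no congruence condition, as \<open>c\<close> below is prime to
      \<open>N\<close>.\<close>
    let ?Q = "{p::nat. prime p \<and> p dvd M \<and> \<not> p dvd N}"
    have fin: "finite ?Q"
      using finite_prime_divisors[of M] \<open>M > 0\<close> by (auto intro: finite_subset)
    let ?q = "\<Prod>?Q"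
    have "coprime ?q N"
      by (rule prod_coprime_left) (auto intro: prime_imp_coprime)
    then have "coprime (int N) (int ?q)" by (metis coprime_commute coprime_int_iff)
    then obtain b where b: "[b = a] (mod int N)" "[b = 1] (mod int ?q)"
      using binary_chinese_remainder_int[of "int N" "int ?q" a 1] by blast
    have q: "?q > 0" by (auto simp: prime_gt_0_nat intro: prod_pos)
    \<comment> \<open>Adding a full period makes the representative a positive natural number even
      for the residue \<open>0\<close>.\<close>
    define c where "c = nat (b mod (int N * int ?q) + int N * int ?q)"
    have "int N * int ?q > 0" using N(1) q by (metis mult_pos_pos of_nat_0_less_iff)
    moreover from this have "b mod (int N * int ?q) \<ge> 0" by simp
    ultimately have c: "int c = b mod (int N * int ?q) + int N * int ?q" and "c > 0"
      unfolding c_def by linarith+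
    have "[int c = b] (mod (int N * int ?q))" unfolding c by (simp add: cong_def)
    then have "[int c = b] (mod int N)" "[int c = b] (mod int ?q)"
      by (auto intro: cong_dvd_modulus)
    then have c1: "[int c = a] (mod int N)" and c2: "[int c = 1] (mod int ?q)"
      using b cong_trans by blast+
    have "coprime (int c) (int N)" "coprime (int c) (int ?q)"
      using cong_imp_coprime[OF cong_sym[OF c1]] cong_imp_coprime[OF cong_sym[OF c2]] a by simp_all
    then have cop: "coprime c N" "coprime c ?q" by (metis coprime_int_iff)+
    have "\<phi> (int c) = \<psi> (int c)"
    proof (rule dirichlet_char_eq_if_eq_at_primes[OF \<phi>' \<psi>'])
      show "c > 0" by fact
      fix p :: nat assume p: "prime p" "p dvd c"
      have pN: "\<not> p dvd N" and pq: "\<not> p dvd ?q"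
        using p cop by (meson coprime_common_divisor not_prime_unit)+
      then have "\<not> p dvd M" using p(1) fin by (auto intro: dvd_prodI)
      then show "\<phi> (int p) = \<psi> (int p)" using * p(1) pN by blast
    qed
    moreover have "[int c = a] (mod int m)" "[int c = a] (mod int n)"
      using c1 N by (meson cong_dvd_modulus of_nat_dvd_iff)+
    ultimately show ?thesis
      using dirichlet_char_cong[OF \<phi>'] dirichlet_char_cong[OF \<psi>'] by metis
  qed
  then show False using primitive_char_eqI[OF \<phi> \<psi> N] \<open>\<phi> \<noteq> \<psi>\<close> by blast
qed

text \<open>A character is determined by one period, and its values there are \<open>0\<close> or
  roots of unity of order dividing \<open>fact m\<close>.\<close>

lemma finite_dirichlet_chars: "finite {\<phi>. dirichlet_char m \<phi>}"
proof -
  let ?Z = "insert 0 {z::complex. z ^ fact m = 1}"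
  let ?r = "\<lambda>\<phi> :: int \<Rightarrow> complex. restrict \<phi> {0..<int m}"
  have "finite {z::complex. z ^ fact m = 1}"
    by (rule finite_roots_unity) simp
  then have "finite ({0..<int m} \<rightarrow>\<^sub>E ?Z)" by (intro finite_PiE) auto
  moreover have "?r ` {\<phi>. dirichlet_char m \<phi>} \<subseteq> {0..<int m} \<rightarrow>\<^sub>E ?Z"
    using dirichlet_char_root_of_unity by fastforce
  ultimately have "finite (?r ` {\<phi>. dirichlet_char m \<phi>})" by (rule finite_subset[rotated])
  moreover have "inj_on ?r {\<phi>. dirichlet_char m \<phi>}"
  proof (rule inj_onI, rule ext)
    fix \<phi> \<psi> a assume *: "\<phi> \<in> {\<phi>. dirichlet_char m \<phi>}" "\<psi> \<in> {\<phi>. dirichlet_char m \<phi>}" "?r \<phi> = ?r \<psi>"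
    then have "m > 0" using dirichlet_char_pos by auto
    then have "a mod int m \<in> {0..<int m}" by simp
    then have "\<phi> (a mod int m) = \<psi> (a mod int m)" using *(3) by (metis restrict_apply')
    then show "\<phi> a = \<psi> a"
      using * dirichlet_char_cong[of m \<phi> a "a mod int m"] dirichlet_char_cong[of m \<psi> a "a mod int m"]
      by simp
  qed
  ultimately show ?thesis by (rule finite_imageD)
qed


section \<open>Linear independence of shifted divisor sums\<close>

lemma twisted_sigma_1: "dirichlet_char m \<phi> \<Longrightarrow> dirichlet_char n \<psi> \<Longrightarrow> twisted_sigma \<phi> \<psi> j 1 = 1"
  by (simp add: twisted_sigma_def dirichlet_char_1)

lemma divisors_prime_power_Suc:
  fixes p m :: nat
  assumes p: "prime p" "\<not> p dvd m" and m: "m > 0"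
  shows "{d. d dvd p ^ Suc i * m} = {d. d dvd p ^ i * m} \<union> (\<lambda>e. p ^ Suc i * e) ` {e. e dvd m}"
    and "{d. d dvd p ^ i * m} \<inter> (\<lambda>e. p ^ Suc i * e) ` {e. e dvd m} = {}"
proof -
  have p0: "p > 0" using p(1) by (simp add: prime_gt_0_nat)
  have "d dvd p ^ i * m \<or> d \<in> (\<lambda>e. p ^ Suc i * e) ` {e. e dvd m}" if dv: "d dvd p ^ Suc i * m" for d
  proof -
    obtain b e where d: "d = b * e" "b dvd p ^ Suc i" "e dvd m"
      using division_decomp[OF dv] by blast
    then obtain t where t: "t \<le> Suc i" "b = p ^ t"
      using divides_primepow_nat[OF p(1)] by blast
    show ?thesis
    proof (cases "t = Suc i")
      case False
      then have "b dvd p ^ i" using t by (simp add: le_imp_power_dvd)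
      then show ?thesis using d by (auto intro: mult_dvd_mono)
    qed (use t d in auto)
  qed
  moreover have "d dvd p ^ Suc i * m" if "d dvd p ^ i * m" for d
    using that by (metis dvd_mult mult.assoc power_Suc)
  moreover have "p ^ Suc i * e dvd p ^ Suc i * m" if "e dvd m" for e
    by (rule mult_dvd_mono[OF dvd_refl that])
  ultimately show "{d. d dvd p ^ Suc i * m} = {d. d dvd p ^ i * m} \<union> (\<lambda>e. p ^ Suc i * e) ` {e. e dvd m}"
    by blast
  have False if "p ^ Suc i * e dvd p ^ i * m" for e
  proof -
    have "p ^ i * (p * e) dvd p ^ i * m" using that by (metis mult.assoc power_Suc2)
    then have "p * e dvd m" using p0 by (subst (asm) nat_mult_dvd_cancel1) simp_all
    then show False using p(2) by (meson dvd_mult_left)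
  qed
  then show "{d. d dvd p ^ i * m} \<inter> (\<lambda>e. p ^ Suc i * e) ` {e. e dvd m} = {}" by blast
qed

text \<open>The divisors are split according to whether they contain the full power of
  \<open>p\<close>. If not, the extra \<open>p\<close> lies in the complementary divisor and
  contributes \<phi> p; if so, the divisor is \<open>p ^ Suc i * e\<close> with \<open>e\<close>
  dividing \<open>m\<close>.\<close>

lemma twisted_sigma_prime_step:
  assumes \<phi>: "dirichlet_char N1 \<phi>" and \<psi>: "dirichlet_char N2 \<psi>"
    and p: "prime p" "\<not> p dvd m" and m: "m > 0"
  shows "twisted_sigma \<phi> \<psi> j (p ^ Suc i * m) = \<phi> (int p) * twisted_sigma \<phi> \<psi> j (p ^ i * m)
           + (\<psi> (int p) * of_nat p ^ j) ^ Suc i * twisted_sigma \<phi> \<psi> j m"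
proof -
  have p0: "p > 0" using p(1) by (simp add: prime_gt_0_nat)
  let ?f = "\<lambda>n d. \<phi> (int (n div d)) * \<psi> (int d) * of_nat d ^ j"
  let ?q = "p ^ Suc i"
  have fin: "finite {d. d dvd p ^ i * m}" "finite {e. e dvd m}"
    using p0 m by (auto intro: finite_divisors_nat)
  have "twisted_sigma \<phi> \<psi> j (?q * m) = sum (?f (?q * m)) {d. d dvd p ^ i * m}
      + sum (?f (?q * m)) ((\<lambda>e. ?q * e) ` {e. e dvd m})"
    unfolding twisted_sigma_def divisors_prime_power_Suc(1)[OF p m]
    using fin divisors_prime_power_Suc(2)[OF p m] by (intro sum.union_disjoint) auto
  also have "sum (?f (?q * m)) {d. d dvd p ^ i * m} = (\<Sum>d | d dvd p ^ i * m. \<phi> (int p) * ?f (p ^ i * m) d)"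
  proof (intro sum.cong refl)
    fix d assume "d \<in> {d. d dvd p ^ i * m}"
    then have "?q * m div d = p * (p ^ i * m div d)"
      by (simp add: div_mult_swap mult.assoc)
    then show "?f (?q * m) d = \<phi> (int p) * ?f (p ^ i * m) d"
      by (simp add: dirichlet_char_mult[OF \<phi>])
  qed
  also have "\<dots> = \<phi> (int p) * twisted_sigma \<phi> \<psi> j (p ^ i * m)"
    by (simp add: twisted_sigma_def sum_distrib_left)
  also have "sum (?f (?q * m)) ((\<lambda>e. ?q * e) ` {e. e dvd m}) =
      (\<Sum>e | e dvd m. (\<psi> (int p) * of_nat p ^ j) ^ Suc i * ?f m e)"
  proof (subst sum.reindex)
    show "inj_on (\<lambda>e. ?q * e) {e. e dvd m}" using p0 by (auto simp: inj_on_def)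
    have "?f (?q * m) (?q * e) = (\<psi> (int p) * of_nat p ^ j) ^ Suc i * ?f m e" for e
    proof -
      have "?q * m div (?q * e) = m div e" using p0 by (intro div_mult_mult1) simp
      moreover have "\<psi> (int (?q * e)) = \<psi> (int p) ^ Suc i * \<psi> (int e)"
        using dirichlet_char_mult[OF \<psi>] dirichlet_char_power[OF \<psi>]
        by (metis of_nat_mult of_nat_power)
      ultimately show ?thesis
        by (simp add: power_mult_distrib ac_simps flip: power_mult)
    qed
    then show "sum (?f (?q * m) \<circ> (\<lambda>e. ?q * e)) {e. e dvd m} =
        (\<Sum>e | e dvd m. (\<psi> (int p) * of_nat p ^ j) ^ Suc i * ?f m e)"
      by simp
  qed
  also have "\<dots> = (\<psi> (int p) * of_nat p ^ j) ^ Suc i * twisted_sigma \<phi> \<psi> j m"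
    by (simp add: twisted_sigma_def sum_distrib_left)
  finally show ?thesis .
qed

text \<open>The complete homogeneous symmetric polynomial of degree \<open>i\<close> in
  \<open>x\<close> and \<open>y\<close>, that is, the coefficient of \<open>T ^ i\<close> in
  \<open>1 / ((1 - x * T) * (1 - y * T))\<close>, the Euler factor of the divisor sum.\<close>

definition geom_conv :: "complex \<Rightarrow> complex \<Rightarrow> nat \<Rightarrow> complex" where
  "geom_conv x y i = (\<Sum>t\<le>i. x ^ (i - t) * y ^ t)"

lemma geom_conv_0 [simp]: "geom_conv x y 0 = 1"
  by (simp add: geom_conv_def)

lemma geom_conv_Suc: "geom_conv x y (Suc i) = x * geom_conv x y i + y ^ Suc i"
  by (simp add: geom_conv_def sum_distrib_left Suc_diff_le mult.assoc)

lemma geom_conv_diff: "(y - x) * geom_conv x y i = y ^ Suc i - x ^ Suc i"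
proof (induction i)
  case (Suc i)
  have "(y - x) * geom_conv x y (Suc i) = x * ((y - x) * geom_conv x y i) + (y - x) * y ^ Suc i"
    by (simp add: geom_conv_Suc algebra_simps)
  also have "\<dots> = x * (y ^ Suc i - x ^ Suc i) + (y - x) * y ^ Suc i" unfolding Suc.IH ..
  also have "\<dots> = y ^ Suc (Suc i) - x ^ Suc (Suc i)" by (simp add: algebra_simps)
  finally show ?case .
qed simp

lemma twisted_sigma_prime_power:
  assumes "dirichlet_char N1 \<phi>" "dirichlet_char N2 \<psi>" "prime p" "\<not> p dvd m" "m > 0"
  shows "twisted_sigma \<phi> \<psi> j (p ^ i * m) =
    geom_conv (\<phi> (int p)) (\<psi> (int p) * of_nat p ^ j) i * twisted_sigma \<phi> \<psi> j m"
proof (induction i)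
  case (Suc i)
  then show ?case
    using twisted_sigma_prime_step[OF assms, of j i] by (simp add: geom_conv_Suc algebra_simps)
qed simp

text \<open>An operator on sequences: a linear combination of the dilations taking
  \<open>a n\<close> to \<open>a (w * n)\<close>. Such operators commute and compose, so one that
  annihilates a sequence still does so after composition with others.\<close>

definition weighted :: "(complex \<times> nat) list \<Rightarrow> (nat \<Rightarrow> complex) \<Rightarrow> nat \<Rightarrow> complex" where
  "weighted ws a n = (\<Sum>(l, w)\<leftarrow>ws. l * a (w * n))"

lemma weighted_Nil [simp]: "weighted [] a n = 0"
  and weighted_Cons [simp]: "weighted ((l, w) # ws) a n = l * a (w * n) + weighted ws a n"
  by (simp_all add: weighted_def)

lemma weighted_append [simp]: "weighted (ws @ vs) a n = weighted ws a n + weighted vs a n"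
  by (simp add: weighted_def)

lemma weighted_cong:
  "(\<And>l w. (l, w) \<in> set ws \<Longrightarrow> a (w * n) = b (w * m)) \<Longrightarrow> weighted ws a n = weighted ws b m"
  unfolding weighted_def by (intro arg_cong[where f = sum_list] map_cong) auto

lemma weighted_sum: "weighted ws (\<lambda>n. \<Sum>i\<in>T. c i * a i n) n = (\<Sum>i\<in>T. c i * weighted ws (a i) n)"
  by (induction ws) (auto simp: algebra_simps sum.distrib sum_distrib_left)

lemma weighted_mult: "weighted ws (\<lambda>n. c * a n) n = c * weighted ws a n"
  by (induction ws) (auto simp: algebra_simps)

lemma weighted_add: "weighted ws (\<lambda>n. a n + b n) n = weighted ws a n + weighted ws b n"
  by (induction ws) (auto simp: algebra_simps)

lemma weighted_commute: "weighted ws (weighted vs a) n = weighted vs (weighted ws a) n"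
proof (induction ws)
  case Nil
  show ?case by (induction vs) auto
next
  case (Cons x ws)
  obtain l w where x: "x = (l, w)" by force
  have "l * weighted vs a (w * n) = weighted vs (\<lambda>n. l * a (w * n)) n"
    by (induction vs) (auto simp: algebra_simps)
  then show ?case
    using Cons.IH weighted_add[of vs "\<lambda>n. l * a (w * n)" "weighted ws a" n] by (simp add: x)
qed

definition compose_weights :: "(complex \<times> nat) list \<Rightarrow> (complex \<times> nat) list \<Rightarrow> (complex \<times> nat) list" where
  "compose_weights ws vs = concat (map (\<lambda>(l, w). map (\<lambda>(k, v). (l * k, v * w)) vs) ws)"

lemma weighted_compose: "weighted (compose_weights ws vs) a n = weighted ws (weighted vs a) n"
proof (induction ws)
  case (Cons x ws)
  obtain l w where x: "x = (l, w)" by force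
  have "weighted (map (\<lambda>(k, v). (l * k, v * w)) vs) a n = l * weighted vs a (w * n)"
    by (induction vs) (auto simp: algebra_simps)
  then show ?case using Cons.IH by (simp add: compose_weights_def x)
qed (simp add: compose_weights_def)

text \<open>Neither the product of the characters nor its parity is prescribed, so that newforms
  with character \<eta> and their conjugates are covered together.\<close>

definition primitive_pair :: "nat \<Rightarrow> (int \<Rightarrow> complex) \<times> (int \<Rightarrow> complex) \<Rightarrow> bool" where
  "primitive_pair N = (\<lambda>(\<phi>, \<psi>). \<exists>N1 N2. primitive_char N1 \<phi> \<and> primitive_char N2 \<psi> \<and> N1 * N2 dvd N)"

abbreviation pair_sigma :: "nat \<Rightarrow> (int \<Rightarrow> complex) \<times> (int \<Rightarrow> complex) \<Rightarrow> nat \<Rightarrow> complex" where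
  "pair_sigma j \<Phi> \<equiv> twisted_sigma (fst \<Phi>) (snd \<Phi>) j"

text \<open>With \<open>x\<^sub>1 = \<phi> p\<close> and \<open>x\<^sub>2 = \<psi> p * p ^ j\<close>, the sequence \<open>i \<mapsto> \<sigma> (p ^ i)\<close> satisfies the linear
  recurrence with roots \<open>x\<^sub>1\<close>, \<open>x\<^sub>2\<close>, so that the polynomial with the roots belonging to another pair,
  and one of \<open>x\<^sub>1\<close>, \<open>x\<^sub>2\<close>, annihilates the other pair and leaves a nonzero multiple of this one.\<close>

lemma separate_two_pairs:
  assumes \<Phi>: "primitive_pair N \<Phi>" and \<Psi>: "primitive_pair N \<Psi>" and ne: "\<Phi> \<noteq> \<Psi>"
    and "N > 0" "M > 0" "j > 0"
  shows "\<exists>ws p \<kappa>. prime p \<and> \<not> p dvd N \<and> \<not> p dvd M \<and> (\<forall>(l, w)\<in>set ws. \<exists>i. w = p ^ i) \<and>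
    (\<forall>n>0. weighted ws (pair_sigma j \<Psi>) n = 0) \<and> \<kappa> \<noteq> 0 \<and>
    (\<forall>n>0. \<not> p dvd n \<longrightarrow> weighted ws (pair_sigma j \<Phi>) n = \<kappa> * pair_sigma j \<Phi> n)"
proof -
  obtain \<phi> \<phi>' N1 N1' where \<Phi>_eq: "\<Phi> = (\<phi>, \<phi>')" and
    p\<phi>: "primitive_char N1 \<phi>" "primitive_char N1' \<phi>'" and "N1 * N1' dvd N"
    using \<Phi> by (auto simp: primitive_pair_def)
  obtain \<psi> \<psi>' N2 N2' where \<Psi>_eq: "\<Psi> = (\<psi>, \<psi>')" and
    p\<psi>: "primitive_char N2 \<psi>" "primitive_char N2' \<psi>'" and "N2 * N2' dvd N"
    using \<Psi> by (auto simp: primitive_pair_def)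
  have dvd: "N1 dvd N" "N1' dvd N" "N2 dvd N" "N2' dvd N"
    using \<open>N1 * N1' dvd N\<close> \<open>N2 * N2' dvd N\<close> by (auto intro: dvd_mult_left dvd_mult_right)
  have chars: "dirichlet_char N1 \<phi>" "dirichlet_char N1' \<phi>'" "dirichlet_char N2 \<psi>" "dirichlet_char N2' \<psi>'"
    using p\<phi> p\<psi> by (simp_all add: primitive_char_def)
  obtain p where p: "prime p" "\<not> p dvd N" "\<not> p dvd M"
    and diff: "\<phi> (int p) \<noteq> \<psi> (int p) \<or> \<phi>' (int p) \<noteq> \<psi>' (int p)"
    using ne primitive_chars_differ_at_prime[OF p\<phi>(1) p\<psi>(1) _ \<open>N > 0\<close> dvd(1,3) \<open>M > 0\<close>]
      primitive_chars_differ_at_prime[OF p\<phi>(2) p\<psi>(2) _ \<open>N > 0\<close> dvd(2,4) \<open>M > 0\<close>]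
    unfolding \<Phi>_eq \<Psi>_eq by blast
  define x1 where "x1 = \<phi> (int p)"
  define x2 where "x2 = \<phi>' (int p) * of_nat p ^ j"
  define y1 where "y1 = \<psi> (int p)"
  define y2 where "y2 = \<psi>' (int p) * of_nat p ^ j"
  have cop: "coprime (int p) (int m)" if "m dvd N" for m
    using that p(1,2) by (metis coprime_int_iff dvd_trans prime_imp_coprime)
  have nrm: "cmod (\<theta> (int p)) = 1" if "dirichlet_char m \<theta>" "m dvd N" for m \<theta>
    using that cop dirichlet_char_norm[of m \<theta> "int p"] dirichlet_char_nonzero_iff[of m \<theta> "int p"]
    by blast
  have "real p ^ j > 1"
    using prime_gt_1_nat[OF p(1)] \<open>j > 0\<close> by (intro one_less_power) auto
  then have norms: "cmod x1 = 1" "cmod x2 > 1" "cmod y1 = 1" "cmod y2 > 1"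
    unfolding x1_def x2_def y1_def y2_def
    using nrm chars dvd by (auto simp: norm_mult norm_power)
  have diff': "x1 \<noteq> y1 \<or> x2 \<noteq> y2"
    using diff p(1) by (auto simp: x1_def x2_def y1_def y2_def)
  have ne': "x1 \<noteq> y2" "x2 \<noteq> y1" "x1 \<noteq> 0" "x2 \<noteq> 0" using norms by auto
  \<comment> \<open>\<open>z\<close> is the root of \<Phi> to be annihilated besides
    \<open>y1\<close> and \<open>y2\<close>. The other root must survive, so it must differ from
    \<open>y1\<close> and \<open>y2\<close>; across the two kinds of roots the absolute values
    already differ.\<close>
  define z where "z = (if x2 \<noteq> y2 then x1 else x2)"
  \<comment> \<open>With \<open>P = (X - z) * (X - y1) * (X - y2)\<close>, applying \<open>P\<close>
    to the sequence \<open>geom_conv x1 x2\<close> gives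
    \<open>(x2 * P(x2) - x1 * P(x1)) / (x2 - x1)\<close> at index \<open>0\<close>. One of the two
    values of \<open>P\<close> is zero, and the denominator cancels.\<close>
  define \<kappa> where "\<kappa> = (if x2 \<noteq> y2 then x2 * (x2 - y1) * (x2 - y2) else x1 * (x1 - y1) * (x1 - y2))"
  have "\<kappa> \<noteq> 0" using diff' ne' by (auto simp: \<kappa>_def)
  define ws where "ws = [(- (z * y1 * y2), p ^ 0), (z * y1 + z * y2 + y1 * y2, p ^ 1),
      (- (z + y1 + y2), p ^ 2), (1, p ^ 3)]"
  have g2: "geom_conv x y (i + 2) = (x + y) * geom_conv x y (i + 1) - x * y * geom_conv x y i"
    and g3: "geom_conv x y (i + 3) = (x + y) * geom_conv x y (i + 2) - x * y * geom_conv x y (i + 1)"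
    for x y i
    by (simp_all add: geom_conv_Suc numeral_2_eq_2 numeral_3_eq_3 algebra_simps)
  have "weighted ws (pair_sigma j \<Psi>) n = 0" if pos: "n > 0" for n
  proof -
    \<comment> \<open>A factor \<open>p ^ i\<close> of \<open>n\<close> only moves the starting
      point of the recurrence, so the annihilation holds for every positive
      \<open>n\<close>.\<close>
    obtain i m where n: "n = p ^ i * m" "\<not> p dvd m"
      using prime_power_canonical[OF p(1) pos] by (auto simp: mult.commute)
    have "m > 0" using n pos by (auto intro: Nat.gr0I)
    have "pair_sigma j \<Psi> (p ^ e * n) = geom_conv y1 y2 (i + e) * pair_sigma j \<Psi> m" for e
      using twisted_sigma_prime_power[OF chars(3,4) p(1) n(2) \<open>m > 0\<close>, of j "e + i"]
      by (simp add: \<Psi>_eq n(1) y1_def y2_def power_add ac_simps)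
    moreover define u where "u e = pair_sigma j \<Psi> (p ^ e * n)" for e
    ultimately have u: "u e = geom_conv y1 y2 (i + e) * pair_sigma j \<Psi> m" for e by simp
    have u2: "u 2 = (y1 + y2) * u 1 - y1 * y2 * u 0" and u3: "u 3 = (y1 + y2) * u 2 - y1 * y2 * u 1"
      unfolding u g2 g3 by (simp_all add: algebra_simps)
    have "weighted ws (pair_sigma j \<Psi>) n =
        - (z * y1 * y2) * u 0 + (z * y1 + z * y2 + y1 * y2) * u 1 - (z + y1 + y2) * u 2 + u 3"
      by (simp add: ws_def u_def algebra_simps)
    also have "\<dots> = 0" unfolding u3 u2 by (simp add: algebra_simps)
    finally show ?thesis .
  qed
  moreover have "weighted ws (pair_sigma j \<Phi>) n = \<kappa> * pair_sigma j \<Phi> n" if "n > 0" "\<not> p dvd n" for n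
  proof -
    have *: "pair_sigma j \<Phi> (p ^ e * n) = geom_conv x1 x2 e * pair_sigma j \<Phi> n" for e
      using twisted_sigma_prime_power[OF chars(1,2) p(1) that(2,1), of j e]
      by (simp add: \<Phi>_eq x1_def x2_def)
    have "geom_conv x1 x2 1 = x1 + x2" "geom_conv x1 x2 2 = x1 * x1 + x1 * x2 + x2 * x2"
      "geom_conv x1 x2 3 = x1 * x1 * x1 + x1 * x1 * x2 + x1 * x2 * x2 + x2 * x2 * x2"
      by (simp_all add: geom_conv_Suc numeral_2_eq_2 numeral_3_eq_3 algebra_simps)
    note g = this
    define u where "u e = pair_sigma j \<Phi> (p ^ e * n)" for e
    have u: "u 0 = pair_sigma j \<Phi> n" "u 1 = (x1 + x2) * pair_sigma j \<Phi> n"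
      "u 2 = (x1 * x1 + x1 * x2 + x2 * x2) * pair_sigma j \<Phi> n"
      "u 3 = (x1 * x1 * x1 + x1 * x1 * x2 + x1 * x2 * x2 + x2 * x2 * x2) * pair_sigma j \<Phi> n"
      unfolding u_def * g by simp_all
    have "weighted ws (pair_sigma j \<Phi>) n =
        - (z * y1 * y2) * u 0 + (z * y1 + z * y2 + y1 * y2) * u 1 - (z + y1 + y2) * u 2 + u 3"
      by (simp add: ws_def u_def algebra_simps)
    also have "\<dots> = (- (z * y1 * y2) + (z * y1 + z * y2 + y1 * y2) * (x1 + x2)
        - (z + y1 + y2) * (x1 * x1 + x1 * x2 + x2 * x2)
        + (x1 * x1 * x1 + x1 * x1 * x2 + x1 * x2 * x2 + x2 * x2 * x2)) * pair_sigma j \<Phi> n"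
      unfolding u by (simp only: left_diff_distrib distrib_right mult.assoc)
    also have "- (z * y1 * y2) + (z * y1 + z * y2 + y1 * y2) * (x1 + x2)
        - (z + y1 + y2) * (x1 * x1 + x1 * x2 + x2 * x2)
        + (x1 * x1 * x1 + x1 * x1 * x2 + x1 * x2 * x2 + x2 * x2 * x2) = \<kappa>"
      by (cases "x2 = y2") (simp_all add: \<kappa>_def z_def algebra_simps)
    finally show ?thesis .
  qed
  moreover have "\<forall>(l, w)\<in>set ws. \<exists>i. w = p ^ i"
    unfolding ws_def by (auto intro: exI[of _ 0] exI[of _ 1])
  ultimately show ?thesis using p \<open>\<kappa> \<noteq> 0\<close> by blast
qed

text \<open>The operators for the single members of \<open>\<Y>\<close> are composed. Each new prime
  avoids \<open>M\<close>, which collects the primes used before, so that the earlier eigenvalue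
  property survives dilation by its powers. Weights prime to \<open>N\<close> do not interfere with
  shifts by divisors of \<open>N\<close>.\<close>

lemma separate_pair:
  assumes "finite \<Y>" "\<And>\<Psi>. \<Psi> \<in> \<Y> \<Longrightarrow> primitive_pair N \<Psi>" "primitive_pair N \<Phi>" "\<Phi> \<notin> \<Y>"
    and "N > 0" "j > 0"
  shows "\<exists>ws M \<kappa>. (\<forall>(l, w)\<in>set ws. w > 0 \<and> coprime w N) \<and>
    (\<forall>\<Psi>\<in>\<Y>. \<forall>n>0. weighted ws (pair_sigma j \<Psi>) n = 0) \<and> M > 0 \<and> \<kappa> \<noteq> 0 \<and>
    (\<forall>n>0. coprime n M \<longrightarrow> weighted ws (pair_sigma j \<Phi>) n = \<kappa> * pair_sigma j \<Phi> n)"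
  using assms(1,2,4)
proof (induction \<Y>)
  case empty
  show ?case by (rule exI[of _ "[(1, 1)]"], rule exI[of _ 1], rule exI[of _ 1]) simp
next
  case (insert \<Psi> \<Y>)
  have "primitive_pair N \<Theta>" if "\<Theta> \<in> \<Y>" for \<Theta> using that insert.prems(1) by blast
  moreover have "\<Phi> \<notin> \<Y>" using insert.prems(2) by blast
  ultimately obtain ws M \<kappa> where *: "(\<forall>(l, w)\<in>set ws. w > 0 \<and> coprime w N) \<and>
    (\<forall>\<Psi>\<in>\<Y>. \<forall>n>0. weighted ws (pair_sigma j \<Psi>) n = 0) \<and> M > 0 \<and> \<kappa> \<noteq> 0 \<and>
    (\<forall>n>0. coprime n M \<longrightarrow> weighted ws (pair_sigma j \<Phi>) n = \<kappa> * pair_sigma j \<Phi> n)"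
    using insert.IH by blast
  then have ws: "\<And>l w. (l, w) \<in> set ws \<Longrightarrow> w > 0 \<and> coprime w N" by auto
  from * have kill: "\<And>\<Psi> n. \<Psi> \<in> \<Y> \<Longrightarrow> n > 0 \<Longrightarrow> weighted ws (pair_sigma j \<Psi>) n = 0"
    and "M > 0" "\<kappa> \<noteq> 0"
    and scale: "\<And>n. n > 0 \<Longrightarrow> coprime n M \<Longrightarrow> weighted ws (pair_sigma j \<Phi>) n = \<kappa> * pair_sigma j \<Phi> n"
    by blast+
  have "primitive_pair N \<Psi>" "\<Phi> \<noteq> \<Psi>" using insert by auto
  then obtain vs p \<mu> where **: "prime p \<and> \<not> p dvd N \<and> \<not> p dvd M \<and> (\<forall>(l, w)\<in>set vs. \<exists>i. w = p ^ i) \<and>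
    (\<forall>n>0. weighted vs (pair_sigma j \<Psi>) n = 0) \<and> \<mu> \<noteq> 0 \<and>
    (\<forall>n>0. \<not> p dvd n \<longrightarrow> weighted vs (pair_sigma j \<Phi>) n = \<mu> * pair_sigma j \<Phi> n)"
    using separate_two_pairs[OF assms(3) _ _ \<open>N > 0\<close> \<open>M > 0\<close> \<open>j > 0\<close>, of \<Psi>] by blast
  then have p: "prime p" "\<not> p dvd N" "\<not> p dvd M"
    and kill': "\<And>n. n > 0 \<Longrightarrow> weighted vs (pair_sigma j \<Psi>) n = 0" and "\<mu> \<noteq> 0"
    and scale': "\<And>n. n > 0 \<Longrightarrow> \<not> p dvd n \<Longrightarrow> weighted vs (pair_sigma j \<Phi>) n = \<mu> * pair_sigma j \<Phi> n"
    by blast+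
  from ** have vs: "\<And>l w. (l, w) \<in> set vs \<Longrightarrow> \<exists>i. w = p ^ i" by auto
  have vs_pos: "w > 0" "coprime w N" "coprime w M" if lw: "(l, w) \<in> set vs" for l w
    using vs[OF lw] p prime_gt_0_nat[OF p(1)] by (auto intro: prime_imp_coprime)
  let ?zs = "compose_weights vs ws"
  have "w > 0 \<and> coprime w N" if "(l, w) \<in> set ?zs" for l w
  proof -
    have "\<exists>k v k' v'. w = v * v' \<and> (k, v) \<in> set ws \<and> (k', v') \<in> set vs"
      using that by (auto simp: compose_weights_def)
    then show ?thesis using ws vs_pos by force
  qed
  then have "\<forall>(l, w)\<in>set ?zs. w > 0 \<and> coprime w N" by auto
  moreover have "weighted ?zs (pair_sigma j \<Theta>) n = 0" if "\<Theta> \<in> insert \<Psi> \<Y>" "n > 0" for \<Theta> n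
  proof (cases "\<Theta> = \<Psi>")
    case True
    have "weighted ws (weighted vs (pair_sigma j \<Theta>)) n = weighted ws (\<lambda>_. 0) n"
      by (rule weighted_cong) (use ws kill' True \<open>n > 0\<close> in auto)
    also have "\<dots> = 0" by (induction ws) auto
    finally show ?thesis by (simp add: weighted_compose weighted_commute)
  next
    case False
    have "weighted vs (weighted ws (pair_sigma j \<Theta>)) n = weighted vs (\<lambda>_. 0) n"
      by (rule weighted_cong) (use vs_pos kill that False in auto)
    also have "\<dots> = 0" by (induction vs) auto
    finally show ?thesis by (simp add: weighted_compose)
  qed
  moreover have "weighted ?zs (pair_sigma j \<Phi>) n = \<mu> * \<kappa> * pair_sigma j \<Phi> n"
    if "n > 0" "coprime n (p * M)" for n
  proof -
    have n: "\<not> p dvd n" "coprime n M"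
      using that(2) p(1) coprime_common_divisor[of n "p * M" p] not_prime_unit by auto
    have "weighted vs (weighted ws (pair_sigma j \<Phi>)) n = weighted vs (\<lambda>m. \<kappa> * pair_sigma j \<Phi> m) n"
      by (rule weighted_cong) (use vs_pos scale n \<open>n > 0\<close> in auto)
    also have "\<dots> = \<kappa> * (\<mu> * pair_sigma j \<Phi> n)"
      by (simp add: weighted_mult scale'[OF \<open>n > 0\<close> n(1)])
    finally show ?thesis by (simp add: weighted_compose)
  qed
  moreover have "p * M > 0" "\<mu> * \<kappa> \<noteq> 0"
    using prime_gt_0_nat[OF p(1)] \<open>M > 0\<close> \<open>\<mu> \<noteq> 0\<close> \<open>\<kappa> \<noteq> 0\<close> by auto
  ultimately show ?case by blast
qed

definition shifted_sigma ::
    "nat \<Rightarrow> ((int \<Rightarrow> complex) \<times> (int \<Rightarrow> complex)) \<times> nat \<Rightarrow> nat \<Rightarrow> complex" where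
  "shifted_sigma j = (\<lambda>(\<Phi>, d) n. if d dvd n then pair_sigma j \<Phi> (n div d) else 0)"

text \<open>One pair \<Phi> is isolated by \<open>separate_pair\<close>, and the relation is
  evaluated at the least shift \<open>d\<close> at which \<Phi> has a nonzero coefficient. Shifts
  not dividing \<open>d\<close> contribute nothing there and smaller ones have coefficient zero, so
  only \<open>\<kappa> * c (\<Phi>, d)\<close> remains.\<close>

theorem shifted_sigma_independent:
  assumes "finite T" and T: "\<And>\<Phi> d. (\<Phi>, d) \<in> T \<Longrightarrow> primitive_pair N \<Phi> \<and> d dvd N"
    and "N > 0" "j > 0"
    and rel: "\<And>n. n > 0 \<Longrightarrow> (\<Sum>i\<in>T. c i * shifted_sigma j i n) = 0"
  shows "\<forall>i\<in>T. c i = 0"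
proof (rule ccontr)
  assume "\<not> ?thesis"
  then obtain \<Phi> d' where d': "(\<Phi>, d') \<in> T" "c (\<Phi>, d') \<noteq> 0" by auto
  define d where "d = (LEAST d. (\<Phi>, d) \<in> T \<and> c (\<Phi>, d) \<noteq> 0)"
  have d: "(\<Phi>, d) \<in> T" "c (\<Phi>, d) \<noteq> 0"
    using LeastI[of "\<lambda>d. (\<Phi>, d) \<in> T \<and> c (\<Phi>, d) \<noteq> 0"] d' by (auto simp: d_def)
  have least: "c (\<Phi>, e) = 0" if "(\<Phi>, e) \<in> T" "e < d" for e
    using not_less_Least that unfolding d_def by blast
  have "d > 0" using T[OF d(1)] \<open>N > 0\<close> by (auto intro: Nat.gr0I)
  have "primitive_pair N \<Psi>" if "\<Psi> \<in> fst ` T - {\<Phi>}" for \<Psi>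
    using that T by auto
  then obtain ws M \<kappa> where *: "(\<forall>(l, w)\<in>set ws. w > 0 \<and> coprime w N) \<and>
    (\<forall>\<Psi>\<in>fst ` T - {\<Phi>}. \<forall>n>0. weighted ws (pair_sigma j \<Psi>) n = 0) \<and> M > 0 \<and> \<kappa> \<noteq> 0 \<and>
    (\<forall>n>0. coprime n M \<longrightarrow> weighted ws (pair_sigma j \<Phi>) n = \<kappa> * pair_sigma j \<Phi> n)"
    using separate_pair[of "fst ` T - {\<Phi>}" N \<Phi> j] \<open>finite T\<close> T[OF d(1)] \<open>N > 0\<close> \<open>j > 0\<close>
    by blast
  then have kill: "\<And>\<Psi> n. \<Psi> \<in> fst ` T - {\<Phi>} \<Longrightarrow> n > 0 \<Longrightarrow> weighted ws (pair_sigma j \<Psi>) n = 0"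
    and "\<kappa> \<noteq> 0"
    and scale: "\<And>n. n > 0 \<Longrightarrow> coprime n M \<Longrightarrow> weighted ws (pair_sigma j \<Phi>) n = \<kappa> * pair_sigma j \<Phi> n"
    by blast+
  from * have ws: "\<And>l w. (l, w) \<in> set ws \<Longrightarrow> w > 0 \<and> coprime w N" by auto
  have sh: "weighted ws (shifted_sigma j (\<Psi>, e)) d =
      (if e dvd d then weighted ws (pair_sigma j \<Psi>) (d div e) else 0)" if "(\<Psi>, e) \<in> T" for \<Psi> e
  proof -
    \<comment> \<open>The weights are prime to \<open>N\<close>, hence to \<open>e\<close>: dilation
      does not change which shifts are visible at \<open>d\<close>.\<close>
    have "e dvd w * d \<longleftrightarrow> e dvd d" if lw: "(l, w) \<in> set ws" for l w
      using ws[OF lw] T[OF \<open>(\<Psi>, e) \<in> T\<close>]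
      by (metis coprime_commute coprime_divisors coprime_dvd_mult_right_iff dvd_refl)
    then have "weighted ws (shifted_sigma j (\<Psi>, e)) d =
        weighted ws (\<lambda>n. if e dvd d then pair_sigma j \<Psi> n else 0) (d div e)"
      by (intro weighted_cong) (auto simp: shifted_sigma_def div_mult_swap)
    also have "\<dots> = (if e dvd d then weighted ws (pair_sigma j \<Psi>) (d div e) else 0)"
      by (induction ws) auto
    finally show ?thesis .
  qed
  have "weighted ws (\<lambda>n. \<Sum>i\<in>T. c i * shifted_sigma j i n) d = weighted ws (\<lambda>_. 0) d"
    by (rule weighted_cong) (use ws rel \<open>d > 0\<close> in auto)
  also have "\<dots> = 0" by (induction ws) auto
  finally have "0 = (\<Sum>i\<in>T. c i * weighted ws (shifted_sigma j i) d)"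
    by (simp only: weighted_sum)
  also have "\<dots> = (\<Sum>i\<in>T. if i = (\<Phi>, d) then c i * weighted ws (pair_sigma j \<Phi>) 1 else 0)"
  proof (intro sum.cong refl, clarify)
    fix \<Psi> e assume i: "(\<Psi>, e) \<in> T"
    show "c (\<Psi>, e) * weighted ws (shifted_sigma j (\<Psi>, e)) d =
        (if (\<Psi>, e) = (\<Phi>, d) then c (\<Psi>, e) * weighted ws (pair_sigma j \<Phi>) 1 else 0)"
    proof (cases "\<Psi> = \<Phi>")
      case True
      show ?thesis
      proof (cases "e < d")
        case True
        then show ?thesis using least i \<open>\<Psi> = \<Phi>\<close> by auto
      next
        case False
        then have "e dvd d \<longleftrightarrow> e = d" using \<open>d > 0\<close> by (auto dest: dvd_imp_le)
        then show ?thesis using sh[OF i] \<open>\<Psi> = \<Phi>\<close> \<open>d > 0\<close> by auto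
      qed
    next
      case False
      have "weighted ws (pair_sigma j \<Psi>) (d div e) = 0" if "e dvd d"
        using that i False \<open>d > 0\<close>
        by (intro kill) (auto simp: image_iff dvd_div_eq_0_iff intro!: bexI[of _ "(\<Psi>, e)"])
      then show ?thesis using sh[OF i] False by auto
    qed
  qed
  also have "\<dots> = c (\<Phi>, d) * weighted ws (pair_sigma j \<Phi>) 1"
    using \<open>finite T\<close> d(1) by simp
  also have "weighted ws (pair_sigma j \<Phi>) 1 = \<kappa>"
    using scale[of 1] T[OF d(1)] twisted_sigma_1
    by (auto simp: primitive_pair_def primitive_char_def)
  finally show False using d(2) \<open>\<kappa> \<noteq> 0\<close> by simp
qed


section \<open>Values of Dirichlet L-functions\<close>

lemma norm_powr_of_real: "x > 0 \<Longrightarrow> cmod (of_real x powr s) = x powr Re s"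
  by (subst norm_powr_real_powr) auto

text \<open>The general term of the Hurwitz zeta function satisfies the assumption with \<open>b = 0\<close>,
  Taylor remainders of order \<open>J\<close> satisfy it with \<open>b = J\<close>.\<close>

lemma holomorphic_on_suminf_powr:
  fixes f :: "nat \<Rightarrow> complex \<Rightarrow> complex" and C :: "complex \<Rightarrow> real"
  assumes x: "x > 0" and hol: "\<And>n. f n holomorphic_on UNIV" and C: "continuous_on UNIV C"
    and le: "\<And>n s. Re s + b > 1 \<Longrightarrow> cmod (f n s) \<le> C s * (real n + x) powr - (Re s + b)"
  shows "(\<lambda>s. \<Sum>n. f n s) holomorphic_on {s. Re s > 1 - b}"
    and "Re s > 1 - b \<Longrightarrow> summable (\<lambda>n. f n s)"
proof -
  let ?S = "{s. Re s > 1 - b}"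
  have S: "open ?S" by (rule open_halfspace_Re_gt)
  have "\<exists>g g'. \<forall>s\<in>?S. (\<lambda>n. f n s) sums g s \<and> (\<lambda>n. deriv (f n) s) sums g' s \<and>
      (g has_field_derivative g' s) (at s)"
  proof (rule series_and_derivative_comparison_local[OF S])
    show "(f n has_field_derivative deriv (f n) s) (at s)" for n s
      using hol by (intro holomorphic_derivI[of _ UNIV]) auto
    fix s assume s: "s \<in> ?S"
    define d where "d = (Re s + b - 1) / 2"
    have d: "d > 0" using s by (simp add: d_def)
    have "compact (C ` cball s d)"
      using C by (intro compact_continuous_image) (auto intro: continuous_on_subset)
    then obtain B where "\<forall>r\<in>C ` cball s d. \<bar>r\<bar> \<le> B"
      using compact_imp_bounded[of "C ` cball s d"] unfolding bounded_real by blast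
    then have B: "C y \<le> B" if "y \<in> cball s d" for y
      using that by (meson abs_le_D1 imageI)
    define h where "h n = \<bar>B\<bar> * real n powr - (1 + d)" for n
    have "summable h"
      unfolding h_def using d by (intro summable_mult) (simp add: summable_real_powr_iff)
    moreover have "\<forall>\<^sub>F n in sequentially. \<forall>y\<in>ball s d \<inter> ?S. norm (f n y) \<le> h n"
      using eventually_gt_at_top[of 0]
    proof (eventually_elim, intro ballI)
      fix n :: nat and y assume n: "n > 0" and y: "y \<in> ball s d \<inter> ?S"
      have "\<bar>Re s - Re y\<bar> \<le> cmod (s - y)" using abs_Re_le_cmod[of "s - y"] by simp
      moreover have "cmod (s - y) < d" using y by (simp add: dist_norm)
      ultimately have y': "Re y + b > 1 + d" unfolding d_def by (simp add: field_simps)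
      have "norm (f n y) \<le> C y * (real n + x) powr - (Re y + b)"
        using le y' d by (auto intro: order.trans)
      also have "\<dots> \<le> \<bar>B\<bar> * (real n + x) powr - (Re y + b)"
        using B[of y] y by (intro mult_right_mono) auto
      also have "(real n + x) powr - (Re y + b) \<le> real n powr - (Re y + b)"
        using n x y' d by (intro powr_mono2') auto
      also have "real n powr - (Re y + b) \<le> real n powr - (1 + d)"
        using n y' by (intro powr_mono) auto
      finally show "norm (f n y) \<le> h n" by (simp add: h_def mult_left_mono)
    qed
    ultimately show "\<exists>d h. 0 < d \<and> summable h \<and>
        (\<forall>\<^sub>F n in sequentially. \<forall>y\<in>ball s d \<inter> ?S. norm (f n y) \<le> h n)"
      using d by blast
  qed
  then obtain g g' where g: "\<And>s. s \<in> ?S \<Longrightarrow> (\<lambda>n. f n s) sums g s"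
    "\<And>s. s \<in> ?S \<Longrightarrow> (g has_field_derivative g' s) (at s)" by blast
  have "g holomorphic_on ?S"
    using g(2) S by (auto simp: holomorphic_on_open)
  then show "(\<lambda>s. \<Sum>n. f n s) holomorphic_on ?S"
    by (rule holomorphic_transform) (use g(1) sums_unique in blast)
  show "summable (\<lambda>n. f n s)" if "Re s > 1 - b"
    using g(1)[of s] that by (auto simp: summable_def)
qed

section \<open>Continuation of the Hurwitz zeta function and its values at
  \<open>1 - k\<close>\<close>

definition hurwitz_series :: "real \<Rightarrow> complex \<Rightarrow> complex" where
  "hurwitz_series x s = (\<Sum>n. of_real (real n + x) powr - s)"

lemma
  assumes "x > 0"
  shows hurwitz_series_holomorphic: "hurwitz_series x holomorphic_on {s. Re s > 1}"
    and hurwitz_series_sums: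
      "Re s > 1 \<Longrightarrow> (\<lambda>n. of_real (real n + x) powr - s) sums hurwitz_series x s"
proof -
  have le: "cmod (of_real (real n + x) powr - s) \<le> 1 * (real n + x) powr - (Re s + 0)" for n s
    using norm_powr_of_real[of "real n + x" "- s"] \<open>x > 0\<close> by simp
  have nz: "of_real (real n + x) \<noteq> (0::complex)" for n
    using \<open>x > 0\<close> by (metis add_nonneg_pos of_nat_0_le_iff of_real_eq_0_iff order_less_irrefl)
  have hol: "(\<lambda>s. of_real (real n + x) powr - s) holomorphic_on UNIV" for n
    using nz[of n] unfolding powr_def by (auto intro!: holomorphic_intros)
  have "(\<lambda>s. \<Sum>n. of_real (real n + x) powr - s :: complex) holomorphic_on {s. Re s > 1 - 0}"
    by (rule holomorphic_on_suminf_powr(1)[OF \<open>x > 0\<close> hol _ le]) auto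
  then show "hurwitz_series x holomorphic_on {s. Re s > 1}"
    by (simp add: hurwitz_series_def[abs_def])
  show "(\<lambda>n. of_real (real n + x) powr - s) sums hurwitz_series x s" if "Re s > 1"
    unfolding hurwitz_series_def
    using holomorphic_on_suminf_powr(2)[OF \<open>x > 0\<close> hol _ le, of s] that by (auto intro!: summable_sums)
qed

text \<open>The Taylor remainder of order \<open>J\<close> for the function \<open>u powr w\<close>,
  expanded about \<open>u = y\<close> and evaluated at \<open>u = y + 1\<close>.\<close>

definition powr_remainder :: "nat \<Rightarrow> real \<Rightarrow> complex \<Rightarrow> complex" where
  "powr_remainder J y w = of_real (y + 1) powr w - (\<Sum>j\<le>J. (w gchoose j) * of_real y powr (w - of_nat j))"

text \<open>Taylor's theorem on the segment from \<open>y\<close> to \<open>y + 1\<close>. The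
  assumption on \<open>Re w\<close> makes the bound on the derivative of order \<open>J + 1\<close>
  decrease along the segment, so its value at \<open>y\<close> dominates.\<close>

lemma norm_powr_remainder_le:
  assumes y: "y > 0" and w: "Re w \<le> real J + 1"
  shows "cmod (powr_remainder J y w) \<le>
    cmod (\<Prod>i<Suc J. w - of_nat i) / fact J * y powr (Re w - (real J + 1))"
proof -
  define f where "f i z = (\<Prod>l<i. w - of_nat l) * z powr (w - of_nat i)" for i z
  let ?S = "closed_segment (of_real y) (of_real (y + 1)) :: complex set"
  have S: "\<exists>u\<ge>y. z = of_real u" if "z \<in> ?S" for z
    using that unfolding closed_segment_of_real by (auto simp: closed_segment_eq_real_ivl)
  have "cmod (f 0 (of_real (y + 1)) - (\<Sum>i\<le>J. f i (of_real y) * (of_real (y + 1) - of_real y) ^ i / fact i))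
      \<le> cmod (\<Prod>i<Suc J. w - of_nat i) * y powr (Re w - (real J + 1)) * cmod (of_real (y + 1) - of_real y) ^ Suc J / fact J"
  proof (rule complex_Taylor[where S = ?S])
    fix i z assume "z \<in> ?S"
    then obtain u where u: "u \<ge> y" "z = of_real u" using S by blast
    then have "z \<notin> \<real>\<^sub>\<le>\<^sub>0" using y by (auto simp: complex_nonpos_Reals_iff)
    then have "(f i has_field_derivative (\<Prod>l<i. w - of_nat l) * ((w - of_nat i) * z powr (w - of_nat i - 1))) (at z within ?S)"
      unfolding f_def by (intro DERIV_cmult has_field_derivative_at_within[OF has_field_derivative_powr])
    then show "(f i has_field_derivative f (Suc i) z) (at z within ?S)"
      by (simp add: f_def algebra_simps)
  next
    fix z assume "z \<in> ?S"
    then obtain u where u: "u \<ge> y" "z = of_real u" using S by blast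
    have "cmod (z powr (w - of_nat (Suc J))) = u powr (Re w - (real J + 1))"
      using u y by (simp add: norm_powr_of_real algebra_simps)
    also have "\<dots> \<le> y powr (Re w - (real J + 1))"
      using u y w by (intro powr_mono2') auto
    finally show "cmod (f (Suc J) z) \<le> cmod (\<Prod>i<Suc J. w - of_nat i) * y powr (Re w - (real J + 1))"
      unfolding f_def norm_mult by (intro mult_left_mono) auto
  qed auto
  also have "f 0 (of_real (y + 1)) - (\<Sum>i\<le>J. f i (of_real y) * (of_real (y + 1) - of_real y) ^ i / fact i)
      = powr_remainder J y w"
    by (simp add: f_def powr_remainder_def gbinomial_prod_rev lessThan_atLeast0)
  finally show ?thesis by simp
qed

text \<open>Here the expansion is the finite binomial theorem. At \<open>s = 1 - k\<close> the
  infinite series in the recursion for the Hurwitz zeta function therefore vanishes and only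
  rational terms are left.\<close>

lemma powr_remainder_of_nat:
  assumes "y > 0" "k \<le> J"
  shows "powr_remainder J y (of_nat k) = 0"
proof -
  have y: "of_real y \<noteq> (0::complex)" "of_real (y + 1) \<noteq> (0::complex)"
    using assms(1) by (simp_all del: of_real_add)
  have "(\<Sum>j\<le>J. (of_nat k gchoose j) * of_real y powr (of_nat k - of_nat j)) =
      (\<Sum>j\<le>J. if j \<le> k then of_nat (k choose j) * of_real y ^ (k - j) else (0::complex))"
  proof (intro sum.cong refl)
    fix j
    show "(of_nat k gchoose j) * of_real y powr (of_nat k - of_nat j) =
        (if j \<le> k then of_nat (k choose j) * of_real y ^ (k - j) else (0::complex))"
    proof (cases "j \<le> k")
      case True
      then have "of_nat k - of_nat j = (of_nat (k - j) :: complex)" by (simp add: of_nat_diff)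
      then show ?thesis
        using True powr_complexpow[OF y(1), of "k - j"] by (simp only: binomial_gbinomial if_True)
    next
      case False
      then show ?thesis by (simp add: binomial_eq_0 flip: binomial_gbinomial)
    qed
  qed
  also have "\<dots> = (\<Sum>j\<le>k. of_nat (k choose j) * of_real y ^ (k - j))"
    using assms(2) by (intro sum.mono_neutral_cong_right) auto
  also have "\<dots> = (1 + of_real y) ^ k"
    by (subst binomial_ring) simp
  finally show ?thesis
    using y powr_complexpow[of "of_real (y + 1)" k] by (simp add: powr_remainder_def add.commute)
qed

text \<open>Each Taylor term that is subtracted improves the decay in \<open>n\<close> by one power,
  so the half-plane of convergence moves left by one with each increase of \<open>J\<close>.\<close>

lemma powr_remainder_series_holomorphic:
  assumes x: "x > 0"
  shows "(\<lambda>s. \<Sum>n. powr_remainder J (real n + x) (1 - s)) holomorphic_on {s. Re s > 1 - real J}"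
proof -
  let ?C = "\<lambda>s. cmod (\<Prod>i<Suc J. 1 - s - of_nat i) / fact J"
  have le: "cmod (powr_remainder J (real n + x) (1 - s)) \<le> ?C s * (real n + x) powr - (Re s + real J)"
    if "Re s + real J > 1" for n s
  proof -
    have "Re (1 - s) - (real J + 1) = - (Re s + real J)" by simp
    then show ?thesis using norm_powr_remainder_le[of "real n + x" "1 - s" J] x that by simp
  qed
  have nz: "of_real (real n + x) \<noteq> (0::complex)" "of_real (real n + x + 1) \<noteq> (0::complex)" for n
    using x by (simp_all del: of_real_add add: add_nonneg_eq_0_iff)
  have hol: "(\<lambda>s. powr_remainder J (real n + x) (1 - s)) holomorphic_on UNIV" for n
    unfolding powr_remainder_def using nz[of n]
    by (auto intro!: holomorphic_intros simp: gbinomial_prod_rev powr_def)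
  have C: "continuous_on UNIV ?C"
    by (intro continuous_intros) auto
  show ?thesis by (rule holomorphic_on_suminf_powr(1)[OF x hol C le])
qed

text \<open>Summing the Taylor expansions of \<open>(y + 1)\<^sup>1\<^sup>-\<^sup>s\<close> over \<open>y = n + x\<close>, the left-hand sides telescope.\<close>

lemma hurwitz_series_recursion:
  assumes x: "x > 0" and s: "Re s > 1" and J: "J \<ge> 1"
  shows "(s - 1) * hurwitz_series x s = of_real x powr (1 - s)
    - (\<Sum>j\<in>{2..J}. (1 - s gchoose (j - 1)) / of_nat j * ((s + of_nat j - 2) * hurwitz_series x (s + of_nat j - 1)))
    + (\<Sum>n. powr_remainder J (real n + x) (1 - s))"
proof -
  let ?y = "\<lambda>n. of_real (real n + x) :: complex"
  let ?w = "1 - s"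
  have sumsj: "(\<lambda>n. (?w gchoose j) * ?y n powr (?w - of_nat j)) sums
      ((?w gchoose j) * hurwitz_series x (s + of_nat j - 1))" if "j \<ge> 1" for j
  proof -
    have "Re (s + of_nat j - 1) > 1" using s that by simp
    from hurwitz_series_sums[OF x this]
    have "(\<lambda>n. ?y n powr (?w - of_nat j)) sums hurwitz_series x (s + of_nat j - 1)"
      by (simp add: algebra_simps)
    then show ?thesis by (rule sums_mult)
  qed
  have "(\<lambda>n. ?y n powr ?w) \<longlonglongrightarrow> 0"
  proof (rule tendsto_norm_zero_cancel)
    have "(\<lambda>n. (real n + x) powr - (Re s - 1)) \<longlonglongrightarrow> 0"
      using s filterlim_tendsto_add_at_top[OF tendsto_const filterlim_real_sequentially, of x]
      by (intro tendsto_neg_powr) (auto simp: add.commute)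
    moreover have "cmod (?y n powr ?w) = (real n + x) powr - (Re s - 1)" for n
      using x by (subst norm_powr_of_real) auto
    ultimately show "(\<lambda>n. cmod (?y n powr ?w)) \<longlonglongrightarrow> 0" by simp
  qed
  from telescope_sums[OF this]
  have tel: "(\<lambda>n. ?y (Suc n) powr ?w - ?y n powr ?w) sums (- (of_real x powr ?w))" by simp
  have split: "powr_remainder J (real n + x) ?w = (?y (Suc n) powr ?w - ?y n powr ?w)
      - (\<Sum>j\<in>{1..J}. (?w gchoose j) * ?y n powr (?w - of_nat j))" for n
  proof -
    have "{..J} = insert 0 {1..J}" by auto
    then show ?thesis by (simp add: powr_remainder_def add.commute add.left_commute)
  qed
  have "(\<lambda>n. powr_remainder J (real n + x) ?w) sums
      (- (of_real x powr ?w) - (\<Sum>j\<in>{1..J}. (?w gchoose j) * hurwitz_series x (s + of_nat j - 1)))"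
    unfolding split by (intro sums_diff tel sums_sum sumsj) auto
  then have R: "(\<Sum>n. powr_remainder J (real n + x) ?w) =
      - (of_real x powr ?w) - (\<Sum>j\<in>{1..J}. (?w gchoose j) * hurwitz_series x (s + of_nat j - 1))"
    by (rule sums_unique[symmetric])
  have "{1..J} = insert 1 {2..J}" using J by auto
  then have "(\<Sum>j\<in>{1..J}. (?w gchoose j) * hurwitz_series x (s + of_nat j - 1)) =
      ?w * hurwitz_series x s + (\<Sum>j\<in>{2..J}. (?w gchoose j) * hurwitz_series x (s + of_nat j - 1))"
    by simp
  also have "(\<Sum>j\<in>{2..J}. (?w gchoose j) * hurwitz_series x (s + of_nat j - 1)) =
      (\<Sum>j\<in>{2..J}. - ((?w gchoose (j - 1)) / of_nat j * ((s + of_nat j - 2) * hurwitz_series x (s + of_nat j - 1))))"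
  proof (intro sum.cong refl)
    fix j assume "j \<in> {2..J}"
    then obtain i where i: "j = Suc i" by (cases j) auto
    \<comment> \<open>The last factor of the binomial coefficient is, up to sign,
      \<open>s + j - 2\<close>. It turns the series at \<open>s' = s + j - 1\<close> into
      \<open>(s' - 1) * hurwitz_series x s'\<close>, the combination without a pole.\<close>
    have rec: "(?w gchoose Suc i) = (?w gchoose i) * (?w - of_nat i) / of_nat (Suc i)"
      using gbinomial_mult_1[of ?w i] by (simp add: field_simps del: of_nat_Suc)
    have e: "s + of_nat j - 2 = - (?w - of_nat i)" by (simp add: i)
    have "g * c / b * H = - (g / b * (- c * H))" for g c b H :: complex by simp
    then show "(?w gchoose j) * hurwitz_series x (s + of_nat j - 1) =
      - ((?w gchoose (j - 1)) / of_nat j * ((s + of_nat j - 2) * hurwitz_series x (s + of_nat j - 1)))"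
      unfolding e unfolding i diff_Suc_1 rec .
  qed
  finally have S: "(\<Sum>j\<in>{1..J}. (?w gchoose j) * hurwitz_series x (s + of_nat j - 1)) =
      ?w * hurwitz_series x s + - (\<Sum>j\<in>{2..J}. (?w gchoose (j - 1)) / of_nat j *
        ((s + of_nat j - 2) * hurwitz_series x (s + of_nat j - 1)))"
    by (simp only: sum_negf)
  have "(s - 1) * h = c - t + (- c - (?w * h + - t))" for h c t :: complex
    by (simp add: algebra_simps)
  then show ?thesis unfolding R S .
qed


text \<open>The factor \<open>s - 1\<close> removes the pole. The recursion of order
  \<open>Suc M\<close> expresses the function at \<open>s\<close> by its values at
  \<open>s + 1, ..., s + M\<close> and a series holomorphic one strip further left, which serves as
  the definition there.\<close>

lemma hurwitz_continuation_strip: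
  assumes x: "x > 0" "x \<in> \<rat>"
  shows "\<exists>A. A holomorphic_on {s. Re s > 1 - real M} \<and>
    (\<forall>s. Re s > 1 \<longrightarrow> A s = (s - 1) * hurwitz_series x s) \<and> (\<forall>k<M. A (1 - of_nat k) \<in> \<rat>)"
proof (induction M)
  case 0
  show ?case
    using hurwitz_series_holomorphic[OF x(1)]
    by (intro exI[of _ "\<lambda>s. (s - 1) * hurwitz_series x s"]) (auto intro!: holomorphic_intros)
next
  case (Suc M)
  then obtain A where hol: "A holomorphic_on {s. Re s > 1 - real M}"
    and A: "\<And>s. Re s > 1 \<Longrightarrow> A s = (s - 1) * hurwitz_series x s"
    and rat: "\<And>k. k < M \<Longrightarrow> A (1 - of_nat k) \<in> \<rat>" by blast
  let ?J = "Suc M"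
  define B where "B s = of_real x powr (1 - s)
    - (\<Sum>j\<in>{2..?J}. (1 - s gchoose (j - 1)) / of_nat j * A (s + of_nat j - 1))
    + (\<Sum>n. powr_remainder ?J (real n + x) (1 - s))" for s
  have "(\<lambda>s. A (s + of_nat j - 1)) holomorphic_on {s. Re s > 1 - real ?J}" if "j \<ge> 2" for j
  proof -
    have "(A \<circ> (\<lambda>s. s + of_nat j - 1)) holomorphic_on {s. Re s > 1 - real ?J}"
      by (rule holomorphic_on_compose_gen[OF _ hol]) (use that in \<open>auto intro!: holomorphic_intros\<close>)
    then show ?thesis by (simp add: o_def)
  qed
  then have "B holomorphic_on {s. Re s > 1 - real ?J}"
    unfolding B_def using powr_remainder_series_holomorphic[OF x(1), of ?J] x(1)
    by (intro holomorphic_intros) (auto simp: gbinomial_prod_rev powr_def intro!: holomorphic_intros)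
  moreover have "B s = (s - 1) * hurwitz_series x s" if s: "Re s > 1" for s
  proof -
    have "A (s + of_nat j - 1) = (s + of_nat j - 2) * hurwitz_series x (s + of_nat j - 1)"
      if "j \<in> {2..?J}" for j
      using A[of "s + of_nat j - 1"] s that by (simp add: algebra_simps)
    then show ?thesis
      unfolding B_def using hurwitz_series_recursion[OF x(1) s, of ?J] by (simp del: sum.cl_ivl_Suc)
  qed
  moreover have "B (1 - of_nat k) \<in> \<rat>" if k: "k < Suc M" for k
  proof -
    \<comment> \<open>For \<open>j - 1 > k\<close> the binomial coefficient vanishes; otherwise
      \<open>A\<close> is evaluated at \<open>1 - k'\<close> with \<open>k' = Suc k - j < M\<close>,
      where it is already known to be rational.\<close>
    have "(of_nat k gchoose (j - 1)) / of_nat j * A (of_nat j - of_nat k) \<in> \<rat>" if "j \<in> {2..?J}" for j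
    proof (cases "j - 1 \<le> k")
      case True
      have "Suc k - j < M" using k that True by auto
      moreover have "1 - of_nat (Suc k - j) = (of_nat j - of_nat k :: complex)"
        using True that by (simp add: of_nat_diff)
      ultimately have "A (of_nat j - of_nat k) \<in> \<rat>" using rat by metis
      then show ?thesis by (auto simp flip: binomial_gbinomial)
    next
      case False
      then show ?thesis by (simp add: binomial_eq_0 flip: binomial_gbinomial)
    qed
    moreover have "powr_remainder ?J (real n + x) (of_nat k) = 0" for n
      using x(1) k by (intro powr_remainder_of_nat) auto
    moreover have "of_real x powr of_nat k \<in> (\<rat> :: complex set)"
    proof -
      obtain q where "x = of_rat q" using x(2) by (auto elim: Rats_cases)
      then show ?thesis using x(1) by simp
    qed
    ultimately show ?thesis
      unfolding B_def by (auto intro!: Rats_add Rats_diff Rats_sum simp del: sum.cl_ivl_Suc)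
  qed
  ultimately show ?case by blast
qed

text \<open>The continuations to the half-planes agree on overlaps by the identity theorem, so each
  point may use any half-plane containing it.\<close>

lemma hurwitz_continuation:
  assumes x: "x > 0" "x \<in> \<rat>"
  shows "\<exists>A. A holomorphic_on UNIV \<and>
    (\<forall>s. Re s > 1 \<longrightarrow> A s = (s - 1) * hurwitz_series x s) \<and> (\<forall>k. A (1 - of_nat k) \<in> \<rat>)"
proof -
  obtain A where hol: "\<And>M. A M holomorphic_on {s. Re s > 1 - real M}"
    and A: "\<And>M s. Re s > 1 \<Longrightarrow> A M s = (s - 1) * hurwitz_series x s"
    and rat: "\<And>M k. k < M \<Longrightarrow> A M (1 - of_nat k) \<in> \<rat>"
    using hurwitz_continuation_strip[OF x] by metis
  have le: "A M s = A M' s" if "Re s > 1 - real M" "M \<le> M'" for M M' s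
  proof (rule analytic_continuation_open[of "{s. Re s > 1}" "{s. Re s > 1 - real M}" "A M" "A M'"])
    show "{s. Re s > 1} \<noteq> {}" by (auto intro: exI[of _ 2])
    show "A M' holomorphic_on {s. 1 - real M < Re s}"
      by (rule holomorphic_on_subset[OF hol]) (use that in auto)
  qed (use that A hol in \<open>auto simp: open_halfspace_Re_gt convex_connected convex_halfspace_Re_gt\<close>)
  then have eq: "A M s = A M' s" if "Re s > 1 - real M" "Re s > 1 - real M'" for M M' s
    using that by (cases "M \<le> M'") (auto, metis nle_le)
  define m where "m s = nat \<lceil>2 - Re s\<rceil>" for s
  have m: "Re s > 1 - real (m s)" for s
    unfolding m_def by linarith
  define G where "G s = A (m s) s" for s
  have G: "G s = A M s" if "Re s > 1 - real M" for s M
    unfolding G_def by (rule eq) (use that m in auto)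
  have "G field_differentiable at s" for s
  proof -
    have "G holomorphic_on {z. Re z > 1 - real (m s)}"
      by (rule holomorphic_transform[OF hol[of "m s"]]) (use G in auto)
    then show ?thesis
      by (rule holomorphic_on_imp_differentiable_at) (use m in \<open>auto simp: open_halfspace_Re_gt\<close>)
  qed
  then have "G holomorphic_on UNIV" by (auto simp: holomorphic_on_def)
  moreover have "G s = (s - 1) * hurwitz_series x s" if "Re s > 1" for s
    using G[of 0 s] A[of s 0] that by simp
  moreover have "G (1 - of_nat k) \<in> \<rat>" for k
    using G[of "Suc k" "1 - of_nat k"] rat[of k "Suc k"] by simp
  ultimately show ?thesis by blast
qed

text \<open>Generalized Bernoulli numbers would give the weights explicitly, but only their rationality
  is needed.\<close>

lemma dirichlet_L_rational_combination:
  assumes "m > 0" "k \<ge> 1"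
  shows "\<exists>r. (\<forall>i. r i \<in> \<rat>) \<and> (\<forall>\<phi>. dirichlet_char m \<phi> \<longrightarrow>
    dirichlet_L \<phi> (1 - of_nat k) = (\<Sum>i<m. \<phi> (int (Suc i)) * r i))"
proof -
  \<comment> \<open>The terms of the L-series with index congruent to \<open>Suc i\<close> modulo
    \<open>m\<close> form \<open>m powr - s\<close> times the Hurwitz series at \<open>x i\<close>.
    Representatives from \<open>1\<close> to \<open>m\<close> keep \<open>x i\<close>
    positive.\<close>
  define x where "x i = real (Suc i) / real m" for i
  have x: "x i > 0" "x i \<in> \<rat>" for i using assms(1) by (auto simp: x_def)
  obtain A where hol: "\<And>i. A i holomorphic_on UNIV"
    and A: "\<And>i s. Re s > 1 \<Longrightarrow> A i s = (s - 1) * hurwitz_series (x i) s"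
    and rat: "\<And>i k. A i (1 - of_nat k) \<in> \<rat>"
    using hurwitz_continuation[OF x] by metis
  \<comment> \<open>The weight of the residue class at \<open>s = 1 - k\<close>, where
    \<open>m powr - s\<close> is \<open>m ^ (k - 1)\<close> and \<open>s - 1\<close> is
    \<open>- k\<close>.\<close>
  define r where "r i = of_nat m ^ (k - 1) * A i (1 - of_nat k) / - of_nat k" for i
  have "dirichlet_L \<phi> (1 - of_nat k) = (\<Sum>i<m. \<phi> (int (Suc i)) * r i)" if \<phi>: "dirichlet_char m \<phi>" for \<phi>
  proof -
    define F where "F s = (\<Sum>i<m. \<phi> (int (Suc i)) * (of_nat m powr - s * A i s / (s - 1)))" for s
    let ?P = "\<lambda>F. F holomorphic_on (- {1}) \<and>
      (\<forall>s. Re s > 1 \<longrightarrow> (\<lambda>n. \<phi> (int (Suc n)) / of_nat (Suc n) powr s) sums F s)"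
    have F_hol: "F holomorphic_on (- {1})"
      unfolding F_def using assms(1)
      by (intro holomorphic_intros holomorphic_on_subset[OF hol]) (auto simp: powr_def intro!: holomorphic_intros)
    have "(\<lambda>n. \<phi> (int (Suc n)) / of_nat (Suc n) powr s) sums F s" if s: "Re s > 1" for s
    proof -
      let ?f = "\<lambda>n. \<phi> (int (Suc n)) / of_nat (Suc n) powr s"
      have "summable (\<lambda>n. real (Suc n) powr - Re s)"
        using s by (subst summable_Suc_iff) (simp add: summable_real_powr_iff)
      then have "summable ?f"
      proof (rule summable_comparison_test'[where N = 0])
        fix n
        have "norm (?f n) = cmod (\<phi> (int (Suc n))) * real (Suc n) powr - Re s"
          using norm_powr_of_real[of "real (Suc n)" s]
          by (simp add: norm_mult norm_inverse powr_minus divide_inverse del: of_nat_Suc)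
        also have "\<dots> \<le> 1 * real (Suc n) powr - Re s"
          using dirichlet_char_norm_le[OF \<phi>] by (intro mult_right_mono) auto
        finally show "norm (?f n) \<le> real (Suc n) powr - Re s" by simp
      qed
      then have "(\<lambda>n. sum ?f {n * m..<n * m + m}) sums (\<Sum>n. ?f n)"
        using assms(1) by (intro sums_group summable_sums)
      moreover have "sum ?f {n * m..<n * m + m} =
          (\<Sum>i<m. \<phi> (int (Suc i)) * (of_nat m powr - s * of_real (real n + x i) powr - s))" for n
      proof -
        have "sum ?f {n * m..<n * m + m} = (\<Sum>i<m. ?f (i + n * m))"
          using sum.shift_bounds_nat_ivl[of ?f 0 "n * m" m] by (simp add: lessThan_atLeast0 add.commute)
        also have "\<dots> = (\<Sum>i<m. \<phi> (int (Suc i)) * (of_nat m powr - s * of_real (real n + x i) powr - s))"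
        proof (intro sum.cong refl)
          fix i
          have "real (Suc (i + n * m)) = real m * (real n + x i)"
            using assms(1) by (simp add: x_def field_simps)
          then have "of_nat (Suc (i + n * m)) = (of_real (real m * (real n + x i)) :: complex)"
            by (metis of_real_of_nat_eq)
          also have "\<dots> powr - s = of_nat m powr - s * of_real (real n + x i) powr - s"
            using x(1)[of i] by (subst powr_times_real[symmetric]) auto
          finally have "of_nat (Suc (i + n * m)) powr - s =
              of_nat m powr - s * of_real (real n + x i) powr - s" .
          moreover have "\<phi> (int (Suc (i + n * m))) = \<phi> (int (Suc i))"
            by (rule dirichlet_char_cong[OF \<phi>]) (simp add: cong_iff_dvd_diff)
          ultimately show "?f (i + n * m) = \<phi> (int (Suc i)) * (of_nat m powr - s * of_real (real n + x i) powr - s)"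
            by (simp add: powr_minus divide_inverse)
        qed
        finally show ?thesis .
      qed
      ultimately have sums1: "(\<lambda>n. \<Sum>i<m. \<phi> (int (Suc i)) * (of_nat m powr - s * of_real (real n + x i) powr - s))
          sums (\<Sum>n. ?f n)" by simp
      have sums2: "(\<lambda>n. \<Sum>i<m. \<phi> (int (Suc i)) * (of_nat m powr - s * of_real (real n + x i) powr - s))
          sums (\<Sum>i<m. \<phi> (int (Suc i)) * (of_nat m powr - s * hurwitz_series (x i) s))"
        by (intro sums_sum sums_mult hurwitz_series_sums x s)
      have "s \<noteq> 1" using s by auto
      then have "F s = (\<Sum>i<m. \<phi> (int (Suc i)) * (of_nat m powr - s * hurwitz_series (x i) s))"
        by (simp add: F_def A[OF s])
      also have "\<dots> = (\<Sum>n. ?f n)" by (rule sums_unique2[OF sums2 sums1])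
      finally have "F s = (\<Sum>n. ?f n)" .
      then show ?thesis using \<open>summable ?f\<close> by (simp add: summable_sums)
    qed
    with F_hol have PF: "?P F" by blast
    \<comment> \<open>\<open>dirichlet_L\<close> is a choice among continuations: \<open>F\<close>
      shows that one exists, and then the identity theorem on the connected punctured plane equates
      the two.\<close>
    have PL: "?P (dirichlet_L \<phi>)"
      using someI[of ?P, OF PF] unfolding dirichlet_L_def .
    have "dirichlet_L \<phi> (1 - of_nat k) = F (1 - of_nat k)"
    proof (rule analytic_continuation_open[of "{s. Re s > 1}" "- {1}" "dirichlet_L \<phi>" F])
      show "{s. Re s > 1} \<noteq> {}" by (auto intro: exI[of _ 2])
      show "connected (- {1::complex})"
        by (simp add: connected_punctured_universe)
      show "dirichlet_L \<phi> s = F s" if "s \<in> {s. Re s > 1}" for s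
        using PL PF that sums_unique2 by blast
    qed (use PL PF assms(2) in \<open>auto simp: open_halfspace_Re_gt\<close>)
    also have "\<dots> = (\<Sum>i<m. \<phi> (int (Suc i)) * r i)"
    proof -
      have "of_nat m powr - (1 - of_nat k) = (of_nat m ^ (k - 1) :: complex)"
        using powr_complexpow[of "of_nat m" "k - 1"] assms by (simp add: of_nat_diff)
      then show ?thesis by (simp add: F_def r_def)
    qed
    finally show ?thesis .
  qed
  moreover have "r i \<in> \<rat>" for i
    unfolding r_def using rat by (intro Rats_divide Rats_mult) auto
  ultimately show ?thesis by blast
qed


section \<open>Subfields of the complex numbers and their embeddings\<close>

lemma complex_subfieldD:
  assumes "complex_subfield K"
  shows "0 \<in> K" "1 \<in> K" "x \<in> K \<Longrightarrow> y \<in> K \<Longrightarrow> x + y \<in> K" "x \<in> K \<Longrightarrow> y \<in> K \<Longrightarrow> x * y \<in> K"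
    "x \<in> K \<Longrightarrow> - x \<in> K" "x \<in> K \<Longrightarrow> inverse x \<in> K" "x \<in> K \<Longrightarrow> y \<in> K \<Longrightarrow> x - y \<in> K"
    "x \<in> K \<Longrightarrow> y \<in> K \<Longrightarrow> x / y \<in> K"
proof -
  show *: "0 \<in> K" "1 \<in> K" "x \<in> K \<Longrightarrow> y \<in> K \<Longrightarrow> x + y \<in> K" "x \<in> K \<Longrightarrow> y \<in> K \<Longrightarrow> x * y \<in> K"
    "x \<in> K \<Longrightarrow> - x \<in> K" "x \<in> K \<Longrightarrow> inverse x \<in> K" for x y
    using assms by (auto simp: complex_subfield_def)
  show "x \<in> K \<Longrightarrow> y \<in> K \<Longrightarrow> x - y \<in> K" using *(3)[of x "- y"] *(5)[of y] by simp
  show "x \<in> K \<Longrightarrow> y \<in> K \<Longrightarrow> x / y \<in> K" using *(4)[of x "inverse y"] *(6)[of y] by (simp add: divide_inverse)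
qed

lemma complex_subfield_sum: "complex_subfield K \<Longrightarrow> (\<And>i. i \<in> A \<Longrightarrow> f i \<in> K) \<Longrightarrow> sum f A \<in> K"
  by (induction A rule: infinite_finite_induct) (auto intro: complex_subfieldD)

lemma complex_subfield_power: "complex_subfield K \<Longrightarrow> x \<in> K \<Longrightarrow> x ^ n \<in> K"
  by (induction n) (auto intro: complex_subfieldD)

lemma complex_subfield_of_nat: "complex_subfield K \<Longrightarrow> of_nat n \<in> K"
  by (induction n) (auto intro: complex_subfieldD)

lemma complex_subfield_Rats: "complex_subfield K \<Longrightarrow> \<rat> \<subseteq> K"
proof
  fix x :: complex assume K: "complex_subfield K" and "x \<in> \<rat>"
  then obtain a b where x: "x = of_int a / of_int b" by (metis Rats_cases')
  have "of_int a \<in> K" for a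
    by (cases a rule: int_cases2) (auto simp: complex_subfield_of_nat[OF K] complex_subfieldD(5)[OF K])
  then show "x \<in> K" unfolding x using complex_subfieldD(8)[OF K] by blast
qed

lemma complex_subfield_Rats_self: "complex_subfield \<rat>"
  by (auto simp: complex_subfield_def)

lemma complex_subfield_hull: "complex_subfield (complex_subfield hull X)"
  by (rule hull_in) (auto simp: complex_subfield_def)

text \<open>An embedding of \<open>K\<close> into the complex numbers: the image need not lie in
  \<open>K\<close>, and values off \<open>K\<close> are arbitrary. The condition at \<open>1\<close>
  excludes the zero map.\<close>

definition field_hom_on :: "complex set \<Rightarrow> (complex \<Rightarrow> complex) \<Rightarrow> bool" where
  "field_hom_on K \<sigma> \<longleftrightarrow> \<sigma> 1 = 1 \<and> (\<forall>x\<in>K. \<forall>y\<in>K. \<sigma> (x + y) = \<sigma> x + \<sigma> y \<and> \<sigma> (x * y) = \<sigma> x * \<sigma> y)"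

lemma field_hom_onD:
  assumes "field_hom_on K \<sigma>"
  shows "\<sigma> 1 = 1" "x \<in> K \<Longrightarrow> y \<in> K \<Longrightarrow> \<sigma> (x + y) = \<sigma> x + \<sigma> y"
    "x \<in> K \<Longrightarrow> y \<in> K \<Longrightarrow> \<sigma> (x * y) = \<sigma> x * \<sigma> y"
  using assms by (auto simp: field_hom_on_def)

context
  fixes K :: "complex set" and \<sigma> :: "complex \<Rightarrow> complex"
  assumes K: "complex_subfield K" and \<sigma>: "field_hom_on K \<sigma>"
begin

lemma field_hom_on_0: "\<sigma> 0 = 0"
  using field_hom_onD(2)[OF \<sigma>, of 0 0] complex_subfieldD(1)[OF K] by simp

lemma field_hom_on_uminus: "x \<in> K \<Longrightarrow> \<sigma> (- x) = - \<sigma> x"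
  using field_hom_onD(2)[OF \<sigma>, of x "- x"] complex_subfieldD(5)[OF K, of x] field_hom_on_0
  by (simp add: eq_neg_iff_add_eq_0 add.commute)

lemma field_hom_on_diff: "x \<in> K \<Longrightarrow> y \<in> K \<Longrightarrow> \<sigma> (x - y) = \<sigma> x - \<sigma> y"
  using field_hom_onD(2)[OF \<sigma>, of x "- y"] complex_subfieldD(5)[OF K, of y] field_hom_on_uminus[of y]
  by simp

lemma field_hom_on_eq_0_iff: "x \<in> K \<Longrightarrow> \<sigma> x = 0 \<longleftrightarrow> x = 0"
  using field_hom_onD(3)[OF \<sigma>, of x "inverse x"] complex_subfieldD(6)[OF K, of x]
    field_hom_onD(1)[OF \<sigma>] field_hom_on_0
  by (cases "x = 0") auto

lemma field_hom_on_inj: "inj_on \<sigma> K"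
proof (rule inj_onI)
  fix x y assume "x \<in> K" "y \<in> K" "\<sigma> x = \<sigma> y"
  then have "\<sigma> (x - y) = 0" "x - y \<in> K"
    by (simp_all add: field_hom_on_diff complex_subfieldD(7)[OF K])
  then show "x = y" using field_hom_on_eq_0_iff by force
qed

lemma field_hom_on_inverse: "x \<in> K \<Longrightarrow> \<sigma> (inverse x) = inverse (\<sigma> x)"
  using field_hom_onD(3)[OF \<sigma>, of "inverse x" x] complex_subfieldD(6)[OF K, of x]
    field_hom_onD(1)[OF \<sigma>] field_hom_on_0 inverse_unique[of "\<sigma> x" "\<sigma> (inverse x)"]
  by (cases "x = 0") (auto simp: mult.commute)

lemma field_hom_on_sum: "(\<And>i. i \<in> A \<Longrightarrow> f i \<in> K) \<Longrightarrow> \<sigma> (sum f A) = (\<Sum>i\<in>A. \<sigma> (f i))"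
  by (induction A rule: infinite_finite_induct)
    (auto simp: field_hom_on_0 field_hom_onD(2)[OF \<sigma>] complex_subfield_sum[OF K])

lemma field_hom_on_power: "x \<in> K \<Longrightarrow> \<sigma> (x ^ n) = \<sigma> x ^ n"
  by (induction n)
    (auto simp: field_hom_onD(1)[OF \<sigma>] field_hom_onD(3)[OF \<sigma>] complex_subfield_power[OF K])

lemma field_hom_on_of_nat: "\<sigma> (of_nat n) = of_nat n"
  by (induction n)
    (auto simp: field_hom_on_0 field_hom_onD(1,2)[OF \<sigma>] complex_subfield_of_nat[OF K]
      complex_subfieldD(2)[OF K])

lemma field_hom_on_Rats: "x \<in> \<rat> \<Longrightarrow> \<sigma> x = x"
proof -
  assume "x \<in> \<rat>"
  then obtain a b where x: "x = of_int a / of_int b" by (metis Rats_cases')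
  have int: "of_int a \<in> K" for a using complex_subfield_Rats[OF K] by auto
  have "\<sigma> (of_int a) = of_int a" for a
    by (cases a rule: int_cases2)
      (auto simp: field_hom_on_of_nat field_hom_on_uminus complex_subfield_of_nat[OF K])
  then show ?thesis
    using field_hom_onD(3)[OF \<sigma>, of "of_int a" "inverse (of_int b)"] int[of a] int[of b]
      complex_subfieldD(6)[OF K] field_hom_on_inverse
    by (simp add: x divide_inverse)
qed

end

section \<open>Simple extensions generated by a root of unity\<close>

definition coeffs_in :: "complex set \<Rightarrow> complex poly \<Rightarrow> bool" where
  "coeffs_in K p \<longleftrightarrow> (\<forall>i. coeff p i \<in> K)"

definition adjoin :: "complex set \<Rightarrow> complex \<Rightarrow> complex set" where
  "adjoin K \<zeta> = {poly p \<zeta> | p. coeffs_in K p}"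

context
  fixes K :: "complex set"
  assumes K: "complex_subfield K"
begin

lemma coeffs_in_simps:
  "coeffs_in K 0" "coeffs_in K 1" "coeffs_in K p \<Longrightarrow> coeffs_in K q \<Longrightarrow> coeffs_in K (p + q)"
  "coeffs_in K p \<Longrightarrow> coeffs_in K q \<Longrightarrow> coeffs_in K (p - q)"
  "coeffs_in K p \<Longrightarrow> coeffs_in K (- p)" "coeffs_in K p \<Longrightarrow> coeffs_in K q \<Longrightarrow> coeffs_in K (p * q)"
  "c \<in> K \<Longrightarrow> coeffs_in K (monom c n)" "c \<in> K \<Longrightarrow> coeffs_in K [:c:]"
  by (auto simp: coeffs_in_def coeff_mult coeff_pCons complex_subfieldD[OF K]
      intro: complex_subfield_sum[OF K] split: nat.splits)

text \<open>Long division. Subfields are sets, so all polynomials live over the complex numbers, and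
  membership of the coefficients in \<open>K\<close> has to be carried through each step.\<close>

lemma coeffs_in_division:
  assumes "coeffs_in K g" "coeffs_in K p" "g \<noteq> 0"
  shows "\<exists>q r. coeffs_in K q \<and> coeffs_in K r \<and> p = q * g + r \<and> (r = 0 \<or> degree r < degree g)"
  using assms(2)
proof (induction "degree p" arbitrary: p rule: less_induct)
  case less
  show ?case
  proof (cases "p = 0 \<or> degree p < degree g")
    case True
    then show ?thesis using less.prems coeffs_in_simps(1) by (intro exI[of _ 0] exI[of _ p]) auto
  next
    case False
    define c where "c = lead_coeff p / lead_coeff g"
    define m where "m = monom c (degree p - degree g)"
    define p' where "p' = p - m * g"
    have "c \<in> K" using less.prems assms(1) complex_subfieldD(8)[OF K] by (auto simp: c_def coeffs_in_def)
    then have m: "coeffs_in K m" unfolding m_def by (rule coeffs_in_simps)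
    then have p': "coeffs_in K p'" using less.prems assms(1) unfolding p'_def by (intro coeffs_in_simps)
    have c0: "c \<noteq> 0" using False \<open>g \<noteq> 0\<close> by (auto simp: c_def)
    have m': "degree m = degree p - degree g" "lead_coeff m = c" "m \<noteq> 0"
      using c0 by (auto simp: m_def degree_monom_eq)
    have deg: "degree (m * g) = degree p"
      using False \<open>g \<noteq> 0\<close> m' by (simp add: degree_mult_eq)
    have "lead_coeff (m * g) = lead_coeff p"
      using \<open>g \<noteq> 0\<close> m'(2) unfolding lead_coeff_mult by (simp add: c_def)
    then have "coeff p' (degree p) = 0" by (simp add: p'_def deg)
    moreover have "degree p' \<le> degree p"
      unfolding p'_def by (rule degree_diff_le) (simp_all add: deg)
    ultimately have *: "p' = 0 \<or> degree p' < degree p"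
      using leading_coeff_0_iff[of p'] by (cases "degree p' = degree p") auto
    show ?thesis
    proof (cases "p' = 0")
      case True
      then show ?thesis using m coeffs_in_simps(1)
        by (intro exI[of _ m] exI[of _ 0]) (auto simp: p'_def)
    next
      case False
      then obtain q r where qr: "coeffs_in K q" "coeffs_in K r" "p' = q * g + r" "r = 0 \<or> degree r < degree g"
        using less.hyps[OF _ p'] * by blast
      then have "p = (q + m) * g + r" by (simp add: p'_def algebra_simps)
      then show ?thesis using qr m coeffs_in_simps(3) by blast
    qed
  qed
qed

end

context
  fixes K :: "complex set" and \<zeta> :: complex and M :: nat
  assumes K: "complex_subfield K" and \<zeta>: "\<zeta> ^ M = 1" and M: "M > 0"
begin

text \<open>A polynomial of least degree among the nonzero ones over \<open>K\<close> that vanish at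
  \<zeta>. It is a scalar multiple of the monic minimal polynomial.\<close>

definition minpoly :: "complex poly" where
  "minpoly = (ARG_MIN degree p. coeffs_in K p \<and> p \<noteq> 0 \<and> poly p \<zeta> = 0)"

lemma unity_poly: "coeffs_in K (monom 1 M - 1)" "monom 1 M - 1 \<noteq> (0 :: complex poly)"
    "poly (monom 1 M - 1) \<zeta> = 0"
proof -
  show "coeffs_in K (monom 1 M - 1)"
    by (intro coeffs_in_simps[OF K] complex_subfieldD[OF K])
  show "monom 1 M - 1 \<noteq> (0 :: complex poly)"
  proof
    assume "monom 1 M - 1 = (0 :: complex poly)"
    then have "coeff (monom 1 M - 1 :: complex poly) M = 0" by simp
    then show False using M by simp
  qed
  show "poly (monom 1 M - 1) \<zeta> = 0" using \<zeta> by (simp add: poly_monom)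
qed

lemma minpoly: "coeffs_in K minpoly" "minpoly \<noteq> 0" "poly minpoly \<zeta> = 0"
  and minpoly_le: "coeffs_in K p \<Longrightarrow> p \<noteq> 0 \<Longrightarrow> poly p \<zeta> = 0 \<Longrightarrow> degree minpoly \<le> degree p"
  using arg_min_nat_lemma[of "\<lambda>p. coeffs_in K p \<and> p \<noteq> 0 \<and> poly p \<zeta> = 0", OF conjI[OF unity_poly(1)
    conjI[OF unity_poly(2,3)]], of degree]
  by (auto simp flip: minpoly_def)

lemma minpoly_dvd:
  assumes p: "coeffs_in K p" "poly p \<zeta> = 0"
  shows "\<exists>q. coeffs_in K q \<and> p = q * minpoly"
proof -
  obtain q r where qr: "coeffs_in K q" "coeffs_in K r" "p = q * minpoly + r"
    "r = 0 \<or> degree r < degree minpoly"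
    using coeffs_in_division[OF K minpoly(1) p(1) minpoly(2)] by blast
  have "poly r \<zeta> = 0" using qr(3) p(2) minpoly(3) by simp
  then have "r = 0" using qr(2,4) minpoly_le[of r] by (cases "r = 0") auto
  then show ?thesis using qr by auto
qed

lemma degree_minpoly: "degree minpoly > 0"
proof (rule ccontr)
  assume "\<not> ?thesis"
  then obtain c where "minpoly = [:c:]" by (auto elim: degree_eq_zeroE)
  then show False using minpoly(2,3) by simp
qed

text \<open>Euclidean descent: dividing \<open>minpoly\<close> by \<open>g\<close> leaves a
  remainder whose value at \<zeta> is, up to sign, a multiple of that of \<open>g\<close>, so an
  inverse for the remainder yields one for \<open>g\<close>. A zero remainder would make the
  quotient a root-carrying polynomial of smaller degree.\<close>

lemma adjoin_inverse:
  assumes "coeffs_in K g" "g \<noteq> 0" "degree g < degree minpoly"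
  shows "\<exists>h. coeffs_in K h \<and> poly h \<zeta> * poly g \<zeta> = 1"
  using assms
proof (induction "degree g" arbitrary: g rule: less_induct)
  case less
  show ?case
  proof (cases "degree g = 0")
    case True
    then obtain c where c: "g = [:c:]" by (metis degree_eq_zeroE)
    then have "c \<noteq> 0" "c \<in> K" using less.prems(1,2) by (auto simp: coeffs_in_def dest: spec[of _ 0])
    then show ?thesis
      using c coeffs_in_simps(8)[OF K] complex_subfieldD(6)[OF K] by (intro exI[of _ "[:inverse c:]"]) auto
  next
    case False
    obtain q r where qr: "coeffs_in K q" "coeffs_in K r" "minpoly = q * g + r"
      "r = 0 \<or> degree r < degree g"
      using coeffs_in_division[OF K less.prems(1) minpoly(1) less.prems(2)] by blast
    have g\<zeta>: "poly g \<zeta> \<noteq> 0" using minpoly_le[of g] less.prems by auto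
    have r\<zeta>: "poly r \<zeta> = - (poly q \<zeta> * poly g \<zeta>)"
      using minpoly(3) qr(3) by (simp add: eq_neg_iff_add_eq_0 add.commute)
    have "r \<noteq> 0"
    proof
      assume "r = 0"
      then have "poly q \<zeta> = 0" "q \<noteq> 0" "minpoly = q * g" using r\<zeta> g\<zeta> qr(3) minpoly(2) by auto
      then have "degree minpoly \<le> degree q" "degree minpoly = degree q + degree g"
        using minpoly_le[of q] qr(1) less.prems(2) by (auto simp: degree_mult_eq)
      then show False using False by simp
    qed
    then have "degree r < degree g" using qr(4) by simp
    then obtain h where h: "coeffs_in K h" "poly h \<zeta> * poly r \<zeta> = 1"
      using less.hyps[of r] qr(2) \<open>r \<noteq> 0\<close> less.prems(3) by auto
    have "poly (- (h * q)) \<zeta> * poly g \<zeta> = 1" using h(2) r\<zeta> by (simp add: algebra_simps)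
    moreover have "coeffs_in K (- (h * q))" by (intro coeffs_in_simps[OF K] h qr)
    ultimately show ?thesis by blast
  qed
qed

lemma adjoin_reduced:
  assumes "x \<in> adjoin K \<zeta>"
  obtains g where "coeffs_in K g" "x = poly g \<zeta>" "g = 0 \<or> degree g < degree minpoly"
proof -
  obtain p where p: "coeffs_in K p" "x = poly p \<zeta>" using assms by (auto simp: adjoin_def)
  obtain q r where "coeffs_in K q" "coeffs_in K r" "p = q * minpoly + r"
    "r = 0 \<or> degree r < degree minpoly"
    using coeffs_in_division[OF K minpoly(1) p(1) minpoly(2)] by blast
  then show ?thesis using that p minpoly(3) by auto
qed

lemma complex_subfield_adjoin: "complex_subfield (adjoin K \<zeta>)"
  and subset_adjoin: "K \<subseteq> adjoin K \<zeta>" and in_adjoin: "\<zeta> \<in> adjoin K \<zeta>"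
proof -
  have mem: "poly p \<zeta> \<in> adjoin K \<zeta>" if "coeffs_in K p" for p
    using that by (auto simp: adjoin_def)
  show "K \<subseteq> adjoin K \<zeta>"
  proof
    fix c assume "c \<in> K"
    then show "c \<in> adjoin K \<zeta>" using mem[of "[:c:]"] coeffs_in_simps(8)[OF K] by simp
  qed
  show "\<zeta> \<in> adjoin K \<zeta>"
    using mem[of "monom 1 1"] coeffs_in_simps(7)[OF K] complex_subfieldD(2)[OF K] by (simp add: poly_monom)
  have "inverse x \<in> adjoin K \<zeta>" if x: "x \<in> adjoin K \<zeta>" for x
  proof (cases "x = 0")
    case False
    obtain g where g: "coeffs_in K g" "x = poly g \<zeta>" "g = 0 \<or> degree g < degree minpoly"
      using adjoin_reduced[OF x] .
    have "g \<noteq> 0" using False g(2) by auto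
    then obtain h where h: "coeffs_in K h" "poly h \<zeta> * x = 1"
      using adjoin_inverse[OF g(1)] g(2,3) by auto
    then have "inverse x = poly h \<zeta>" using inverse_unique[of x "poly h \<zeta>"] by (simp add: mult.commute)
    then show ?thesis using mem[OF h(1)] by simp
  qed (use x in auto)
  moreover have "x + y \<in> adjoin K \<zeta>" "x * y \<in> adjoin K \<zeta>"
    if xy: "x \<in> adjoin K \<zeta>" "y \<in> adjoin K \<zeta>" for x y
  proof -
    obtain p q where "coeffs_in K p" "x = poly p \<zeta>" "coeffs_in K q" "y = poly q \<zeta>"
      using xy by (auto simp: adjoin_def)
    then show "x + y \<in> adjoin K \<zeta>" "x * y \<in> adjoin K \<zeta>"
      using mem[of "p + q"] mem[of "p * q"] coeffs_in_simps(3,6)[OF K] by auto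
  qed
  moreover have "- x \<in> adjoin K \<zeta>" if x: "x \<in> adjoin K \<zeta>" for x
  proof -
    obtain p where "coeffs_in K p" "x = poly p \<zeta>" using x by (auto simp: adjoin_def)
    then show ?thesis using mem[of "- p"] coeffs_in_simps(5)[OF K] by auto
  qed
  ultimately show "complex_subfield (adjoin K \<zeta>)"
    using \<open>K \<subseteq> adjoin K \<zeta>\<close> complex_subfieldD(1,2)[OF K] by (auto simp: complex_subfield_def)
qed

text \<open>The extension sends \<open>p(\<zeta>)\<close> to \<open>p\<^sup>\<sigma>(\<zeta>')\<close>, where \<open>\<zeta>'\<close> is a root of the image of the minimal
  polynomial.\<close>

lemma field_hom_extend_to_root:
  assumes \<sigma>: "field_hom_on K \<sigma>" and root: "poly (map_poly \<sigma> minpoly) \<zeta>' = 0"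
  shows "\<exists>\<tau>. field_hom_on (adjoin K \<zeta>) \<tau> \<and> (\<forall>x\<in>K. \<tau> x = \<sigma> x) \<and> \<tau> \<zeta> = \<zeta>'"
proof -
  note [simp] = field_hom_on_0[OF K \<sigma>]
  have add: "map_poly \<sigma> (p + q) = map_poly \<sigma> p + map_poly \<sigma> q"
    if "coeffs_in K p" "coeffs_in K q" for p q
    using that by (intro poly_eqI) (auto simp: coeff_map_poly coeffs_in_def field_hom_onD(2)[OF \<sigma>])
  have mult: "map_poly \<sigma> (p * q) = map_poly \<sigma> p * map_poly \<sigma> q"
    if "coeffs_in K p" "coeffs_in K q" for p q
    using that complex_subfieldD(4)[OF K]
    by (intro poly_eqI)
      (auto simp: coeff_map_poly coeff_mult coeffs_in_def field_hom_onD(3)[OF \<sigma>] field_hom_on_sum[OF K \<sigma>])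
  have diff: "map_poly \<sigma> (p - q) = map_poly \<sigma> p - map_poly \<sigma> q"
    if "coeffs_in K p" "coeffs_in K q" for p q
    using that by (intro poly_eqI) (auto simp: coeff_map_poly coeffs_in_def field_hom_on_diff[OF K \<sigma>])
  define \<tau> where "\<tau> x = poly (map_poly \<sigma> (SOME p. coeffs_in K p \<and> poly p \<zeta> = x)) \<zeta>'" for x
  \<comment> \<open>Two polynomials representing the same element differ by a multiple of
    \<open>minpoly\<close>, and the image of \<open>minpoly\<close> vanishes at
    \<open>\<zeta>'\<close>; hence the choice made in \<tau> does not matter.\<close>
  have \<tau>: "\<tau> (poly p \<zeta>) = poly (map_poly \<sigma> p) \<zeta>'" if p: "coeffs_in K p" for p
  proof -
    define p' where "p' = (SOME p'. coeffs_in K p' \<and> poly p' \<zeta> = poly p \<zeta>)"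
    have p': "coeffs_in K p'" "poly p' \<zeta> = poly p \<zeta>"
      unfolding p'_def using someI[of "\<lambda>p'. coeffs_in K p' \<and> poly p' \<zeta> = poly p \<zeta>" p] p by auto
    then obtain q where q: "coeffs_in K q" "p' - p = q * minpoly"
      using minpoly_dvd[of "p' - p"] coeffs_in_simps(4)[OF K] p by auto
    have "map_poly \<sigma> p' - map_poly \<sigma> p = map_poly \<sigma> q * map_poly \<sigma> minpoly"
      using q p p' minpoly(1) by (metis diff mult)
    then have "poly (map_poly \<sigma> p' - map_poly \<sigma> p) \<zeta>' = 0" using root by simp
    then show ?thesis by (simp add: \<tau>_def flip: p'_def)
  qed
  have const: "\<tau> c = \<sigma> c" if "c \<in> K" for c
    using \<tau>[of "[:c:]"] coeffs_in_simps(8)[OF K that] by (simp add: map_poly_pCons)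
  have "\<tau> \<zeta> = \<zeta>'"
  proof -
    have "coeffs_in K (monom 1 1)" using coeffs_in_simps(7)[OF K] complex_subfieldD(2)[OF K] by blast
    from \<tau>[OF this] show ?thesis
      by (simp add: poly_monom map_poly_monom field_hom_onD(1)[OF \<sigma>])
  qed
  moreover have "field_hom_on (adjoin K \<zeta>) \<tau>"
    unfolding field_hom_on_def
  proof (intro conjI ballI)
    show "\<tau> 1 = 1" using const[of 1] complex_subfieldD(2)[OF K] field_hom_onD(1)[OF \<sigma>] by simp
    fix x y assume "x \<in> adjoin K \<zeta>" "y \<in> adjoin K \<zeta>"
    then obtain p q where pq: "coeffs_in K p" "coeffs_in K q" and xy: "x = poly p \<zeta>" "y = poly q \<zeta>"
      by (auto simp: adjoin_def)
    show "\<tau> (x + y) = \<tau> x + \<tau> y"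
      using \<tau>[of "p + q"] \<tau>[OF pq(1)] \<tau>[OF pq(2)] add[OF pq] coeffs_in_simps(3)[OF K pq] by (simp add: xy)
    show "\<tau> (x * y) = \<tau> x * \<tau> y"
      using \<tau>[of "p * q"] \<tau>[OF pq(1)] \<tau>[OF pq(2)] mult[OF pq] coeffs_in_simps(6)[OF K pq] by (simp add: xy)
  qed
  ultimately show ?thesis using const by blast
qed

text \<open>By injectivity \<sigma> does not kill the leading coefficient, so the image of
  \<open>minpoly\<close> is not constant and has a complex root.\<close>

lemma field_hom_extend:
  assumes \<sigma>: "field_hom_on K \<sigma>"
  shows "\<exists>\<tau>. field_hom_on (adjoin K \<zeta>) \<tau> \<and> (\<forall>x\<in>K. \<tau> x = \<sigma> x)"
proof -
  have "lead_coeff minpoly \<in> K" using minpoly(1) by (auto simp: coeffs_in_def)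
  then have "coeff (map_poly \<sigma> minpoly) (degree minpoly) \<noteq> 0"
    using field_hom_on_eq_0_iff[OF K \<sigma>] field_hom_on_0[OF K \<sigma>] minpoly(2) by (simp add: coeff_map_poly)
  then have "degree (map_poly \<sigma> minpoly) \<ge> degree minpoly" by (rule le_degree)
  then have "degree (map_poly \<sigma> minpoly) > 0" using degree_minpoly by simp
  then have "\<not> constant (poly (map_poly \<sigma> minpoly))" by (simp add: constant_degree)
  then obtain \<zeta>' where "poly (map_poly \<sigma> minpoly) \<zeta>' = 0"
    using fundamental_theorem_of_algebra by blast
  then show ?thesis using field_hom_extend_to_root[OF \<sigma>] by blast
qed

text \<open>Separability: \<open>minpoly\<close> divides \<open>X ^ M - 1\<close>, which has
  \<open>M\<close> distinct roots, and the cofactor can account for no more of them than its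
  degree.\<close>

lemma card_roots_minpoly: "card {z. poly minpoly z = 0} \<ge> degree minpoly"
proof -
  obtain q where q: "monom 1 M - 1 = q * minpoly"
    using minpoly_dvd[OF unity_poly(1,3)] by blast
  have q0: "q \<noteq> 0" using q unity_poly(2) by auto
  have "M = degree (monom 1 M - 1 :: complex poly)"
  proof -
    have "degree (monom 1 M + (- 1 :: complex poly)) = M"
      using M by (subst degree_add_eq_left) (auto simp: degree_monom_eq)
    then show ?thesis by simp
  qed
  also have "\<dots> = degree q + degree minpoly"
    unfolding q using q0 minpoly(2) by (rule degree_mult_eq)
  finally have deg: "M = degree q + degree minpoly" .
  have "M = card {z::complex. z ^ M = 1}"
    using card_roots_unity_eq[OF M] by simp
  also have "{z::complex. z ^ M = 1} = {z. poly (monom 1 M - 1) z = 0}"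
    by (auto simp: poly_monom)
  also have "\<dots> = {z. poly q z = 0} \<union> {z. poly minpoly z = 0}"
    unfolding q by auto
  also have "card \<dots> \<le> card {z. poly q z = 0} + card {z. poly minpoly z = 0}"
    by (rule card_Un_le)
  also have "card {z. poly q z = 0} \<le> degree q"
    using q0 by (rule card_poly_roots_bound)
  finally show ?thesis using deg by simp
qed

text \<open>Write \<open>x = g(\<zeta>)\<close> with \<open>g\<close> of degree below that of
  \<open>minpoly\<close>. The embedding over \<open>K\<close> taking \<zeta> to another root
  \<open>\<zeta>'\<close> shows \<open>g(\<zeta>') = x\<close>. Thus \<open>g - x\<close> has more
  roots than its degree allows, and \<open>x\<close> is the constant coefficient of
  \<open>g\<close>.\<close>

lemma fixed_field:
  assumes x: "x \<in> adjoin K \<zeta>"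
    and fix_x: "\<And>\<tau>. field_hom_on (adjoin K \<zeta>) \<tau> \<Longrightarrow> (\<forall>y\<in>K. \<tau> y = y) \<Longrightarrow> \<tau> x = x"
  shows "x \<in> K"
proof -
  obtain g where g: "coeffs_in K g" "x = poly g \<zeta>" "g = 0 \<or> degree g < degree minpoly"
    using adjoin_reduced[OF x] .
  have id: "field_hom_on K id" by (simp add: field_hom_on_def)
  have root: "poly (g - [:x:]) \<zeta>' = 0" if "poly minpoly \<zeta>' = 0" for \<zeta>'
  proof -
    have "poly (map_poly id minpoly) \<zeta>' = 0" using that by simp
    then obtain \<tau> where \<tau>: "field_hom_on (adjoin K \<zeta>) \<tau>" "\<And>y. y \<in> K \<Longrightarrow> \<tau> y = y" "\<tau> \<zeta> = \<zeta>'"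
      using field_hom_extend_to_root[OF id] by auto
    note L = complex_subfield_adjoin
    have c: "coeff g i \<in> adjoin K \<zeta>" "\<tau> (coeff g i) = coeff g i" for i
      using g(1) \<tau>(2) subset_adjoin by (auto simp: coeffs_in_def)
    have "\<tau> x = (\<Sum>i\<le>degree g. \<tau> (coeff g i * \<zeta> ^ i))"
      unfolding g(2) poly_altdef
      using c complex_subfieldD(4)[OF L] complex_subfield_power[OF L in_adjoin]
      by (subst field_hom_on_sum[OF L \<tau>(1)]) auto
    also have "\<dots> = poly g \<zeta>'"
      unfolding poly_altdef
      using c complex_subfield_power[OF L in_adjoin] in_adjoin
      by (intro sum.cong) (auto simp: field_hom_onD(3)[OF \<tau>(1)] field_hom_on_power[OF L \<tau>(1)] \<tau>(3))
    finally show ?thesis using fix_x[OF \<tau>(1)] \<tau>(2) by simp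
  qed
  have "g - [:x:] = 0"
  proof (rule ccontr)
    assume nz: "g - [:x:] \<noteq> 0"
    have "degree (g - [:x:]) < degree minpoly"
      using g(3) degree_minpoly by (intro degree_diff_less) auto
    moreover have "card {z. poly minpoly z = 0} \<le> card {z. poly (g - [:x:]) z = 0}"
      using root poly_roots_finite[OF nz] by (intro card_mono) auto
    ultimately show False using card_roots_minpoly card_poly_roots_bound[OF nz] by simp
  qed
  then have "coeff g 0 = x" by (metis coeff_pCons_0 eq_iff_diff_eq_0)
  then show ?thesis using g(1) by (auto simp: coeffs_in_def)
qed

end

text \<open>Gaussian elimination over \<open>K\<close>, one unknown at a time. Independence of the
  columns over the complex numbers supplies a nonzero pivot and passes to the reduced
  system.\<close>

lemma linear_system_solution_in_subfield:
  assumes K: "complex_subfield K" and "finite I"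
    and "\<And>i n. i \<in> I \<Longrightarrow> a i n \<in> K" "\<And>n. e n \<in> K"
    and "\<And>n::nat. (\<Sum>i\<in>I. c i * a i n) = e n"
    and "\<And>b. (\<And>n. (\<Sum>i\<in>I. b i * a i n) = 0) \<Longrightarrow> \<forall>i\<in>I. b i = 0"
  shows "\<forall>i\<in>I. c i \<in> K"
  using assms(2-)
proof (induction I arbitrary: a e)
  case (insert j I)
  have "\<exists>n. a j n \<noteq> 0"
  proof (rule ccontr)
    assume "\<not> ?thesis"
    then have "(\<Sum>i\<in>insert j I. (if i = j then 1 else 0) * a i n) = 0" for n
      by (intro sum.neutral) auto
    from insert.prems(4)[OF this] show False by auto
  qed
  then obtain m where m: "a j m \<noteq> 0" by blast
  \<comment> \<open>Equation \<open>n\<close> minus the multiple \<open>a j n / a j m\<close> of the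
    pivot equation \<open>m\<close>, so that the unknown \<open>j\<close> disappears.\<close>
  define a' where "a' i n = a i n - a i m / a j m * a j n" for i n
  define e' where "e' n = e n - e m / a j m * a j n" for n
  have I: "\<forall>i\<in>I. c i \<in> K"
  proof (rule insert.IH)
    show "a' i n \<in> K" if "i \<in> I" for i n
      unfolding a'_def using insert.prems(1) that by (intro complex_subfieldD(4,7,8)[OF K]) auto
    show "e' n \<in> K" for n
      unfolding e'_def using insert.prems(1,2) by (intro complex_subfieldD(4,7,8)[OF K]) auto
    have *: "(\<Sum>i\<in>I. b i * a' i n) = (\<Sum>i\<in>I. b i * a i n) - (\<Sum>i\<in>I. b i * a i m) / a j m * a j n" for b n
      by (simp add: a'_def algebra_simps sum_subtractf sum_distrib_left sum_divide_distrib)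
    show "(\<Sum>i\<in>I. c i * a' i n) = e' n" for n
    proof -
      have S: "(\<Sum>i\<in>I. c i * a i n) = e n - c j * a j n" for n
        using insert.prems(3)[of n] insert.hyps by (simp add: algebra_simps)
      show ?thesis unfolding * e'_def S using m by (simp add: field_simps)
    qed
    show "\<forall>i\<in>I. b i = 0" if b: "\<And>n. (\<Sum>i\<in>I. b i * a' i n) = 0" for b
    proof -
      \<comment> \<open>A relation of the reduced system extends to the full one; the value at
        \<open>j\<close> is the one forced by equation \<open>m\<close>.\<close>
      define b' where "b' i = (if i = j then - (\<Sum>i\<in>I. b i * a i m) / a j m else b i)" for i
      have "(\<Sum>i\<in>insert j I. b' i * a i n) = 0" for n
      proof -
        have "(\<Sum>i\<in>I. b' i * a i n) = (\<Sum>i\<in>I. b i * a i n)"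
          using insert.hyps by (intro sum.cong) (auto simp: b'_def)
        then show ?thesis using insert.hyps b[of n] by (simp add: * b'_def)
      qed
      then show ?thesis using insert.prems(4)[of b'] insert.hyps by (auto simp: b'_def split: if_splits)
    qed
  qed
  have "c j \<in> K"
  proof -
    have "c j = (e m - (\<Sum>i\<in>I. c i * a i m)) / a j m"
      using insert.prems(3)[of m] insert.hyps m by (simp add: field_simps)
    also have "\<dots> \<in> K"
      using insert.prems(1,2) I
      by (intro complex_subfieldD(4,7,8)[OF K] complex_subfield_sum[OF K]) auto
    finally show ?thesis .
  qed
  then show ?case using I by simp
qed simp


section \<open>Fourier expansions and coefficient fields\<close>

lemma nome_surj:
  assumes "w \<noteq> 0" "cmod w < 1"
  obtains z where "Im z > 0" "nome z = w"
proof -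
  define z where "z = Ln w / (2 * of_real pi * \<i>)"
  have "Im z = - ln (cmod w) / (2 * pi)"
    using assms(1) by (simp add: z_def Im_divide power2_eq_square)
  then have "Im z > 0" using assms by (simp add: divide_neg_pos)
  moreover have "nome z = w" using assms(1) by (simp add: nome_def z_def)
  ultimately show ?thesis by (rule that)
qed

lemma norm_nome: "cmod (nome z) = exp (- 2 * pi * Im z)"
  by (simp add: nome_def)

lemma nome_shift: "nome (of_nat d * z) = nome z ^ d"
  by (simp add: nome_def ac_simps flip: exp_of_nat_mult)

text \<open>Vanishing off the upper half-plane is included, so that the coefficients determine the
  function.\<close>

definition q_expansion :: "(complex \<Rightarrow> complex) \<Rightarrow> (nat \<Rightarrow> complex) \<Rightarrow> bool" where
  "q_expansion f a \<longleftrightarrow>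
     (\<forall>z. if Im z > 0 then (\<lambda>n. a n * nome z ^ n) sums f z else f z = 0)"

text \<open>The point \<open>0\<close> is excluded because \<open>nome\<close> never takes that
  value; the constant coefficient is recovered as a limit, and division by \<open>w\<close> shifts
  the series.\<close>

lemma power_series_zero_coeffs:
  fixes a :: "nat \<Rightarrow> complex"
  assumes "\<And>w. w \<noteq> 0 \<Longrightarrow> cmod w < 1 \<Longrightarrow> (\<lambda>n. a n * w ^ n) sums 0"
  shows "a n = 0"
  using assms
proof (induction n arbitrary: a)
  case (0 a)
  have "((\<lambda>w. 0) \<longlongrightarrow> a 0) (at (0::complex))"
    by (rule powser_limit_0_strong[of 1]) (use 0 in auto)
  then show ?case by (simp add: tendsto_const_iff)
next
  case (Suc n a)
  have "((\<lambda>w. 0) \<longlongrightarrow> a 0) (at (0::complex))"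
    by (rule powser_limit_0_strong[of 1]) (use Suc.prems in auto)
  then have a0: "a 0 = 0" by (simp add: tendsto_const_iff)
  show ?case
  proof (rule Suc.IH[of "\<lambda>n. a (Suc n)"])
    fix w :: complex assume w: "w \<noteq> 0" "cmod w < 1"
    have "(\<lambda>n. a (Suc n) * w ^ Suc n) sums 0"
      using Suc.prems[OF w] sums_Suc_iff[of "\<lambda>n. a n * w ^ n" 0] a0 by simp
    then have "(\<lambda>n. a (Suc n) * w ^ Suc n / w) sums (0 / w)" by (rule sums_divide)
    then show "(\<lambda>n. a (Suc n) * w ^ n) sums 0" using w by simp
  qed
qed

lemma q_expansion_unique:
  assumes "\<And>z. Im z > 0 \<Longrightarrow> (\<lambda>n. a n * nome z ^ n) sums f z"
    and "\<And>z. Im z > 0 \<Longrightarrow> (\<lambda>n. b n * nome z ^ n) sums f z"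
  shows "a = b"
proof
  fix n
  have "a n - b n = 0"
  proof (rule power_series_zero_coeffs)
    fix w :: complex assume "w \<noteq> 0" "cmod w < 1"
    then obtain z where z: "Im z > 0" "nome z = w" by (rule nome_surj)
    show "(\<lambda>n. (a n - b n) * w ^ n) sums 0"
      using sums_diff[OF assms(1,2)[OF z(1)]] z(2) by (simp add: left_diff_distrib)
  qed
  then show "a n = b n" by simp
qed

lemma fourier_coeff_eq: "q_expansion f a \<Longrightarrow> fourier_coeff f = a"
  unfolding fourier_coeff_def
  by (rule the_equality) (auto simp: q_expansion_def intro: q_expansion_unique split: if_splits)

lemma q_series_eq: "q_expansion f a \<Longrightarrow> q_series a = f"
  unfolding q_expansion_def q_series_def by (intro ext) (auto simp: sums_iff split: if_splits)

lemma q_expansion_0: "q_expansion 0 (\<lambda>_. 0)"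
  by (simp add: q_expansion_def)

lemma q_expansion_add: "q_expansion f a \<Longrightarrow> q_expansion g b \<Longrightarrow> q_expansion (f + g) (\<lambda>n. a n + b n)"
  by (auto simp: q_expansion_def distrib_right intro: sums_add)

lemma q_expansion_cscale: "q_expansion f a \<Longrightarrow> q_expansion (cscale c f) (\<lambda>n. c * a n)"
  by (auto simp: q_expansion_def cscale_def mult.assoc intro: sums_mult)

lemma q_expansion_sum:
  "finite T \<Longrightarrow> (\<And>i. i \<in> T \<Longrightarrow> q_expansion (f i) (a i)) \<Longrightarrow>
    q_expansion (\<Sum>i\<in>T. f i) (\<lambda>n. \<Sum>i\<in>T. a i n)"
  by (induction T rule: finite_induct) (auto intro: q_expansion_0 q_expansion_add)

lemma q_expansion_shift:
  assumes f: "q_expansion f a" and d: "d > 0"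
  shows "q_expansion (shift d f) (\<lambda>n. if d dvd n then a (n div d) else 0)"
  unfolding q_expansion_def
proof (intro allI)
  fix z
  let ?b = "\<lambda>n. (if d dvd n then a (n div d) else 0) * nome z ^ n"
  show "if Im z > 0 then ?b sums shift d f z else shift d f z = 0"
  proof (cases "Im z > 0")
    case True
    then have "Im (of_nat d * z) > 0" using d by simp
    then have "(\<lambda>n. a n * nome (of_nat d * z) ^ n) sums f (of_nat d * z)"
      using f unfolding q_expansion_def by meson
    then have *: "(\<lambda>n. ?b (d * n)) sums shift d f z"
      using d by (simp add: shift_def nome_shift flip: power_mult)
    have "strict_mono (\<lambda>n. d * n)" using d by (simp add: strict_mono_def)
    moreover have "?b n = 0" if "n \<notin> range (\<lambda>n. d * n)" for n using that by auto
    ultimately have "?b sums shift d f z"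
      using * sums_mono_reindex[of "\<lambda>n. d * n" ?b "shift d f z"] by blast
    then show ?thesis using True by simp
  next
    case False
    then have "\<not> Im (of_nat d * z) > 0" using d by (simp add: zero_less_mult_iff)
    then show ?thesis using False f unfolding q_expansion_def shift_def by meson
  qed
qed

section \<open>Coefficients of Eisenstein series and the field they generate\<close>

definition eisenstein_coeff :: "nat \<Rightarrow> (int \<Rightarrow> complex) \<times> (int \<Rightarrow> complex) \<Rightarrow> nat \<Rightarrow> complex" where
  "eisenstein_coeff k \<Phi> n = (if n = 0
     then (if principal_char (fst \<Phi>) then 1 else 0) / 2 * dirichlet_L (snd \<Phi>) (1 - of_nat k)
     else pair_sigma (k - 1) \<Phi> n)"

abbreviation pair_eisenstein :: "nat \<Rightarrow> (int \<Rightarrow> complex) \<times> (int \<Rightarrow> complex) \<Rightarrow> complex \<Rightarrow> complex" where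
  "pair_eisenstein k \<Phi> \<equiv> eisenstein (fst \<Phi>) (snd \<Phi>) k"

lemma norm_twisted_sigma_le:
  assumes "dirichlet_char N1 \<phi>" "dirichlet_char N2 \<psi>" "n > 0"
  shows "cmod (twisted_sigma \<phi> \<psi> j n) \<le> real n ^ Suc j"
proof -
  have "cmod (twisted_sigma \<phi> \<psi> j n) \<le> (\<Sum>d | d dvd n. real n ^ j)"
    unfolding twisted_sigma_def
  proof (rule sum_norm_le)
    fix d assume "d \<in> {d. d dvd n}"
    then have "d \<le> n" using assms(3) by (auto intro: dvd_imp_le)
    have "cmod (\<phi> (int (n div d)) * \<psi> (int d) * of_nat d ^ j) \<le> 1 * 1 * real n ^ j"
      unfolding norm_mult norm_power norm_of_nat
      using \<open>d \<le> n\<close> dirichlet_char_norm_le[OF assms(1)] dirichlet_char_norm_le[OF assms(2)]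
      by (intro mult_mono power_mono) auto
    then show "cmod (\<phi> (int (n div d)) * \<psi> (int d) * of_nat d ^ j) \<le> real n ^ j" by simp
  qed
  also have "\<dots> = real (card {d. d dvd n}) * real n ^ j" by simp
  also have "card {d. d dvd n} \<le> card {1..n}"
    using assms(3) by (intro card_mono) (auto intro: dvd_imp_le Nat.gr0I)
  then have "real (card {d. d dvd n}) * real n ^ j \<le> real n * real n ^ j"
    by (intro mult_right_mono) auto
  finally show ?thesis by simp
qed

lemma summable_power_times_geometric:
  fixes r :: real
  assumes "0 \<le> r" "r < 1"
  shows "summable (\<lambda>n. real n ^ k * r ^ n)"
proof -
  define c where "c = (1 + r) / 2"
  have c: "r < c" "c < 1" using assms by (simp_all add: c_def)
  have "(\<lambda>n. (1 + inverse (real n)) ^ k * r) \<longlonglongrightarrow> (1 + 0) ^ k * r"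
    by (intro tendsto_intros lim_inverse_n)
  then have "\<forall>\<^sub>F n in sequentially. (1 + inverse (real n)) ^ k * r < c"
    using c(1) by (intro order_tendstoD(2)[of _ "r"]) auto
  then obtain M where M: "\<And>n. n \<ge> M \<Longrightarrow> (1 + inverse (real n)) ^ k * r < c"
    by (auto simp: eventually_sequentially)
  show ?thesis
  proof (rule summable_ratio_test[OF c(2), of "Suc M"])
    fix n assume n: "n \<ge> Suc M"
    have "real (Suc n) ^ k * r ^ Suc n = (1 + inverse (real n)) ^ k * r * (real n ^ k * r ^ n)"
    proof -
      have "real (Suc n) = (1 + inverse (real n)) * real n" using n by (simp add: field_simps)
      then have "real (Suc n) ^ k = (1 + inverse (real n)) ^ k * real n ^ k"
        by (metis power_mult_distrib)
      then show ?thesis by simp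
    qed
    also have "\<dots> \<le> c * (real n ^ k * r ^ n)"
      using M[of n] n assms(1) by (intro mult_right_mono) auto
    finally show "norm (real (Suc n) ^ k * r ^ Suc n) \<le> c * norm (real n ^ k * r ^ n)"
      using assms(1) by simp
  qed
qed

lemma q_expansion_eisenstein:
  assumes "dirichlet_char N1 (fst \<Phi>)" "dirichlet_char N2 (snd \<Phi>)"
  shows "q_expansion (pair_eisenstein k \<Phi>) (eisenstein_coeff k \<Phi>)"
  unfolding q_expansion_def
proof (intro allI)
  fix z
  let ?a = "eisenstein_coeff k \<Phi>"
  show "if Im z > 0 then (\<lambda>n. ?a n * nome z ^ n) sums pair_eisenstein k \<Phi> z
      else pair_eisenstein k \<Phi> z = 0"
  proof (cases "Im z > 0")
    case True
    let ?r = "cmod (nome z)"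
    have r: "0 \<le> ?r" "?r < 1" using True by (simp_all add: norm_nome)
    have "summable (\<lambda>n. ?a n * nome z ^ n)"
    proof (rule summable_comparison_test'[OF summable_power_times_geometric[OF r], of 1])
      fix n :: nat assume n: "n \<ge> 1"
      have "cmod (?a n * nome z ^ n) \<le> real n ^ Suc (k - 1) * ?r ^ n"
        using n norm_twisted_sigma_le[OF assms, of n "k - 1"]
        by (simp add: eisenstein_coeff_def norm_mult norm_power mult_right_mono)
      then show "norm (?a n * nome z ^ n) \<le> real n ^ Suc (k - 1) * ?r ^ n" .
    qed
    then have "(\<lambda>n. ?a n * nome z ^ n) sums (?a 0 + (\<Sum>n. ?a (Suc n) * nome z ^ Suc n))"
      using suminf_split_head[of "\<lambda>n. ?a n * nome z ^ n"] by (simp add: summable_sums_iff)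
    also have "?a 0 + (\<Sum>n. ?a (Suc n) * nome z ^ Suc n) = pair_eisenstein k \<Phi> z"
      using True by (simp add: eisenstein_def eisenstein_coeff_def)
    finally show ?thesis using True by simp
  qed (simp add: eisenstein_def)
qed

text \<open>For newforms of weight at least \<open>2\<close> this is the coefficient field, by
  \<open>coeff_field_eisenstein\<close>; generated by character values, it shows directly how an
  embedding acts.\<close>

definition value_field :: "(int \<Rightarrow> complex) \<times> (int \<Rightarrow> complex) \<Rightarrow> complex set" where
  "value_field \<Phi> = complex_subfield hull (range (fst \<Phi>) \<union> range (snd \<Phi>))"

lemma complex_subfield_value_field: "complex_subfield (value_field \<Phi>)"
  unfolding value_field_def by (rule complex_subfield_hull)

lemma value_field_values: "fst \<Phi> a \<in> value_field \<Phi>" "snd \<Phi> a \<in> value_field \<Phi>"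
  unfolding value_field_def by (auto intro: hull_inc)

lemma pair_sigma_in_subfield:
  assumes L: "complex_subfield L" and "\<And>a. fst \<Phi> a \<in> L" "\<And>a. snd \<Phi> a \<in> L"
  shows "pair_sigma j \<Phi> n \<in> L"
  unfolding twisted_sigma_def
  using assms(2,3)
  by (intro complex_subfield_sum[OF L] complex_subfieldD(4)[OF L] complex_subfield_power[OF L]
      complex_subfield_of_nat[OF L]) auto

lemma eisenstein_coeff_in_subfield:
  assumes L: "complex_subfield L" and vals: "\<And>a. fst \<Phi> a \<in> L" "\<And>a. snd \<Phi> a \<in> L"
    and \<psi>: "dirichlet_char N2 (snd \<Phi>)" and k: "k \<ge> 1"
  shows "eisenstein_coeff k \<Phi> n \<in> L"
proof -
  note Rats = subsetD[OF complex_subfield_Rats[OF L]]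
  obtain r where r: "\<And>i. r i \<in> \<rat>"
    and "\<And>\<phi>. dirichlet_char N2 \<phi> \<Longrightarrow> dirichlet_L \<phi> (1 - of_nat k) = (\<Sum>i<N2. \<phi> (int (Suc i)) * r i)"
    using dirichlet_L_rational_combination[OF dirichlet_char_pos[OF \<psi>] k] by blast
  then have "dirichlet_L (snd \<Phi>) (1 - of_nat k) = (\<Sum>i<N2. snd \<Phi> (int (Suc i)) * r i)"
    using \<psi> by blast
  also have "\<dots> \<in> L"
    by (intro complex_subfield_sum[OF L] complex_subfieldD(4)[OF L] vals Rats r)
  finally have D: "dirichlet_L (snd \<Phi>) (1 - of_nat k) \<in> L" .
  have "(if principal_char (fst \<Phi>) then 1 else 0) / 2 \<in> L" by (rule Rats) auto
  from complex_subfieldD(4)[OF L this D] show ?thesis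
    unfolding eisenstein_coeff_def using pair_sigma_in_subfield[of L \<Phi>, OF L vals] by simp
qed

text \<open>Every unit class modulo \<open>m\<close> contains a positive integer prime to
  \<open>M\<close>, and multiplicativity reduces the value there to values at primes not dividing
  \<open>M\<close>.\<close>

lemma char_values_in_subfield:
  assumes \<phi>: "dirichlet_char m \<phi>" and K: "complex_subfield K" and M: "M > 0" "m dvd M"
    and p: "\<And>p. prime p \<Longrightarrow> \<not> p dvd M \<Longrightarrow> \<phi> (int p) \<in> K"
  shows "\<phi> a \<in> K"
proof (cases "coprime a (int m)")
  case True
  obtain b where b: "[b = a] (mod int m)" "coprime b (int M)"
    using exists_cong_coprime[OF True, of "int M"] M(1) by auto
  define n where "n = nat (b mod int M + int M)"
  have "b mod int M \<ge> 0" using M(1) by simp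
  then have n: "int n = b mod int M + int M" and "n > 0"
    using M(1) unfolding n_def by linarith+
  have nM: "[int n = b] (mod int M)" unfolding n by (simp add: cong_def)
  then have "coprime (int n) (int M)" using b(2) cong_imp_coprime cong_sym by blast
  then have "coprime n M" by simp
  have "[int n = b] (mod int m)" using nM M(2) by (meson cong_dvd_modulus of_nat_dvd_iff)
  then have "\<phi> a = \<phi> (int n)"
    using b(1) dirichlet_char_cong[OF \<phi>] by (metis cong_sym cong_trans)
  also have "\<phi> (int n) \<in> K"
    using \<open>n > 0\<close> \<open>coprime n M\<close>
  proof (induction n rule: prime_divisors_induct)
    case (unit x)
    then show ?case using dirichlet_char_1[OF \<phi>] complex_subfieldD(2)[OF K] by simp
  next
    case (factor q x)
    have "\<not> q dvd M"
      using factor.prems(2) factor.hyps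
      by (metis coprime_common_divisor dvd_triv_left not_prime_unit)
    then show ?case
      using factor p[of q] complex_subfieldD(4)[OF K] by (simp add: dirichlet_char_mult[OF \<phi>])
  qed auto
  finally show ?thesis .
next
  case False
  then show ?thesis
    using dirichlet_char_nonzero_iff[OF \<phi>, of a] complex_subfieldD(1)[OF K] by auto
qed

text \<open>Writing \<open>x = \<phi> p\<close> and \<open>y = \<psi> p * p ^ (k - 1)\<close>, the coefficient field contains the sum of
  \<open>x\<close> and \<open>y\<close>, and also their difference: if both characters have order dividing \<open>r\<close>, then
  \<open>(y - x) * \<sigma> (p ^ (r - 1)) = y ^ r - x ^ r\<close> is a rational number.\<close>

lemma coeff_field_eisenstein:
  assumes \<phi>: "dirichlet_char N1 (fst \<Phi>)" and \<psi>: "dirichlet_char N2 (snd \<Phi>)" and k: "k \<ge> 2"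
  shows "coeff_field (pair_eisenstein k \<Phi>) = value_field \<Phi>"
proof
  let ?f = "pair_eisenstein k \<Phi>" and ?\<phi> = "fst \<Phi>" and ?\<psi> = "snd \<Phi>"
  have f: "fourier_coeff ?f = eisenstein_coeff k \<Phi>"
    by (rule fourier_coeff_eq[OF q_expansion_eisenstein[OF \<phi> \<psi>]])
  show "coeff_field ?f \<subseteq> value_field \<Phi>"
    unfolding coeff_field_def f
    using k eisenstein_coeff_in_subfield[OF complex_subfield_value_field value_field_values \<psi>]
    by (intro hull_minimal complex_subfield_value_field) auto
  let ?K = "coeff_field ?f"
  have K: "complex_subfield ?K" unfolding coeff_field_def by (rule complex_subfield_hull)
  have coeff: "eisenstein_coeff k \<Phi> n \<in> ?K" for n
    unfolding coeff_field_def f by (auto intro: hull_inc)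
  let ?M = "N1 * N2"
  have M: "?M > 0" using dirichlet_char_pos[OF \<phi>] dirichlet_char_pos[OF \<psi>] by simp
  have "?\<phi> (int p) \<in> ?K \<and> ?\<psi> (int p) \<in> ?K" if p: "prime p" "\<not> p dvd ?M" for p
  proof -
    let ?j = "k - 1"
    define x where "x = ?\<phi> (int p)"
    define y where "y = ?\<psi> (int p) * of_nat p ^ ?j"
    \<comment> \<open>One less than the common exponent \<open>fact ?M\<close> of both characters,
      because \<open>geom_conv_diff\<close> raises the exponent by one.\<close>
    define r where "r = fact ?M - (1::nat)"
    have r: "Suc r = fact ?M" by (simp add: r_def)
    have p0: "p > 0" using p(1) by (simp add: prime_gt_0_nat)
    have sigma: "geom_conv x y i \<in> ?K" for i
    proof -
      have "pair_sigma ?j \<Phi> (p ^ i * 1) = geom_conv x y i * pair_sigma ?j \<Phi> 1"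
        unfolding x_def y_def
        using p(1) by (intro twisted_sigma_prime_power[OF \<phi> \<psi>]) (auto dest: not_prime_unit)
      then have "geom_conv x y i = eisenstein_coeff k \<Phi> (p ^ i)"
        using p0 twisted_sigma_1[OF \<phi> \<psi>, of ?j] by (simp add: eisenstein_coeff_def)
      then show ?thesis using coeff by metis
    qed
    have "geom_conv x y 1 = x + y" using geom_conv_Suc[of x y 0] by simp
    then have sum: "x + y \<in> ?K" using sigma[of 1] by simp
    have cop: "coprime (int p) (int N1)" "coprime (int p) (int N2)"
      using p by (auto intro!: prime_imp_coprime)
    then have nz: "?\<phi> (int p) \<noteq> 0" "?\<psi> (int p) \<noteq> 0"
      using dirichlet_char_nonzero_iff[OF \<phi>] dirichlet_char_nonzero_iff[OF \<psi>] by auto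
    have le: "N1 \<le> ?M" "N2 \<le> ?M" using M by auto
    have "x ^ fact ?M = 1" "?\<psi> (int p) ^ fact ?M = 1"
      unfolding x_def using dirichlet_char_root_of_unity[OF \<phi> nz(1) le(1)]
        dirichlet_char_root_of_unity[OF \<psi> nz(2) le(2)] by auto
    then have xr: "x ^ Suc r = 1" and yr: "y ^ Suc r = of_nat (p ^ (?j * Suc r))"
      unfolding r by (simp_all add: y_def power_mult_distrib flip: power_mult)
    have "p ^ (?j * Suc r) > 1"
      using prime_gt_1_nat[OF p(1)] k by (intro one_less_power) auto
    then have q: "y ^ Suc r - x ^ Suc r \<noteq> 0"
      unfolding xr yr by (metis eq_iff_diff_eq_0 less_irrefl of_nat_1 of_nat_eq_iff)
    have "(y - x) * geom_conv x y r = y ^ Suc r - x ^ Suc r" by (rule geom_conv_diff)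
    moreover from this have "geom_conv x y r \<noteq> 0" using q by auto
    ultimately have "y - x = (of_nat (p ^ (?j * Suc r)) - 1) / geom_conv x y r"
      unfolding xr yr by (simp add: field_simps)
    also have "\<dots> \<in> ?K"
      by (intro complex_subfieldD(2,7,8)[OF K] complex_subfield_of_nat[OF K] sigma)
    finally have diff: "y - x \<in> ?K" .
    have two: "2 \<in> ?K" using complex_subfield_of_nat[OF K, of 2] by simp
    have "((x + y) - (y - x)) / 2 \<in> ?K" "((x + y) + (y - x)) / 2 \<in> ?K"
      by (intro complex_subfieldD(3,7,8)[OF K] sum diff two)+
    then have "x \<in> ?K" "y \<in> ?K" by simp_all
    moreover have "?\<psi> (int p) = y / of_nat p ^ ?j" using p0 by (simp add: y_def)
    then have "?\<psi> (int p) \<in> ?K"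
      using complex_subfieldD(8)[OF K \<open>y \<in> ?K\<close> complex_subfield_power[OF K complex_subfield_of_nat[OF K]]]
      by simp
    ultimately show ?thesis by (simp add: x_def)
  qed
  then have "?\<phi> a \<in> ?K" "?\<psi> a \<in> ?K" for a
    using char_values_in_subfield[OF \<phi> K M dvd_triv_left] char_values_in_subfield[OF \<psi> K M dvd_triv_right]
    by blast+
  then show "value_field \<Phi> \<subseteq> ?K"
    unfolding value_field_def by (intro hull_minimal K) auto
qed

section \<open>Conjugation of characters and of Eisenstein series\<close>

definition conj_pair ::
    "(complex \<Rightarrow> complex) \<Rightarrow> (int \<Rightarrow> complex) \<times> (int \<Rightarrow> complex) \<Rightarrow> (int \<Rightarrow> complex) \<times> (int \<Rightarrow> complex)" where
  "conj_pair \<sigma> \<Phi> = (\<lambda>a. \<sigma> (fst \<Phi> a), \<lambda>a. \<sigma> (snd \<Phi> a))"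

context
  fixes L :: "complex set" and \<sigma> :: "complex \<Rightarrow> complex"
  assumes L: "complex_subfield L" and \<sigma>: "field_hom_on L \<sigma>"
begin

lemma dirichlet_char_conj:
  assumes "dirichlet_char m \<phi>" "\<And>a. \<phi> a \<in> L"
  shows "dirichlet_char m (\<lambda>a. \<sigma> (\<phi> a))"
  using assms field_hom_on_eq_0_iff[OF L \<sigma>] field_hom_onD(3)[OF \<sigma>]
  by (auto simp: dirichlet_char_def)

lemma primitive_char_conj:
  assumes "primitive_char m \<phi>" "\<And>a. \<phi> a \<in> L"
  shows "primitive_char m (\<lambda>a. \<sigma> (\<phi> a))"
proof -
  have "\<sigma> (\<phi> a) = \<sigma> (\<phi> b) \<longleftrightarrow> \<phi> a = \<phi> b" for a b
    using field_hom_on_inj[OF L \<sigma>] assms(2) by (auto simp: inj_on_def)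
  then show ?thesis
    using assms dirichlet_char_conj by (simp add: primitive_char_iff)
qed

context
  fixes \<Phi> :: "(int \<Rightarrow> complex) \<times> (int \<Rightarrow> complex)"
  assumes vals: "\<And>a. fst \<Phi> a \<in> L" "\<And>a. snd \<Phi> a \<in> L"
begin

lemma pair_sigma_conj: "pair_sigma j (conj_pair \<sigma> \<Phi>) n = \<sigma> (pair_sigma j \<Phi> n)"
proof -
  have "\<sigma> (pair_sigma j \<Phi> n) = (\<Sum>d | d dvd n. \<sigma> (fst \<Phi> (int (n div d)) * snd \<Phi> (int d) * of_nat d ^ j))"
    unfolding twisted_sigma_def
    using vals complex_subfield_power[OF L complex_subfield_of_nat[OF L]]
    by (intro field_hom_on_sum[OF L \<sigma>]) (auto intro!: complex_subfieldD(4)[OF L])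
  also have "\<dots> = pair_sigma j (conj_pair \<sigma> \<Phi>) n"
    unfolding twisted_sigma_def conj_pair_def
    using vals complex_subfield_power[OF L] complex_subfield_of_nat[OF L] complex_subfieldD(4)[OF L]
    by (intro sum.cong)
      (auto simp: field_hom_onD(3)[OF \<sigma>] field_hom_on_power[OF L \<sigma>] field_hom_on_of_nat[OF L \<sigma>])
  finally show ?thesis ..
qed

text \<open>For the constant term, injectivity of \<sigma> preserves being principal, and the
  weights expressing the L-value depend only on the modulus, which a character shares with its
  conjugate.\<close>

lemma eisenstein_coeff_conj:
  assumes \<psi>: "dirichlet_char N2 (snd \<Phi>)" and k: "k \<ge> 1"
  shows "eisenstein_coeff k (conj_pair \<sigma> \<Phi>) n = \<sigma> (eisenstein_coeff k \<Phi> n)"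
proof (cases "n = 0")
  case True
  have "\<sigma> (fst \<Phi> a) \<noteq> 0 \<longleftrightarrow> fst \<Phi> a \<noteq> 0" "\<sigma> (fst \<Phi> a) = 1 \<longleftrightarrow> fst \<Phi> a = 1" for a
    using field_hom_on_eq_0_iff[OF L \<sigma>] vals field_hom_on_inj[OF L \<sigma>] field_hom_onD(1)[OF \<sigma>]
      complex_subfieldD(2)[OF L] by (auto simp: inj_on_def)
  then have princ: "principal_char (fst (conj_pair \<sigma> \<Phi>)) \<longleftrightarrow> principal_char (fst \<Phi>)"
    by (simp add: principal_char_def conj_pair_def)
  note Rats = subsetD[OF complex_subfield_Rats[OF L]]
  obtain r where r: "\<And>i. r i \<in> \<rat>"
    and Lr: "\<And>\<phi>. dirichlet_char N2 \<phi> \<Longrightarrow> dirichlet_L \<phi> (1 - of_nat k) = (\<Sum>i<N2. \<phi> (int (Suc i)) * r i)"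
    using dirichlet_L_rational_combination[OF dirichlet_char_pos[OF \<psi>] k] by blast
  have "\<sigma> (dirichlet_L (snd \<Phi>) (1 - of_nat k)) = (\<Sum>i<N2. \<sigma> (snd \<Phi> (int (Suc i)) * r i))"
    unfolding Lr[OF \<psi>] using vals Rats r
    by (intro field_hom_on_sum[OF L \<sigma>] complex_subfieldD(4)[OF L]) auto
  also have "\<dots> = (\<Sum>i<N2. \<sigma> (snd \<Phi> (int (Suc i))) * r i)"
    using vals Rats r by (intro sum.cong) (auto simp: field_hom_onD(3)[OF \<sigma>] field_hom_on_Rats[OF L \<sigma>])
  also have "\<dots> = dirichlet_L (snd (conj_pair \<sigma> \<Phi>)) (1 - of_nat k)"
    using Lr[OF dirichlet_char_conj[OF \<psi> vals(2)]] by (simp add: conj_pair_def)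
  finally have L_conj: "\<sigma> (dirichlet_L (snd \<Phi>) (1 - of_nat k)) = dirichlet_L (snd (conj_pair \<sigma> \<Phi>)) (1 - of_nat k)" .
  have "dirichlet_L (snd \<Phi>) (1 - of_nat k) \<in> L"
    unfolding Lr[OF \<psi>] using vals Rats r
    by (intro complex_subfield_sum[OF L] complex_subfieldD(4)[OF L]) auto
  then have "\<sigma> (1 / 2 * dirichlet_L (snd \<Phi>) (1 - of_nat k)) =
      1 / 2 * dirichlet_L (snd (conj_pair \<sigma> \<Phi>)) (1 - of_nat k)"
    using Rats[of "1 / 2"] field_hom_onD(3)[OF \<sigma>, of "1 / 2"] field_hom_on_Rats[OF L \<sigma>, of "1 / 2"] L_conj
    by simp
  then show ?thesis
    using True princ field_hom_on_0[OF L \<sigma>] by (simp add: eisenstein_coeff_def)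
next
  case False
  then show ?thesis by (simp add: eisenstein_coeff_def pair_sigma_conj)
qed

end

end


section \<open>Traces and combinations of shifted newforms\<close>

definition newform_indices ::
    "nat \<Rightarrow> nat \<Rightarrow> (int \<Rightarrow> complex) \<Rightarrow> (((int \<Rightarrow> complex) \<times> (int \<Rightarrow> complex)) \<times> nat) set" where
  "newform_indices k N \<eta> = {(\<Phi>, d). \<exists>N1 N2.
     newform_chars k N \<eta> N1 (fst \<Phi>) N2 (snd \<Phi>) \<and> d dvd N div (N1 * N2)}"

definition shifted_eisenstein ::
    "nat \<Rightarrow> ((int \<Rightarrow> complex) \<times> (int \<Rightarrow> complex)) \<times> nat \<Rightarrow> complex \<Rightarrow> complex" where
  "shifted_eisenstein k = (\<lambda>(\<Phi>, d). shift d (pair_eisenstein k \<Phi>))"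

lemma galois_groupD:
  assumes "\<sigma> \<in> galois_group K"
  shows "field_hom_on K \<sigma>" "\<sigma> \<in> extensional K" "bij_betw \<sigma> K K" "x \<in> K \<Longrightarrow> \<sigma> x \<in> K"
  using assms by (auto simp: galois_group_def field_hom_on_def bij_betw_def)

lemma galois_group_id: "(\<lambda>x\<in>K. x) \<in> galois_group K" if "complex_subfield K"
  using complex_subfieldD[OF that] subsetD[OF complex_subfield_Rats[OF that]]
  by (auto simp: galois_group_def bij_betw_def inj_on_def)

lemma galois_group_compose:
  assumes K: "complex_subfield K" and \<sigma>: "\<sigma> \<in> galois_group K" and \<tau>: "\<tau> \<in> galois_group K"
  shows "compose K \<tau> \<sigma> \<in> galois_group K"
proof -
  have "bij_betw (compose K \<tau> \<sigma>) K K"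
    by (rule bij_betw_compose[OF galois_groupD(3)[OF \<sigma>] galois_groupD(3)[OF \<tau>]])
  then show ?thesis
    using \<sigma> \<tau> complex_subfieldD(3,4)[OF K] subsetD[OF complex_subfield_Rats[OF K]] galois_groupD(4)[OF \<sigma>]
    by (auto simp: galois_group_def compose_def)
qed

text \<open>The elements on which two automorphisms agree form a subfield, which here contains the
  generators of \<open>value_field \<Phi>\<close>.\<close>

lemma galois_group_eqI:
  assumes \<sigma>: "\<sigma> \<in> galois_group (value_field \<Phi>)" and \<tau>: "\<tau> \<in> galois_group (value_field \<Phi>)"
    and eq: "conj_pair \<sigma> \<Phi> = conj_pair \<tau> \<Phi>"
  shows "\<sigma> = \<tau>"
proof (rule extensionalityI[OF galois_groupD(2)[OF \<sigma>] galois_groupD(2)[OF \<tau>]])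
  let ?K = "value_field \<Phi>"
  note K = complex_subfield_value_field[of \<Phi>]
  note s = galois_groupD(1)[OF \<sigma>] and t = galois_groupD(1)[OF \<tau>]
  have "complex_subfield {x \<in> ?K. \<sigma> x = \<tau> x}"
    unfolding complex_subfield_def
    by (auto simp: complex_subfieldD[OF K] field_hom_onD[OF s] field_hom_onD[OF t] field_hom_on_0[OF K s]
        field_hom_on_0[OF K t] field_hom_on_uminus[OF K s] field_hom_on_uminus[OF K t]
        field_hom_on_inverse[OF K s] field_hom_on_inverse[OF K t])
  moreover have "range (fst \<Phi>) \<union> range (snd \<Phi>) \<subseteq> {x \<in> ?K. \<sigma> x = \<tau> x}"
    using eq value_field_values[of \<Phi>] by (auto simp: conj_pair_def fun_eq_iff)
  ultimately have "?K \<subseteq> {x \<in> ?K. \<sigma> x = \<tau> x}"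
    unfolding value_field_def by (rule hull_minimal[rotated])
  then show "\<sigma> x = \<tau> x" if "x \<in> ?K" for x using that by auto
qed

text \<open>Automorphisms inject into the finitely many pairs of characters with the same moduli.
  Finiteness gives the sum in \<open>trace_form\<close> its intended meaning, since sums over
  infinite sets are \<open>0\<close>.\<close>

lemma finite_galois_group:
  assumes "dirichlet_char N1 (fst \<Phi>)" "dirichlet_char N2 (snd \<Phi>)"
  shows "finite (galois_group (value_field \<Phi>))"
proof -
  let ?G = "galois_group (value_field \<Phi>)"
  have "conj_pair \<sigma> \<Phi> \<in> {\<phi>. dirichlet_char N1 \<phi>} \<times> {\<phi>. dirichlet_char N2 \<phi>}" if \<sigma>: "\<sigma> \<in> ?G" for \<sigma>
    using dirichlet_char_conj[OF complex_subfield_value_field galois_groupD(1)[OF \<sigma>] assms(1) value_field_values(1)]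
      dirichlet_char_conj[OF complex_subfield_value_field galois_groupD(1)[OF \<sigma>] assms(2) value_field_values(2)]
    by (simp add: conj_pair_def)
  then have "(\<lambda>\<sigma>. conj_pair \<sigma> \<Phi>) ` ?G \<subseteq> {\<phi>. dirichlet_char N1 \<phi>} \<times> {\<phi>. dirichlet_char N2 \<phi>}"
    by blast
  then have "finite ((\<lambda>\<sigma>. conj_pair \<sigma> \<Phi>) ` ?G)"
    by (rule finite_subset) (intro finite_cartesian_product finite_dirichlet_chars)
  moreover have "inj_on (\<lambda>\<sigma>. conj_pair \<sigma> \<Phi>) ?G"
    by (rule inj_onI) (rule galois_group_eqI)
  ultimately show ?thesis by (rule finite_imageD)
qed

text \<open>The elements that \<sigma> sends into the field of the conjugate pair form a subfield
  containing the generators, so all of \<open>value_field \<Phi>\<close> is sent there; surjectivity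
  of \<sigma> gives the inclusion that is not obvious.\<close>

lemma value_field_conj:
  assumes \<sigma>: "\<sigma> \<in> galois_group (value_field \<Phi>)"
  shows "value_field (conj_pair \<sigma> \<Phi>) = value_field \<Phi>"
proof
  let ?K = "value_field \<Phi>" and ?K' = "value_field (conj_pair \<sigma> \<Phi>)"
  note K = complex_subfield_value_field[of \<Phi>] and K' = complex_subfield_value_field[of "conj_pair \<sigma> \<Phi>"]
  note s = galois_groupD(1)[OF \<sigma>]
  show "?K' \<subseteq> ?K"
    unfolding value_field_def[of "conj_pair \<sigma> \<Phi>"]
    using galois_groupD(4)[OF \<sigma>] value_field_values[of \<Phi>]
    by (intro hull_minimal K) (auto simp: conj_pair_def)
  have "complex_subfield {x \<in> ?K. \<sigma> x \<in> ?K'}"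
    unfolding complex_subfield_def
    by (auto simp: complex_subfieldD[OF K] complex_subfieldD[OF K'] field_hom_onD[OF s] field_hom_on_0[OF K s]
        field_hom_on_uminus[OF K s] field_hom_on_inverse[OF K s])
  moreover have "range (fst \<Phi>) \<union> range (snd \<Phi>) \<subseteq> {x \<in> ?K. \<sigma> x \<in> ?K'}"
    using value_field_values[of \<Phi>] value_field_values[of "conj_pair \<sigma> \<Phi>"] by (auto simp: conj_pair_def)
  ultimately have "?K \<subseteq> {x \<in> ?K. \<sigma> x \<in> ?K'}"
    unfolding value_field_def[of \<Phi>] by (rule hull_minimal[rotated])
  then have "\<sigma> ` ?K \<subseteq> ?K'" by auto
  then show "?K \<subseteq> ?K'" using galois_groupD(3)[OF \<sigma>] by (simp add: bij_betw_def)
qed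

lemma conj_form_eisenstein:
  assumes "dirichlet_char N1 (fst \<Phi>)" "dirichlet_char N2 (snd \<Phi>)" "k \<ge> 1"
    and "complex_subfield K" "field_hom_on K \<sigma>" "\<And>a. fst \<Phi> a \<in> K" "\<And>a. snd \<Phi> a \<in> K"
  shows "conj_form \<sigma> (pair_eisenstein k \<Phi>) = pair_eisenstein k (conj_pair \<sigma> \<Phi>)"
proof -
  have "dirichlet_char N1 (fst (conj_pair \<sigma> \<Phi>))" "dirichlet_char N2 (snd (conj_pair \<sigma> \<Phi>))"
    using assms by (simp_all add: conj_pair_def dirichlet_char_conj)
  from q_expansion_eisenstein[OF this, of k]
  have "q_expansion (pair_eisenstein k (conj_pair \<sigma> \<Phi>)) (\<lambda>n. \<sigma> (eisenstein_coeff k \<Phi> n))"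
    using eisenstein_coeff_conj[OF assms(4-7,2,3)] by (metis ext)
  then show ?thesis
    unfolding conj_form_def fourier_coeff_eq[OF q_expansion_eisenstein[OF assms(1,2)]] by (rule q_series_eq)
qed

lemma trace_form_eisenstein:
  assumes "dirichlet_char N1 (fst \<Phi>)" "dirichlet_char N2 (snd \<Phi>)" "k \<ge> 2"
  shows "trace_form \<alpha> (pair_eisenstein k \<Phi>) =
    (\<Sum>\<sigma>\<in>galois_group (value_field \<Phi>). cscale (\<sigma> \<alpha>) (pair_eisenstein k (conj_pair \<sigma> \<Phi>)))"
  unfolding trace_form_def coeff_field_eisenstein[OF assms]
  using conj_form_eisenstein[OF assms(1,2) _ complex_subfield_value_field galois_groupD(1) value_field_values]
    assms(3)
  by (intro sum.cong) auto

text \<open>Reindexing the sum by composition with \<sigma>, which permutes the finite Galois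
  group.\<close>

lemma trace_form_conj:
  assumes \<Phi>: "dirichlet_char N1 (fst \<Phi>)" "dirichlet_char N2 (snd \<Phi>)" and k: "k \<ge> 2"
    and \<sigma>: "\<sigma> \<in> galois_group (value_field \<Phi>)" and \<alpha>: "\<alpha> \<in> value_field \<Phi>"
  shows "trace_form (\<sigma> \<alpha>) (pair_eisenstein k (conj_pair \<sigma> \<Phi>)) = trace_form \<alpha> (pair_eisenstein k \<Phi>)"
proof -
  let ?K = "value_field \<Phi>" and ?G = "galois_group (value_field \<Phi>)"
  note K = complex_subfield_value_field[of \<Phi>]
  have dc: "dirichlet_char N1 (fst (conj_pair \<sigma> \<Phi>))" "dirichlet_char N2 (snd (conj_pair \<sigma> \<Phi>))"
    using \<Phi> dirichlet_char_conj[OF K galois_groupD(1)[OF \<sigma>]] value_field_values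
    by (simp_all add: conj_pair_def)
  have inj: "inj_on (\<lambda>\<tau>. compose ?K \<tau> \<sigma>) ?G"
  proof (rule inj_onI)
    fix \<tau> \<tau>' assume \<tau>: "\<tau> \<in> ?G" "\<tau>' \<in> ?G" and eq: "compose ?K \<tau> \<sigma> = compose ?K \<tau>' \<sigma>"
    show "\<tau> = \<tau>'"
    proof (rule extensionalityI[OF galois_groupD(2)[OF \<tau>(1)] galois_groupD(2)[OF \<tau>(2)]])
      fix x assume "x \<in> ?K"
      then obtain y where "y \<in> ?K" "x = \<sigma> y"
        using galois_groupD(3)[OF \<sigma>] by (auto simp: bij_betw_def)
      then show "\<tau> x = \<tau>' x" using fun_cong[OF eq, of y] by (simp add: compose_eq)
    qed
  qed
  moreover have "(\<lambda>\<tau>. compose ?K \<tau> \<sigma>) ` ?G \<subseteq> ?G"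
    using galois_group_compose[OF K \<sigma>] by auto
  ultimately have bij: "bij_betw (\<lambda>\<tau>. compose ?K \<tau> \<sigma>) ?G ?G"
    using endo_inj_surj[OF finite_galois_group[OF \<Phi>]] by (simp add: bij_betw_def)
  have "conj_pair (compose ?K \<tau> \<sigma>) \<Phi> = conj_pair \<tau> (conj_pair \<sigma> \<Phi>)" for \<tau>
    using value_field_values[of \<Phi>] by (simp add: conj_pair_def compose_eq)
  then have "trace_form \<alpha> (pair_eisenstein k \<Phi>) =
      (\<Sum>\<tau>\<in>?G. cscale (\<tau> (\<sigma> \<alpha>)) (pair_eisenstein k (conj_pair \<tau> (conj_pair \<sigma> \<Phi>))))"
    unfolding trace_form_eisenstein[OF \<Phi> k] using \<alpha>
    by (subst sum.reindex_bij_betw[OF bij, symmetric]) (simp add: compose_eq)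
  also have "\<dots> = trace_form (\<sigma> \<alpha>) (pair_eisenstein k (conj_pair \<sigma> \<Phi>))"
    unfolding trace_form_eisenstein[OF dc k] value_field_conj[OF \<sigma>] ..
  finally show ?thesis ..
qed

text \<open>Real values of a character are \<open>0\<close> or \<plusminus>\<open>1\<close>, hence
  rational, so the Galois group is trivial. This subsumes rational multiples of real newforms under
  traces.\<close>

lemma trace_form_rational:
  assumes \<Phi>: "dirichlet_char N1 (fst \<Phi>)" "dirichlet_char N2 (snd \<Phi>)" and k: "k \<ge> 2"
    and real: "real_valued_char (fst \<Phi>)" "real_valued_char (snd \<Phi>)" and c: "c \<in> \<rat>"
  shows "trace_form c (pair_eisenstein k \<Phi>) = cscale c (pair_eisenstein k \<Phi>)"
proof -
  let ?K = "value_field \<Phi>"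
  note K = complex_subfield_value_field[of \<Phi>]
  note Rats = subsetD[OF complex_subfield_Rats[OF K]]
  have rat: "\<phi> a \<in> \<rat>" if \<phi>: "dirichlet_char m \<phi>" "real_valued_char \<phi>" for m \<phi> a
  proof (cases "\<phi> a = 0")
    case False
    obtain r where r: "\<phi> a = of_real r"
      using \<phi>(2) by (auto simp: real_valued_char_def elim: Reals_cases)
    then have "\<bar>r\<bar> = 1" using dirichlet_char_norm[OF \<phi>(1) False] by simp
    then have "r = 1 \<or> r = - 1" by linarith
    then show ?thesis using r by auto
  qed auto
  have "conj_pair \<sigma> \<Phi> = \<Phi>" if "\<sigma> \<in> galois_group ?K" for \<sigma>
    using rat[OF \<Phi>(1) real(1)] rat[OF \<Phi>(2) real(2)] field_hom_on_Rats[OF K galois_groupD(1)[OF that]]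
    by (simp add: conj_pair_def)
  then have "galois_group ?K = {\<lambda>x\<in>?K. x}"
    using galois_group_id[OF K] galois_group_eqI by (metis (no_types, lifting) insertI1 is_singletonI' is_singleton_the_elem empty_iff singletonD)
  moreover have "conj_pair (\<lambda>x\<in>?K. x) \<Phi> = \<Phi>"
    using value_field_values[of \<Phi>] by (simp add: conj_pair_def)
  ultimately show ?thesis
    unfolding trace_form_eisenstein[OF \<Phi> k] using Rats[OF c] by simp
qed

definition unity_root :: "nat \<Rightarrow> complex" where
  "unity_root n = cis (2 * pi / real n)"

lemma unity_root:
  assumes "n > 0"
  shows "unity_root n ^ n = 1" and "z ^ n = 1 \<Longrightarrow> \<exists>i. z = unity_root n ^ i"
proof -
  have pow: "unity_root n ^ i = cis (2 * pi * real i / real n)" for i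
    unfolding unity_root_def Complex.DeMoivre by (simp add: mult_ac)
  show "unity_root n ^ n = 1" using assms by (simp add: pow)
  show "\<exists>i. z = unity_root n ^ i" if "z ^ n = 1"
    using Complex.bij_betw_roots_unity[OF assms] that unfolding bij_betw_def pow by blast
qed

text \<open>Since \<open>N!\<close> is a common exponent for all characters of modulus at most
  \<open>N\<close>, a single root of unity accounts for all of them.\<close>

lemma char_values_in_adjoin:
  assumes K: "complex_subfield K" and \<phi>: "dirichlet_char m \<phi>" "m \<le> N"
  shows "\<phi> a \<in> adjoin K (unity_root (fact N))"
proof -
  note L = complex_subfield_adjoin[OF K unity_root(1)[of "fact N"], simplified]
    and \<zeta> = in_adjoin[OF K unity_root(1)[of "fact N"], simplified]
  show ?thesis
  proof (cases "\<phi> a = 0")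
    case True
    then show ?thesis using complex_subfieldD(1)[OF L] by simp
  next
    case False
    then obtain i where "\<phi> a = unity_root (fact N) ^ i"
      using unity_root(2)[of "fact N"] dirichlet_char_root_of_unity[OF \<phi>(1) False \<phi>(2)] by auto
    then show ?thesis using complex_subfield_power[OF L \<zeta>] by simp
  qed
qed

section \<open>The basis of shifted newforms\<close>

context
  fixes k N :: nat and \<eta> :: "int \<Rightarrow> complex"
  assumes k: "k \<ge> 2" and \<eta>: "dirichlet_char N \<eta>"
begin

abbreviation indices where "indices \<equiv> newform_indices k N \<eta>"

lemma N_pos: "N > 0"
  using \<eta> by (rule dirichlet_char_pos)

lemma index_chars:
  assumes "(\<Phi>, d) \<in> indices"
  obtains N1 N2 where "newform_chars k N \<eta> N1 (fst \<Phi>) N2 (snd \<Phi>)" "d dvd N div (N1 * N2)"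
    "primitive_char N1 (fst \<Phi>)" "primitive_char N2 (snd \<Phi>)"
    "dirichlet_char N1 (fst \<Phi>)" "dirichlet_char N2 (snd \<Phi>)" "N1 * N2 dvd N" "N1 \<le> N" "N2 \<le> N"
proof -
  obtain N1 N2 where nf: "newform_chars k N \<eta> N1 (fst \<Phi>) N2 (snd \<Phi>)" "d dvd N div (N1 * N2)"
    using assms by (auto simp: newform_indices_def)
  then have p: "primitive_char N1 (fst \<Phi>)" "primitive_char N2 (snd \<Phi>)" and dv: "N1 * N2 dvd N"
    by (auto simp: newform_chars_def)
  have "N1 dvd N" "N2 dvd N" using dv by (auto intro: dvd_mult_left dvd_mult_right)
  then have "N1 \<le> N" "N2 \<le> N" using N_pos by (auto intro: dvd_imp_le)
  then show ?thesis using that nf p dv by (auto simp: primitive_char_def)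
qed

lemma index_primitive: "(\<Phi>, d) \<in> indices \<Longrightarrow> primitive_pair N \<Phi>"
  by (erule index_chars) (auto simp: primitive_pair_def split_beta)

lemma index_dvd: "(\<Phi>, d) \<in> indices \<Longrightarrow> d dvd N"
  by (erule index_chars) (metis dvd_mult dvd_mult_div_cancel)

lemma index_pos: "(\<Phi>, d) \<in> indices \<Longrightarrow> d > 0"
  using index_dvd N_pos by (metis dvd_0_left_iff gr0I less_irrefl)

lemma finite_indices: "finite indices"
proof (rule finite_subset)
  let ?C = "\<Union>m\<in>{..N}. {\<phi>. dirichlet_char m \<phi>}"
  show "indices \<subseteq> (?C \<times> ?C) \<times> {..N}"
  proof
    fix i assume i: "i \<in> indices"
    obtain \<phi> \<psi> d where i': "i = ((\<phi>, \<psi>), d)" by (metis surj_pair)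
    have "d \<le> N" using index_dvd i i' N_pos by (auto intro: dvd_imp_le)
    moreover have "\<phi> \<in> ?C" "\<psi> \<in> ?C" using i unfolding i' by (auto elim!: index_chars)
    ultimately show "i \<in> (?C \<times> ?C) \<times> {..N}" by (simp add: i')
  qed
  show "finite ((?C \<times> ?C) \<times> {..N})"
    by (intro finite_cartesian_product finite_UN_I finite_dirichlet_chars) auto
qed

definition combination :: "(((int \<Rightarrow> complex) \<times> (int \<Rightarrow> complex)) \<times> nat \<Rightarrow> complex) \<Rightarrow> complex \<Rightarrow> complex" where
  "combination c = (\<Sum>i\<in>indices. cscale (c i) (shifted_eisenstein k i))"

lemma q_expansion_shifted_eisenstein:
  assumes "(\<Phi>, d) \<in> indices"
  shows "q_expansion (shifted_eisenstein k (\<Phi>, d)) (\<lambda>n. if d dvd n then eisenstein_coeff k \<Phi> (n div d) else 0)"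
proof -
  obtain N1 N2 where "dirichlet_char N1 (fst \<Phi>)" "dirichlet_char N2 (snd \<Phi>)"
    using assms by (rule index_chars)
  from q_expansion_shift[OF q_expansion_eisenstein[OF this] index_pos[OF assms]] show ?thesis
    by (simp add: shifted_eisenstein_def)
qed

text \<open>At positive indices the coefficients are pure divisor sums, to which
  \<open>shifted_sigma_independent\<close> applies.\<close>

lemma fourier_coeff_combination:
  assumes "n > 0"
  shows "fourier_coeff (combination c) n = (\<Sum>i\<in>indices. c i * shifted_sigma (k - 1) i n)"
proof -
  let ?a = "\<lambda>i n. if snd i dvd n then eisenstein_coeff k (fst i) (n div snd i) else 0"
  have "q_expansion (shifted_eisenstein k i) (?a i)" if "i \<in> indices" for i
    using q_expansion_shifted_eisenstein[of "fst i" "snd i"] that by simp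
  then have "q_expansion (combination c) (\<lambda>n. \<Sum>i\<in>indices. c i * ?a i n)"
    unfolding combination_def by (intro q_expansion_sum finite_indices q_expansion_cscale)
  then have "fourier_coeff (combination c) n = (\<Sum>i\<in>indices. c i * ?a i n)"
    by (simp add: fourier_coeff_eq)
  also have "\<dots> = (\<Sum>i\<in>indices. c i * shifted_sigma (k - 1) i n)"
  proof (intro sum.cong refl)
    fix i assume "i \<in> indices"
    show "c i * ?a i n = c i * shifted_sigma (k - 1) i n"
      using assms by (auto simp: shifted_sigma_def eisenstein_coeff_def split_beta dvd_div_eq_0_iff)
  qed
  finally show ?thesis .
qed

lemma combination_inj:
  assumes "combination c = combination c'" "i \<in> indices"
  shows "c i = c' i"
proof -
  have "\<forall>i\<in>indices. c i - c' i = 0"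
  proof (rule shifted_sigma_independent[OF finite_indices, of N "k - 1"])
    show "primitive_pair N \<Phi> \<and> d dvd N" if "(\<Phi>, d) \<in> indices" for \<Phi> d
      using that index_primitive index_dvd by blast
    show "(\<Sum>i\<in>indices. (c i - c' i) * shifted_sigma (k - 1) i n) = 0" if "n > 0" for n
      using fourier_coeff_combination[OF that, of c] fourier_coeff_combination[OF that, of c'] assms(1)
      by (simp add: left_diff_distrib sum_subtractf)
  qed (use N_pos k in auto)
  then show ?thesis using assms(2) by auto
qed

lemma combination_0: "combination (\<lambda>_. 0) = 0"
  by (simp add: combination_def cscale_def fun_eq_iff zero_fun_def)

lemma combination_add: "combination (\<lambda>i. c i + c' i) = combination c + combination c'"
proof -
  have "cscale (x + y) f = cscale x f + cscale y f" for x y f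
    by (simp add: cscale_def fun_eq_iff distrib_right)
  then show ?thesis by (simp add: combination_def sum.distrib)
qed

lemma combination_sum: "finite S \<Longrightarrow> combination (\<lambda>i. \<Sum>s\<in>S. t s i) = (\<Sum>s\<in>S. combination (t s))"
  by (induction S rule: finite_induct) (auto simp: combination_0 combination_add)

lemma combination_cong: "(\<And>i. i \<in> indices \<Longrightarrow> c i = c' i) \<Longrightarrow> combination c = combination c'"
  by (simp add: combination_def)

lemma combination_single:
  assumes "i \<in> indices"
  shows "combination (\<lambda>j. if j = i then x else 0) = cscale x (shifted_eisenstein k i)"
proof -
  have "cscale (if j = i then x else 0) (shifted_eisenstein k j) =
      (if j = i then cscale x (shifted_eisenstein k i) else 0)" for j
    by (auto simp: cscale_def zero_fun_def)
  then show ?thesis using finite_indices assms by (simp add: combination_def)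
qed

lemma inj_shifted_eisenstein: "inj_on (shifted_eisenstein k) indices"
proof (rule inj_onI)
  fix i j assume ij: "i \<in> indices" "j \<in> indices" "shifted_eisenstein k i = shifted_eisenstein k j"
  then have "combination (\<lambda>l. if l = i then 1 else 0) = combination (\<lambda>l. if l = j then 1 else 0)"
    by (simp add: combination_single)
  from combination_inj[OF this ij(1)] show "i = j" by (simp split: if_splits)
qed

lemma index_1: "(\<Phi>, d) \<in> indices \<Longrightarrow> (\<Phi>, 1) \<in> indices"
  by (auto simp: newform_indices_def)

lemma pair_eisenstein_inj:
  assumes "(\<Phi>, d) \<in> indices" "(\<Psi>, e) \<in> indices" "pair_eisenstein k \<Phi> = pair_eisenstein k \<Psi>"
  shows "\<Phi> = \<Psi>"
proof -
  have "shifted_eisenstein k (\<Phi>, 1) = shifted_eisenstein k (\<Psi>, 1)"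
    using assms(3) by (simp add: shifted_eisenstein_def)
  then show ?thesis
    using inj_shifted_eisenstein index_1[OF assms(1)] index_1[OF assms(2)] by (auto dest: inj_onD)
qed

text \<open>The normalisation to \<open>0\<close> off \<open>indices\<close> carries information
  later: a nonzero coefficient at a conjugate pair shows that this pair again has character
  \<eta>.\<close>

lemma eisenstein_space_coefficients:
  assumes "E \<in> eisenstein_space k N \<eta>"
  shows "\<exists>c. E = combination c \<and> (\<forall>i. i \<notin> indices \<longrightarrow> c i = 0)"
proof -
  interpret vs: vector_space cscale by (rule vector_space_cscale)
  have "{shift d (eisenstein \<phi>1 \<phi>2 k) | d N1 \<phi>1 N2 \<phi>2.
      newform_chars k N \<eta> N1 \<phi>1 N2 \<phi>2 \<and> d dvd N div (N1 * N2)} = shifted_eisenstein k ` indices"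
    by (force simp: newform_indices_def shifted_eisenstein_def image_iff)
  then have "E \<in> vs.span (shifted_eisenstein k ` indices)"
    using assms by (simp add: eisenstein_space_def)
  then obtain u where "E = (\<Sum>v\<in>shifted_eisenstein k ` indices. cscale (u v) v)"
    using vs.span_finite[OF finite_imageI[OF finite_indices]] by auto
  also have "\<dots> = combination (\<lambda>i. u (shifted_eisenstein k i))"
    by (simp add: sum.reindex[OF inj_shifted_eisenstein] combination_def)
  also have "\<dots> = combination (\<lambda>i. if i \<in> indices then u (shifted_eisenstein k i) else 0)"
    by (rule combination_cong) simp
  finally show ?thesis by (intro exI[of _ "\<lambda>i. if i \<in> indices then u (shifted_eisenstein k i) else 0"]) auto
qed

end


section \<open>Decomposition into traces\<close>

context
  fixes k N :: nat and \<eta> :: "int \<Rightarrow> complex"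
  assumes k: "k \<ge> 2" and \<eta>: "dirichlet_char N \<eta>"
begin

abbreviation idx where "idx \<equiv> newform_indices k N \<eta>"
abbreviation comb where "comb \<equiv> combination k N \<eta>"

section \<open>Galois action on the basis coefficients\<close>

context
  fixes c :: "((int \<Rightarrow> complex) \<times> (int \<Rightarrow> complex)) \<times> nat \<Rightarrow> complex"
  assumes c_0: "\<And>i. i \<notin> idx \<Longrightarrow> c i = 0"
    and rational: "\<And>n. fourier_coeff (comb c) n \<in> \<rat>"
begin

text \<open>Applying \<open>\<tau>\<close> to the rational coefficients of \<open>E\<close> gives a second expression of \<open>E\<close> by shifts
  of newforms, possibly with another character, which must be the same as the first one.\<close>

lemma coefficient_conj:
  assumes L: "complex_subfield L" and \<tau>: "field_hom_on L \<tau>"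
    and vals: "\<And>\<Phi> d a. (\<Phi>, d) \<in> idx \<Longrightarrow> fst \<Phi> a \<in> L \<and> snd \<Phi> a \<in> L"
    and cL: "\<And>i. i \<in> idx \<Longrightarrow> c i \<in> L"
    and i: "(\<Phi>, d) \<in> idx"
  shows "c (conj_pair \<tau> \<Phi>, d) = \<tau> (c (\<Phi>, d))"
proof -
  let ?t = "\<lambda>i. (conj_pair \<tau> (fst i), snd i)"
  \<comment> \<open>The conjugate indices may belong to another character and lie outside
    \<open>idx\<close>; there \<open>c\<close> vanishes by assumption.\<close>
  let ?T = "idx \<union> ?t ` idx"
  let ?s = "shifted_sigma (k - 1)"
  \<comment> \<open>The coefficients of the conjugated combination, pushed forward along
    \<open>?t\<close>. Injectivity of \<open>?t\<close> on \<open>idx\<close>, shown at the end,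
    reduces each sum to one term.\<close>
  define c' where "c' l = (\<Sum>i\<in>idx. if ?t i = l then \<tau> (c i) else 0)" for l
  note fin = finite_indices[OF k \<eta>]
  have s: "?s i n \<in> L" "?s (?t i) n = \<tau> (?s i n)" if i: "i \<in> idx" for i n
  proof -
    obtain \<Phi> d where i': "i = (\<Phi>, d)" by (cases i)
    have v: "\<And>a. fst \<Phi> a \<in> L" "\<And>a. snd \<Phi> a \<in> L" using vals i i' by blast+
    show "?s i n \<in> L"
      using pair_sigma_in_subfield[of L \<Phi>, OF L v] complex_subfieldD(1)[OF L]
      by (simp add: shifted_sigma_def i')
    show "?s (?t i) n = \<tau> (?s i n)"
      using pair_sigma_conj[OF L \<tau>, of \<Phi>, OF v] field_hom_on_0[OF L \<tau>]
      by (simp add: shifted_sigma_def i')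
  qed
  have "\<forall>l\<in>?T. c l - c' l = 0"
  proof (rule shifted_sigma_independent[of _ N "k - 1"])
    show "finite ?T" using fin by simp
    show "primitive_pair N \<Psi> \<and> e dvd N" if mem: "(\<Psi>, e) \<in> ?T" for \<Psi> e
    proof (cases "(\<Psi>, e) \<in> idx")
      case True
      then show ?thesis using index_primitive[OF k \<eta>] index_dvd[OF k \<eta>] by blast
    next
      case False
      then obtain \<Phi> where \<Phi>: "(\<Phi>, e) \<in> idx" "\<Psi> = conj_pair \<tau> \<Phi>" using mem by auto
      obtain N1 N2 where p: "primitive_char N1 (fst \<Phi>)" "primitive_char N2 (snd \<Phi>)" "N1 * N2 dvd N"
        using index_chars[OF k \<eta> \<Phi>(1)] by blast
      have "primitive_char N1 (fst \<Psi>)" "primitive_char N2 (snd \<Psi>)"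
        unfolding \<Phi>(2) conj_pair_def using primitive_char_conj[OF L \<tau>] p vals[OF \<Phi>(1)] by simp_all
      then show ?thesis
        using p(3) index_dvd[OF k \<eta> \<Phi>(1)] by (auto simp: primitive_pair_def split_beta)
    qed
    show "(\<Sum>l\<in>?T. (c l - c' l) * ?s l n) = 0" if n: "n > 0" for n
    proof -
      have "(\<Sum>l\<in>?T. c l * ?s l n) = (\<Sum>i\<in>idx. c i * ?s i n)"
        using fin c_0 by (intro sum.mono_neutral_right) auto
      also have "\<dots> = fourier_coeff (comb c) n"
        by (rule fourier_coeff_combination[OF k \<eta> n, symmetric])
      finally have 1: "(\<Sum>l\<in>?T. c l * ?s l n) = fourier_coeff (comb c) n" .
      have "(\<Sum>l\<in>?T. c' l * ?s l n) = (\<Sum>l\<in>?T. \<Sum>i\<in>idx. if l = ?t i then \<tau> (c i) * ?s (?t i) n else 0)"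
        unfolding c'_def sum_distrib_right by (intro sum.cong refl) auto
      also have "\<dots> = (\<Sum>i\<in>idx. \<Sum>l\<in>?T. if l = ?t i then \<tau> (c i) * ?s (?t i) n else 0)"
        by (rule sum.swap)
      also have "\<dots> = (\<Sum>i\<in>idx. \<tau> (c i) * ?s (?t i) n)"
        using fin by (intro sum.cong refl) (subst sum.delta, auto)
      also have "\<dots> = (\<Sum>i\<in>idx. \<tau> (c i * ?s i n))"
        using cL s by (intro sum.cong refl) (simp add: field_hom_onD(3)[OF \<tau>])
      also have "\<dots> = \<tau> (\<Sum>i\<in>idx. c i * ?s i n)"
        using cL s by (intro field_hom_on_sum[OF L \<tau>, symmetric] complex_subfieldD(4)[OF L])
      also have "\<dots> = \<tau> (fourier_coeff (comb c) n)"
        by (simp add: fourier_coeff_combination[OF k \<eta> n])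
      also have "\<dots> = fourier_coeff (comb c) n"
        by (rule field_hom_on_Rats[OF L \<tau> rational])
      finally show ?thesis using 1 by (simp add: left_diff_distrib sum_subtractf)
    qed
  qed (use N_pos[OF k \<eta>] k in auto)
  then have "c (conj_pair \<tau> \<Phi>, d) = c' (conj_pair \<tau> \<Phi>, d)" using i by force
  also have "c' (conj_pair \<tau> \<Phi>, d) = (\<Sum>l\<in>idx. if l = (\<Phi>, d) then \<tau> (c l) else 0)"
    unfolding c'_def
  proof (intro sum.cong refl)
    fix l assume l: "l \<in> idx"
    obtain \<Psi> e where l': "l = (\<Psi>, e)" by (cases l)
    have "\<Psi> = \<Phi>" if eq: "conj_pair \<tau> \<Psi> = conj_pair \<tau> \<Phi>"
    proof -
      have "\<tau> (fst \<Psi> a) = \<tau> (fst \<Phi> a)" "\<tau> (snd \<Psi> a) = \<tau> (snd \<Phi> a)" for a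
        using eq by (simp_all add: conj_pair_def fun_eq_iff)
      then have "fst \<Psi> a = fst \<Phi> a" "snd \<Psi> a = snd \<Phi> a" for a
        using field_hom_on_inj[OF L \<tau>] vals[OF i] vals[OF l[unfolded l']] by (auto simp: inj_on_def)
      then show ?thesis by (simp add: prod_eq_iff fun_eq_iff)
    qed
    then show "(if ?t l = (conj_pair \<tau> \<Phi>, d) then \<tau> (c l) else 0) = (if l = (\<Phi>, d) then \<tau> (c l) else 0)"
      by (auto simp: l')
  qed
  also have "\<dots> = \<tau> (c (\<Phi>, d))" using fin i by simp
  finally show ?thesis .
qed

text \<open>The positive Fourier coefficients form a linear system for the \<open>c i\<close> with
  entries in the extension and rational right-hand sides; independence makes it uniquely solvable.
  \<open>K\<close> is kept general to allow both the rationals and a field of character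
  values.\<close>

lemma adjoin_unity:
  assumes K: "complex_subfield K"
  shows "complex_subfield (adjoin K (unity_root (fact N)))" "K \<subseteq> adjoin K (unity_root (fact N))"
    and "(\<Phi>, d) \<in> idx \<Longrightarrow> fst \<Phi> a \<in> adjoin K (unity_root (fact N)) \<and> snd \<Phi> a \<in> adjoin K (unity_root (fact N))"
    and "i \<in> idx \<Longrightarrow> c i \<in> adjoin K (unity_root (fact N))"
proof -
  let ?L = "adjoin K (unity_root (fact N))"
  show L: "complex_subfield ?L" and sub: "K \<subseteq> ?L"
    using complex_subfield_adjoin[OF K unity_root(1)] subset_adjoin[OF K unity_root(1)] by simp_all
  show vals: "fst \<Phi> a \<in> ?L \<and> snd \<Phi> a \<in> ?L" if "(\<Phi>, d) \<in> idx" for \<Phi> d a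
    using index_chars[OF k \<eta> that] char_values_in_adjoin[OF K] by metis
  let ?a = "\<lambda>i n. shifted_sigma (k - 1) i (Suc n)"
  have "\<forall>i\<in>idx. c i \<in> ?L"
  proof (rule linear_system_solution_in_subfield[OF L finite_indices[OF k \<eta>]])
    show "?a i n \<in> ?L" if i: "i \<in> idx" for i n
    proof -
      obtain \<Phi> d where i': "i = (\<Phi>, d)" by (cases i)
      have v: "\<And>a. fst \<Phi> a \<in> ?L" "\<And>a. snd \<Phi> a \<in> ?L" using vals i i' by blast+
      show ?thesis
        using pair_sigma_in_subfield[of ?L \<Phi>, OF L v] complex_subfieldD(1)[OF L]
        by (simp add: shifted_sigma_def i')
    qed
    show "fourier_coeff (comb c) (Suc n) \<in> ?L" for n
      using rational complex_subfield_Rats[OF L] by blast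
    show "(\<Sum>i\<in>idx. c i * ?a i n) = fourier_coeff (comb c) (Suc n)" for n
      by (simp add: fourier_coeff_combination[OF k \<eta>])
    show "\<forall>i\<in>idx. b i = 0" if b: "\<And>n. (\<Sum>i\<in>idx. b i * ?a i n) = 0" for b
    proof (rule shifted_sigma_independent[OF finite_indices[OF k \<eta>], of N "k - 1"])
      show "primitive_pair N \<Phi> \<and> d dvd N" if "(\<Phi>, d) \<in> idx" for \<Phi> d
        using that index_primitive[OF k \<eta>] index_dvd[OF k \<eta>] by blast
      show "(\<Sum>i\<in>idx. b i * shifted_sigma (k - 1) i n) = 0" if "n > 0" for n
        using b[of "n - 1"] that by simp
    qed (use N_pos[OF k \<eta>] k in auto)
  qed
  then show "c i \<in> ?L" if "i \<in> idx" using that by blast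
qed

lemma coefficient_conj_unity:
  assumes K: "complex_subfield K" and \<tau>: "field_hom_on (adjoin K (unity_root (fact N))) \<tau>"
    and i: "(\<Phi>, d) \<in> idx"
  shows "c (conj_pair \<tau> \<Phi>, d) = \<tau> (c (\<Phi>, d))"
  by (rule coefficient_conj[OF adjoin_unity(1)[OF K] \<tau> _ _ i]) (use adjoin_unity(3,4)[OF K] in auto)

text \<open>An embedding that fixes \<open>value_field \<Phi>\<close> fixes the pair \<Phi>, hence
  its coefficient, and \<open>fixed_field\<close> applies.\<close>

lemma coefficient_in_value_field:
  assumes i: "(\<Phi>, d) \<in> idx"
  shows "c (\<Phi>, d) \<in> value_field \<Phi>"
proof -
  note K = complex_subfield_value_field[of \<Phi>]
  let ?\<zeta> = "unity_root (fact N)"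
  have one: "?\<zeta> ^ fact N = 1" by (rule unity_root(1)) simp
  show ?thesis
  proof (rule fixed_field[OF K one])
    show "c (\<Phi>, d) \<in> adjoin (value_field \<Phi>) ?\<zeta>" by (rule adjoin_unity(4)[OF K i])
    fix \<tau> assume \<tau>: "field_hom_on (adjoin (value_field \<Phi>) ?\<zeta>) \<tau>" "\<forall>y\<in>value_field \<Phi>. \<tau> y = y"
    have "conj_pair \<tau> \<Phi> = \<Phi>" using \<tau>(2) value_field_values by (simp add: conj_pair_def)
    then show "\<tau> (c (\<Phi>, d)) = c (\<Phi>, d)" using coefficient_conj_unity[OF K \<tau>(1) i] by simp
  qed simp
qed

text \<open>As \<sigma> acts on \<open>value_field \<Phi>\<close> only, it is first extended to the
  field with the root of unity adjoined, which contains all coefficients.\<close>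

lemma coefficient_conj_galois:
  assumes i: "(\<Phi>, d) \<in> idx" and \<sigma>: "\<sigma> \<in> galois_group (value_field \<Phi>)"
  shows "c (conj_pair \<sigma> \<Phi>, d) = \<sigma> (c (\<Phi>, d))"
proof -
  note K = complex_subfield_value_field[of \<Phi>]
  let ?\<zeta> = "unity_root (fact N)"
  have one: "?\<zeta> ^ fact N = 1" by (rule unity_root(1)) simp
  obtain \<tau> where \<tau>: "field_hom_on (adjoin (value_field \<Phi>) ?\<zeta>) \<tau>" "\<And>x. x \<in> value_field \<Phi> \<Longrightarrow> \<tau> x = \<sigma> x"
    using field_hom_extend[OF K one _ galois_groupD(1)[OF \<sigma>]] by auto
  have "conj_pair \<tau> \<Phi> = conj_pair \<sigma> \<Phi>"
    using \<tau>(2) value_field_values by (simp add: conj_pair_def)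
  then show ?thesis
    using coefficient_conj_unity[OF K \<tau>(1) i] \<tau>(2) coefficient_in_value_field[OF i] by simp
qed

text \<open>A nonzero coefficient at \<Phi> gives a nonzero one at its conjugate, which must
  therefore be an index for \<eta> as well. So \<eta> is the product of both the original and the
  conjugate pair at units modulo \<open>N\<close>.\<close>

lemma character_rational:
  assumes i: "(\<Phi>, d) \<in> idx" "c (\<Phi>, d) \<noteq> 0" and a: "coprime a (int N)"
  shows "\<eta> a \<in> \<rat>"
proof -
  note K = complex_subfield_Rats_self
  let ?\<zeta> = "unity_root (fact N)"
  have one: "?\<zeta> ^ fact N = 1" by (rule unity_root(1)) simp
  have \<eta>_eq: "\<eta> a = fst \<Psi> a * snd \<Psi> a" if "(\<Psi>, d) \<in> idx" for \<Psi>
    using index_chars[OF k \<eta> that] a by (metis newform_chars_def)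
  show ?thesis
  proof (rule fixed_field[OF K one])
    show "\<eta> a \<in> adjoin \<rat> ?\<zeta>" by (rule char_values_in_adjoin[OF K \<eta> order_refl])
    fix \<tau> assume \<tau>: "field_hom_on (adjoin \<rat> ?\<zeta>) \<tau>"
    note L = adjoin_unity(1)[OF K]
    have "\<tau> (c (\<Phi>, d)) \<noteq> 0"
      using i field_hom_on_eq_0_iff[OF L \<tau> adjoin_unity(4)[OF K i(1)]] by simp
    then have "(conj_pair \<tau> \<Phi>, d) \<in> idx"
      using coefficient_conj_unity[OF K \<tau> i(1)] c_0 by metis
    then have "\<eta> a = \<tau> (fst \<Phi> a) * \<tau> (snd \<Phi> a)"
      using \<eta>_eq[of "conj_pair \<tau> \<Phi>"] by (simp add: conj_pair_def)
    also have "\<dots> = \<tau> (\<eta> a)"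
      unfolding \<eta>_eq[OF i(1)] using field_hom_onD(3)[OF \<tau>] adjoin_unity(3)[OF K i(1)] by simp
    finally show "\<tau> (\<eta> a) = \<eta> a" ..
  qed simp
qed

end

section \<open>Traces expressed in the basis\<close>

context
  assumes \<eta>_rational: "\<And>a. coprime a (int N) \<Longrightarrow> \<eta> a \<in> \<rat>"
begin

text \<open>The parity condition and the product condition have rational values, which \<sigma>
  fixes; the moduli, and with them the admissible shifts, are unchanged.\<close>

lemma index_conj:
  assumes i: "(\<Phi>, d) \<in> idx" and \<sigma>: "\<sigma> \<in> galois_group (value_field \<Phi>)"
  shows "(conj_pair \<sigma> \<Phi>, d) \<in> idx"
proof -
  note K = complex_subfield_value_field[of \<Phi>] and s = galois_groupD(1)[OF \<sigma>]
  note v = value_field_values[of \<Phi>]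
  obtain N1 N2 where nf: "newform_chars k N \<eta> N1 (fst \<Phi>) N2 (snd \<Phi>)" "d dvd N div (N1 * N2)"
    using index_chars[OF k \<eta> i] by blast
  have mult: "\<sigma> (fst \<Phi> a) * \<sigma> (snd \<Phi> b) = \<sigma> (fst \<Phi> a * snd \<Phi> b)" for a b
    using field_hom_onD(3)[OF s] v by simp
  have "(-1) ^ k \<in> (\<rat> :: complex set)" by (intro Rats_power) auto
  then have sign: "\<sigma> ((-1) ^ k) = (-1) ^ k" by (rule field_hom_on_Rats[OF K s])
  have "newform_chars k N \<eta> N1 (fst (conj_pair \<sigma> \<Phi>)) N2 (snd (conj_pair \<sigma> \<Phi>))"
    unfolding newform_chars_def conj_pair_def fst_conv snd_conv mult
  proof (intro conjI)
    show "primitive_char N1 (\<lambda>a. \<sigma> (fst \<Phi> a))" "primitive_char N2 (\<lambda>a. \<sigma> (snd \<Phi> a))"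
      using nf(1) v by (auto simp: newform_chars_def intro!: primitive_char_conj[OF K s])
    show "\<sigma> (fst \<Phi> (- 1) * snd \<Phi> (- 1)) = (- 1) ^ k"
      using nf(1) sign by (simp add: newform_chars_def)
    show "\<forall>a. coprime a (int N) \<longrightarrow> \<sigma> (fst \<Phi> a * snd \<Phi> a) = \<eta> a"
      using nf(1) field_hom_on_Rats[OF K s \<eta>_rational] by (simp add: newform_chars_def)
  qed (use nf(1) in \<open>auto simp: newform_chars_def\<close>)
  then show ?thesis using nf(2) by (auto simp: newform_indices_def)
qed

lemma constituentE:
  assumes "constituent k N \<eta> f d g"
  obtains \<Phi> \<alpha> where "(\<Phi>, d) \<in> idx" "f = pair_eisenstein k \<Phi>" "\<alpha> \<in> value_field \<Phi>"
    "g = trace_form \<alpha> (pair_eisenstein k \<Phi>)"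
proof -
  obtain N1 \<phi>1 N2 \<phi>2 where nf: "newform_chars k N \<eta> N1 \<phi>1 N2 \<phi>2" and f: "f = eisenstein \<phi>1 \<phi>2 k"
    and d: "d dvd N div (N1 * N2)"
    and g: "(\<exists>\<alpha>\<in>coeff_field f. g = trace_form \<alpha> f) \<or>
         (real_valued_char \<phi>1 \<and> real_valued_char \<phi>2 \<and> (\<exists>c\<in>\<rat>. g = cscale c f))"
    using assms unfolding constituent_def by blast
  define \<Phi> where "\<Phi> = (\<phi>1, \<phi>2)"
  have i: "(\<Phi>, d) \<in> idx" using nf d by (auto simp: newform_indices_def \<Phi>_def)
  have dc: "dirichlet_char N1 (fst \<Phi>)" "dirichlet_char N2 (snd \<Phi>)"
    using nf by (simp_all add: newform_chars_def primitive_char_def \<Phi>_def)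
  have f': "f = pair_eisenstein k \<Phi>" by (simp add: f \<Phi>_def)
  have "\<exists>\<alpha>\<in>value_field \<Phi>. g = trace_form \<alpha> f"
    using g
  proof
    assume "\<exists>\<alpha>\<in>coeff_field f. g = trace_form \<alpha> f"
    then show ?thesis unfolding f' coeff_field_eisenstein[OF dc k] .
  next
    assume *: "real_valued_char \<phi>1 \<and> real_valued_char \<phi>2 \<and> (\<exists>c\<in>\<rat>. g = cscale c f)"
    then obtain c where c: "c \<in> \<rat>" "g = cscale c f" by blast
    have "trace_form c (pair_eisenstein k \<Phi>) = cscale c (pair_eisenstein k \<Phi>)"
      by (rule trace_form_rational[OF dc k]) (use * c in \<open>auto simp: \<Phi>_def\<close>)
    then show ?thesis
      using c complex_subfield_Rats[OF complex_subfield_value_field] unfolding f' by (metis subsetD)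
  qed
  then show ?thesis using that[OF i f'] f' by auto
qed

lemma constituentI:
  assumes "(\<Phi>, d) \<in> idx" "\<alpha> \<in> value_field \<Phi>"
  shows "constituent k N \<eta> (pair_eisenstein k \<Phi>) d (trace_form \<alpha> (pair_eisenstein k \<Phi>))"
proof -
  obtain N1 N2 where nf: "newform_chars k N \<eta> N1 (fst \<Phi>) N2 (snd \<Phi>)" "d dvd N div (N1 * N2)"
    and dc: "dirichlet_char N1 (fst \<Phi>)" "dirichlet_char N2 (snd \<Phi>)"
    using index_chars[OF k \<eta> assms(1)] by blast
  show ?thesis
    unfolding constituent_def using nf assms(2) coeff_field_eisenstein[OF dc k] by metis
qed

definition trace_coeff where
  "trace_coeff \<Phi> d \<alpha> i = (\<Sum>\<sigma>\<in>galois_group (value_field \<Phi>). if i = (conj_pair \<sigma> \<Phi>, d) then \<sigma> \<alpha> else 0)"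
  for \<alpha> :: complex and d :: nat

lemma shift_trace_form:
  assumes i: "(\<Phi>, d) \<in> idx"
  shows "shift d (trace_form \<alpha> (pair_eisenstein k \<Phi>)) = comb (trace_coeff \<Phi> d \<alpha>)"
proof -
  let ?G = "galois_group (value_field \<Phi>)"
  obtain N1 N2 where dc: "dirichlet_char N1 (fst \<Phi>)" "dirichlet_char N2 (snd \<Phi>)"
    using index_chars[OF k \<eta> i] by blast
  have fin: "finite ?G" by (rule finite_galois_group[OF dc])
  have shift_sum: "shift d (\<Sum>\<sigma>\<in>A. F \<sigma>) = (\<Sum>\<sigma>\<in>A. shift d (F \<sigma>))" if "finite A"
    for A and F :: "(complex \<Rightarrow> complex) \<Rightarrow> complex \<Rightarrow> complex"
    using that by (induction A rule: finite_induct) (auto simp: shift_def fun_eq_iff)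
  have "comb (trace_coeff \<Phi> d \<alpha>) = (\<Sum>\<sigma>\<in>?G. comb (\<lambda>i. if i = (conj_pair \<sigma> \<Phi>, d) then \<sigma> \<alpha> else 0))"
    unfolding trace_coeff_def by (rule combination_sum[OF k \<eta> fin])
  also have "\<dots> = (\<Sum>\<sigma>\<in>?G. cscale (\<sigma> \<alpha>) (shifted_eisenstein k (conj_pair \<sigma> \<Phi>, d)))"
    by (intro sum.cong refl combination_single[OF k \<eta>] index_conj[OF i])
  also have "\<dots> = shift d (trace_form \<alpha> (pair_eisenstein k \<Phi>))"
    unfolding trace_form_eisenstein[OF dc k] shift_sum[OF fin]
    by (intro sum.cong refl) (simp add: shifted_eisenstein_def shift_def cscale_def)
  finally show ?thesis ..
qed

text \<open>Different automorphisms produce different pairs, so a single term of the sum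
  survives.\<close>

lemma trace_coeff_conj:
  assumes i: "(\<Phi>, d) \<in> idx" and \<sigma>: "\<sigma> \<in> galois_group (value_field \<Phi>)"
  shows "trace_coeff \<Phi> d \<alpha> (conj_pair \<sigma> \<Phi>, d) = \<sigma> \<alpha>"
proof -
  let ?G = "galois_group (value_field \<Phi>)"
  obtain N1 N2 where dc: "dirichlet_char N1 (fst \<Phi>)" "dirichlet_char N2 (snd \<Phi>)"
    using index_chars[OF k \<eta> i] by blast
  have "trace_coeff \<Phi> d \<alpha> (conj_pair \<sigma> \<Phi>, d) = (\<Sum>\<tau>\<in>?G. if \<tau> = \<sigma> then \<tau> \<alpha> else 0)"
    unfolding trace_coeff_def using galois_group_eqI[OF \<sigma>] by (intro sum.cong refl) auto
  then show ?thesis using finite_galois_group[OF dc] \<sigma> by simp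
qed

lemma trace_coeff_self:
  assumes i: "(\<Phi>, d) \<in> idx" and \<alpha>: "\<alpha> \<in> value_field \<Phi>"
  shows "trace_coeff \<Phi> d \<alpha> (\<Phi>, d) = \<alpha>"
proof -
  let ?id = "\<lambda>x\<in>value_field \<Phi>. x"
  have "conj_pair ?id \<Phi> = \<Phi>" using value_field_values by (simp add: conj_pair_def)
  then show ?thesis
    using trace_coeff_conj[OF i galois_group_id[OF complex_subfield_value_field], of \<alpha>] \<alpha> by simp
qed

lemma trace_coeff_nonzero:
  assumes "trace_coeff \<Phi> d \<alpha> (\<Psi>, e) \<noteq> 0"
  obtains \<sigma> where "\<sigma> \<in> galois_group (value_field \<Phi>)" "\<Psi> = conj_pair \<sigma> \<Phi>" "e = d"
proof -
  obtain \<sigma> where "\<sigma> \<in> galois_group (value_field \<Phi>)" "(if (\<Psi>, e) = (conj_pair \<sigma> \<Phi>, d) then \<sigma> \<alpha> else 0) \<noteq> 0"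
    using assms unfolding trace_coeff_def by (rule sum.not_neutral_contains_not_neutral)
  then show ?thesis using that by (auto split: if_splits)
qed

lemma trace_form_index_conj:
  assumes "(\<Phi>, d) \<in> idx" "\<sigma> \<in> galois_group (value_field \<Phi>)" "\<alpha> \<in> value_field \<Phi>"
  shows "trace_form (\<sigma> \<alpha>) (pair_eisenstein k (conj_pair \<sigma> \<Phi>)) = trace_form \<alpha> (pair_eisenstein k \<Phi>)"
proof -
  obtain N1 N2 where "dirichlet_char N1 (fst \<Phi>)" "dirichlet_char N2 (snd \<Phi>)"
    using index_chars[OF k \<eta> assms(1)] by blast
  from trace_form_conj[OF this k assms(2,3)] show ?thesis .
qed

lemma trace_form_0:
  assumes "(\<Phi>, d) \<in> idx"
  shows "trace_form 0 (pair_eisenstein k \<Phi>) = 0"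
proof -
  obtain N1 N2 where dc: "dirichlet_char N1 (fst \<Phi>)" "dirichlet_char N2 (snd \<Phi>)"
    using index_chars[OF k \<eta> assms] by blast
  have "cscale (\<sigma> 0) f = 0" if "\<sigma> \<in> galois_group (value_field \<Phi>)" for \<sigma> f
    using field_hom_on_0[OF complex_subfield_value_field galois_groupD(1)[OF that]]
    by (simp add: cscale_def zero_fun_def)
  then show ?thesis unfolding trace_form_eisenstein[OF dc k] by (simp add: sum.neutral)
qed

lemma galois_conjugate_eisenstein:
  assumes i: "(\<Phi>, d) \<in> idx" and j: "(\<Psi>, e) \<in> idx"
  shows "galois_conjugate (pair_eisenstein k \<Phi>) (pair_eisenstein k \<Psi>) \<longleftrightarrow>
    (\<exists>\<sigma>\<in>galois_group (value_field \<Phi>). \<Psi> = conj_pair \<sigma> \<Phi>)"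
proof -
  obtain N1 N2 where dc: "dirichlet_char N1 (fst \<Phi>)" "dirichlet_char N2 (snd \<Phi>)"
    using index_chars[OF k \<eta> i] by blast
  have "conj_form \<sigma> (pair_eisenstein k \<Phi>) = pair_eisenstein k (conj_pair \<sigma> \<Phi>)"
    if "\<sigma> \<in> galois_group (value_field \<Phi>)" for \<sigma>
    using k value_field_values
    by (intro conj_form_eisenstein[OF dc _ complex_subfield_value_field galois_groupD(1)[OF that]]) auto
  moreover have "pair_eisenstein k \<Psi> = pair_eisenstein k (conj_pair \<sigma> \<Phi>) \<longleftrightarrow> \<Psi> = conj_pair \<sigma> \<Phi>"
    if "\<sigma> \<in> galois_group (value_field \<Phi>)" for \<sigma>
    using pair_eisenstein_inj[OF k \<eta> j index_conj[OF i that]] by blast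
  ultimately show ?thesis
    unfolding galois_conjugate_def coeff_field_eisenstein[OF dc k] by auto
qed

section \<open>Existence and uniqueness of the decomposition\<close>

context
  fixes c :: "((int \<Rightarrow> complex) \<times> (int \<Rightarrow> complex)) \<times> nat \<Rightarrow> complex"
  assumes c_0: "\<And>i. i \<notin> idx \<Longrightarrow> c i = 0"
    and rational: "\<And>n. fourier_coeff (comb c) n \<in> \<rat>"
begin

text \<open>Constant on Galois orbits, so its image contains one summand for each orbit and
  shift.\<close>

abbreviation orbit_trace where
  "orbit_trace i \<equiv> (trace_form (c i) (pair_eisenstein k (fst i)), snd i)"

lemma in_field: "(\<Phi>, d) \<in> idx \<Longrightarrow> c (\<Phi>, d) \<in> value_field \<Phi>"
  by (rule coefficient_in_value_field[OF c_0 rational])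

lemma orbit_trace_conj:
  assumes "(\<Phi>, d) \<in> idx" "\<sigma> \<in> galois_group (value_field \<Phi>)"
  shows "orbit_trace (conj_pair \<sigma> \<Phi>, d) = orbit_trace (\<Phi>, d)"
  using trace_form_index_conj[OF assms in_field[OF assms(1)]]
    coefficient_conj_galois[OF c_0 rational assms] by simp

lemma decomposition_coefficients:
  assumes dec: "decomposition k N \<eta> (comb c) S"
  obtains P b where "\<And>t. t \<in> S \<Longrightarrow> (P t, snd t) \<in> idx" "\<And>t. t \<in> S \<Longrightarrow> b t \<in> value_field (P t)"
    "\<And>t. t \<in> S \<Longrightarrow> fst t = trace_form (b t) (pair_eisenstein k (P t))"
    "\<And>i. i \<in> idx \<Longrightarrow> c i = (\<Sum>t\<in>S. trace_coeff (P t) (snd t) (b t) i)"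
proof -
  have fin: "finite S" and con: "\<And>g d. (g, d) \<in> S \<Longrightarrow> \<exists>f. constituent k N \<eta> f d g"
    and E: "comb c = (\<Sum>(g, d)\<in>S. shift d g)"
    using dec unfolding decomposition_def by blast+
  have "\<exists>\<Psi> \<beta>. (\<Psi>, snd t) \<in> idx \<and> \<beta> \<in> value_field \<Psi> \<and> fst t = trace_form \<beta> (pair_eisenstein k \<Psi>)"
    if "t \<in> S" for t
  proof -
    obtain f where "constituent k N \<eta> f (snd t) (fst t)"
      using con[of "fst t" "snd t"] \<open>t \<in> S\<close> by auto
    then show ?thesis by (rule constituentE) blast
  qed
  then obtain P b where Pb: "\<And>t. t \<in> S \<Longrightarrow> (P t, snd t) \<in> idx"
    "\<And>t. t \<in> S \<Longrightarrow> b t \<in> value_field (P t)"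
    "\<And>t. t \<in> S \<Longrightarrow> fst t = trace_form (b t) (pair_eisenstein k (P t))"
    by metis
  have "comb c = (\<Sum>t\<in>S. comb (trace_coeff (P t) (snd t) (b t)))"
    unfolding E
  proof (intro sum.cong refl)
    fix t assume "t \<in> S"
    then show "(case t of (g, d) \<Rightarrow> shift d g) = comb (trace_coeff (P t) (snd t) (b t))"
      using shift_trace_form[OF Pb(1)] Pb(3) by (simp add: split_beta)
  qed
  also have "\<dots> = comb (\<lambda>i. \<Sum>t\<in>S. trace_coeff (P t) (snd t) (b t) i)"
    by (rule combination_sum[OF k \<eta> fin, symmetric])
  finally show ?thesis using that[OF Pb] combination_inj[OF k \<eta>] by blast
qed

text \<open>Any other summand contributing to the basis coefficient at \<open>(\<Phi>, d)\<close>
  would come from a newform conjugate to that of \<Phi> with the same shift, which a decomposition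
  forbids.\<close>

lemma decomposition_coefficient:
  assumes dec: "decomposition k N \<eta> (comb c) S" and s: "(trace_form \<alpha> (pair_eisenstein k \<Phi>), d) \<in> S"
    and i: "(\<Phi>, d) \<in> idx" and \<alpha>: "\<alpha> \<in> value_field \<Phi>"
  shows "c (\<Phi>, d) = \<alpha>"
proof -
  have fin: "finite S"
    and nconj: "\<And>g g' d f f'. (g, d) \<in> S \<Longrightarrow> (g', d) \<in> S \<Longrightarrow> g \<noteq> g' \<Longrightarrow>
        constituent k N \<eta> f d g \<Longrightarrow> constituent k N \<eta> f' d g' \<Longrightarrow> \<not> galois_conjugate f f'"
    using dec unfolding decomposition_def by blast+
  obtain P b where Pb: "\<And>t. t \<in> S \<Longrightarrow> (P t, snd t) \<in> idx"
    "\<And>t. t \<in> S \<Longrightarrow> b t \<in> value_field (P t)"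
    "\<And>t. t \<in> S \<Longrightarrow> fst t = trace_form (b t) (pair_eisenstein k (P t))"
    and c: "\<And>i. i \<in> idx \<Longrightarrow> c i = (\<Sum>t\<in>S. trace_coeff (P t) (snd t) (b t) i)"
    using decomposition_coefficients[OF dec] by blast
  have "c (\<Phi>, d) = (\<Sum>t\<in>S. trace_coeff (P t) (snd t) (b t) (\<Phi>, d))" by (rule c[OF i])
  also have "\<dots> = (\<Sum>t\<in>S. if t = (trace_form \<alpha> (pair_eisenstein k \<Phi>), d) then \<alpha> else 0)"
  proof (intro sum.cong refl)
    fix t assume t: "t \<in> S"
    show "trace_coeff (P t) (snd t) (b t) (\<Phi>, d) =
        (if t = (trace_form \<alpha> (pair_eisenstein k \<Phi>), d) then \<alpha> else 0)"
    proof (cases "t = (trace_form \<alpha> (pair_eisenstein k \<Phi>), d)")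
      case True
      have "comb (trace_coeff (P t) (snd t) (b t)) = shift (snd t) (fst t)"
        using shift_trace_form[OF Pb(1)[OF t], of "b t"] Pb(3)[OF t] by simp
      also have "\<dots> = comb (trace_coeff \<Phi> d \<alpha>)"
        using True shift_trace_form[OF i] by simp
      finally show ?thesis
        using True combination_inj[OF k \<eta> _ i] trace_coeff_self[OF i \<alpha>] by metis
    next
      case False
      have "trace_coeff (P t) (snd t) (b t) (\<Phi>, d) = 0"
      proof (rule ccontr)
        assume "\<not> ?thesis"
        then obtain \<sigma> where \<sigma>: "\<sigma> \<in> galois_group (value_field (P t))" "\<Phi> = conj_pair \<sigma> (P t)" "d = snd t"
          by (rule trace_coeff_nonzero)
        have "(fst t, d) \<in> S" "fst t \<noteq> trace_form \<alpha> (pair_eisenstein k \<Phi>)"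
          using t False \<sigma>(3) by (auto simp: prod_eq_iff)
        moreover have "constituent k N \<eta> (pair_eisenstein k (P t)) d (fst t)"
          using constituentI[OF Pb(1,2)[OF t]] Pb(3)[OF t] \<sigma>(3) by simp
        ultimately have "\<not> galois_conjugate (pair_eisenstein k (P t)) (pair_eisenstein k \<Phi>)"
          using nconj s constituentI[OF i \<alpha>] by blast
        then show False using \<sigma> galois_conjugate_eisenstein[OF Pb(1)[OF t] i] by blast
      qed
      then show ?thesis using False by simp
    qed
  qed
  also have "\<dots> = \<alpha>" using fin s by simp
  finally show ?thesis .
qed

lemma decomposition_unique:
  assumes dec: "decomposition k N \<eta> (comb c) S"
  shows "S = orbit_trace ` {i \<in> idx. c i \<noteq> 0}"
proof (intro equalityI subsetI)
  fix s assume s: "s \<in> S"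
  obtain g d where s': "s = (g, d)" by (cases s)
  have "g \<noteq> 0" "\<exists>f. constituent k N \<eta> f d g"
    using dec s unfolding decomposition_def s' by blast+
  then obtain \<Phi> \<alpha> where i: "(\<Phi>, d) \<in> idx" and \<alpha>: "\<alpha> \<in> value_field \<Phi>"
    and g: "g = trace_form \<alpha> (pair_eisenstein k \<Phi>)" by (auto elim!: constituentE)
  have c: "c (\<Phi>, d) = \<alpha>"
    using decomposition_coefficient[OF dec _ i \<alpha>] s unfolding s' g by blast
  have "\<alpha> \<noteq> 0" using \<open>g \<noteq> 0\<close> g trace_form_0[OF i] by auto
  then show "s \<in> orbit_trace ` {i \<in> idx. c i \<noteq> 0}"
    using i c by (intro image_eqI[of _ _ "(\<Phi>, d)"]) (auto simp: s' g)
next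
  fix s assume "s \<in> orbit_trace ` {i \<in> idx. c i \<noteq> 0}"
  then obtain \<Phi> d where i: "(\<Phi>, d) \<in> idx" "c (\<Phi>, d) \<noteq> 0" and s: "s = orbit_trace (\<Phi>, d)" by auto
  obtain P b where Pb: "\<And>t. t \<in> S \<Longrightarrow> (P t, snd t) \<in> idx"
    "\<And>t. t \<in> S \<Longrightarrow> b t \<in> value_field (P t)"
    "\<And>t. t \<in> S \<Longrightarrow> fst t = trace_form (b t) (pair_eisenstein k (P t))"
    and c: "\<And>i. i \<in> idx \<Longrightarrow> c i = (\<Sum>t\<in>S. trace_coeff (P t) (snd t) (b t) i)"
    using decomposition_coefficients[OF dec] by blast
  \<comment> \<open>A nonzero \<open>c (\<Phi>, d)\<close> requires a summand whose trace involves
    \<Phi>. Rewriting that trace with \<Phi> as representative of the orbit makes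
    \<open>decomposition_coefficient\<close> applicable.\<close>
  have "(\<Sum>t\<in>S. trace_coeff (P t) (snd t) (b t) (\<Phi>, d)) \<noteq> 0" using c[OF i(1)] i(2) by simp
  then obtain t where t: "t \<in> S" and nz: "trace_coeff (P t) (snd t) (b t) (\<Phi>, d) \<noteq> 0"
    by (rule sum.not_neutral_contains_not_neutral)
  obtain \<sigma> where \<sigma>: "\<sigma> \<in> galois_group (value_field (P t))" "\<Phi> = conj_pair \<sigma> (P t)" "d = snd t"
    using nz by (rule trace_coeff_nonzero)
  have "(trace_form (\<sigma> (b t)) (pair_eisenstein k \<Phi>), d) = t"
    using trace_form_index_conj[OF Pb(1)[OF t] \<sigma>(1) Pb(2)[OF t]] Pb(3)[OF t] \<sigma>(2,3)
    by (simp add: prod_eq_iff)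
  then have mem: "(trace_form (\<sigma> (b t)) (pair_eisenstein k \<Phi>), d) \<in> S" using t by simp
  have "\<sigma> (b t) \<in> value_field \<Phi>"
    using galois_groupD(4)[OF \<sigma>(1) Pb(2)[OF t]] value_field_conj[OF \<sigma>(1)] \<sigma>(2) by simp
  from decomposition_coefficient[OF dec mem i(1) this] show "s \<in> S" using mem s by simp
qed

text \<open>Comparing basis coefficients at \<open>(\<Psi>, d)\<close>: a nonzero trace determines
  its newform up to conjugation, and then also the number in front of it.\<close>

lemma orbit_trace_coefficient:
  assumes i: "(\<Phi>, d) \<in> idx" and j: "(\<Psi>, d) \<in> idx" and \<alpha>: "\<alpha> \<in> value_field \<Psi>" "\<alpha> \<noteq> 0"
    and eq: "trace_form \<alpha> (pair_eisenstein k \<Psi>) = trace_form (c (\<Phi>, d)) (pair_eisenstein k \<Phi>)"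
  obtains \<sigma> where "\<sigma> \<in> galois_group (value_field \<Phi>)" "\<Psi> = conj_pair \<sigma> \<Phi>" "\<alpha> = c (\<Psi>, d)"
proof -
  have "comb (trace_coeff \<Psi> d \<alpha>) = comb (trace_coeff \<Phi> d (c (\<Phi>, d)))"
    using eq by (simp flip: shift_trace_form[OF i] shift_trace_form[OF j])
  then have *: "\<alpha> = trace_coeff \<Phi> d (c (\<Phi>, d)) (\<Psi>, d)"
    using combination_inj[OF k \<eta> _ j] trace_coeff_self[OF j \<alpha>(1)] by metis
  then obtain \<sigma> where \<sigma>: "\<sigma> \<in> galois_group (value_field \<Phi>)" "\<Psi> = conj_pair \<sigma> \<Phi>"
    using \<alpha>(2) trace_coeff_nonzero by metis
  then have "\<alpha> = c (\<Psi>, d)"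
    using * trace_coeff_conj[OF i \<sigma>(1)] coefficient_conj_galois[OF c_0 rational i \<sigma>(1)] by simp
  then show ?thesis using that \<sigma> by blast
qed

lemma decomposition_exists: "decomposition k N \<eta> (comb c) (orbit_trace ` {i \<in> idx. c i \<noteq> 0})"
  (is "decomposition _ _ _ _ ?S")
  unfolding decomposition_def
proof (intro conjI)
  show fin: "finite ?S" using finite_indices[OF k \<eta>] by simp
  have S_nonzero: "trace_form (c (\<Phi>, d)) (pair_eisenstein k \<Phi>) \<noteq> 0"
    if i: "(\<Phi>, d) \<in> idx" "c (\<Phi>, d) \<noteq> 0" for \<Phi> d
  proof
    assume "trace_form (c (\<Phi>, d)) (pair_eisenstein k \<Phi>) = 0"
    then have "comb (trace_coeff \<Phi> d (c (\<Phi>, d))) = comb (\<lambda>_. 0)"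
      using shift_trace_form[OF i(1), of "c (\<Phi>, d)"]
      by (simp add: combination_0[OF k \<eta>] shift_def zero_fun_def)
    from combination_inj[OF k \<eta> this i(1)] show False
      using trace_coeff_self[OF i(1) in_field[OF i(1)]] i(2) by simp
  qed
  show "\<forall>(g, d)\<in>?S. g \<noteq> 0 \<and> (\<exists>f. constituent k N \<eta> f d g)"
    using S_nonzero constituentI[OF _ in_field] by fastforce
  show "\<forall>g g' d f f'. (g, d) \<in> ?S \<and> (g', d) \<in> ?S \<and> g \<noteq> g' \<and>
      constituent k N \<eta> f d g \<and> constituent k N \<eta> f' d g' \<longrightarrow> \<not> galois_conjugate f f'"
  proof (intro allI impI notI, elim conjE)
    fix g g' d f f'
    assume g: "(g, d) \<in> ?S" "(g', d) \<in> ?S" and ne: "g \<noteq> g'"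
      and con: "constituent k N \<eta> f d g" "constituent k N \<eta> f' d g'" and gal: "galois_conjugate f f'"
    \<comment> \<open>The condition on a decomposition quantifies over every newform a summand can
      be attributed to; whichever is taken, the factor in the trace is the basis
      coefficient.\<close>
    have rep: "h = trace_form (c (\<Psi>, d)) (pair_eisenstein k \<Psi>)"
      if h: "(h, d) \<in> ?S" and j: "(\<Psi>, d) \<in> idx" "\<alpha> \<in> value_field \<Psi>" "h = trace_form \<alpha> (pair_eisenstein k \<Psi>)"
      for h \<Psi> \<alpha>
    proof -
      obtain \<Phi> where i: "(\<Phi>, d) \<in> idx" "c (\<Phi>, d) \<noteq> 0" "h = trace_form (c (\<Phi>, d)) (pair_eisenstein k \<Phi>)"
        using h by auto
      then have "\<alpha> \<noteq> 0" using S_nonzero[OF i(1,2)] trace_form_0[OF j(1)] j(3) by auto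
      then have "\<alpha> = c (\<Psi>, d)"
        using orbit_trace_coefficient[OF i(1) j(1,2)] i(3) j(3) by metis
      then show ?thesis using j(3) by simp
    qed
    obtain \<Phi> \<alpha> where i: "(\<Phi>, d) \<in> idx" "f = pair_eisenstein k \<Phi>" "\<alpha> \<in> value_field \<Phi>"
      "g = trace_form \<alpha> (pair_eisenstein k \<Phi>)" using con(1) by (rule constituentE)
    obtain \<Psi> \<beta> where j: "(\<Psi>, d) \<in> idx" "f' = pair_eisenstein k \<Psi>" "\<beta> \<in> value_field \<Psi>"
      "g' = trace_form \<beta> (pair_eisenstein k \<Psi>)" using con(2) by (rule constituentE)
    obtain \<sigma> where \<sigma>: "\<sigma> \<in> galois_group (value_field \<Phi>)" "\<Psi> = conj_pair \<sigma> \<Phi>"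
      using gal galois_conjugate_eisenstein[OF i(1) j(1)] unfolding i(2) j(2) by blast
    have "g' = g"
      using rep[OF g(1) i(1,3,4)] rep[OF g(2) j(1,3,4)] orbit_trace_conj[OF i(1) \<sigma>(1)] \<sigma>(2) by simp
    with ne show False by simp
  qed
  \<comment> \<open>The restriction of \<open>c\<close> to the fibre of \<open>orbit_trace\<close>
    over \<open>s\<close>; the fibres partition the indices.\<close>
  define t where "t s i = (if s = orbit_trace i then c i else 0)" for s i
  have "shift (snd s) (fst s) = comb (t s)" if s: "s \<in> ?S" for s
  proof -
    obtain \<Phi> d where i: "(\<Phi>, d) \<in> idx" "c (\<Phi>, d) \<noteq> 0" and s': "s = orbit_trace (\<Phi>, d)" using s by auto
    have "shift (snd s) (fst s) = comb (trace_coeff \<Phi> d (c (\<Phi>, d)))"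
      using shift_trace_form[OF i(1)] by (simp add: s')
    also have "\<dots> = comb (t s)"
    proof (rule combination_cong[OF k \<eta>])
      fix j assume "j \<in> idx"
      obtain \<Psi> e where j': "j = (\<Psi>, e)" by (cases j)
      then have j: "(\<Psi>, e) \<in> idx" using \<open>j \<in> idx\<close> by simp
      show "trace_coeff \<Phi> d (c (\<Phi>, d)) j = t s j"
      \<comment> \<open>Among the indices with nonzero coefficient this fibre is the Galois orbit of
        \<open>(\<Phi>, d)\<close>; each case proves one inclusion.\<close>
      proof (cases "\<exists>\<sigma>\<in>galois_group (value_field \<Phi>). j = (conj_pair \<sigma> \<Phi>, d)")
        case True
        then obtain \<sigma> where \<sigma>: "\<sigma> \<in> galois_group (value_field \<Phi>)" "j = (conj_pair \<sigma> \<Phi>, d)" by blast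
        have "orbit_trace j = s" using orbit_trace_conj[OF i(1) \<sigma>(1)] by (simp only: \<sigma>(2) s')
        then show ?thesis
          using trace_coeff_conj[OF i(1) \<sigma>(1)] coefficient_conj_galois[OF c_0 rational i(1) \<sigma>(1)]
          by (simp add: t_def \<sigma>(2))
      next
        case False
        then have "trace_coeff \<Phi> d (c (\<Phi>, d)) j = 0"
          unfolding j' by (metis trace_coeff_nonzero)
        moreover have "c j = 0" if "s = orbit_trace j"
        proof (rule ccontr)
          assume "c j \<noteq> 0"
          have "e = d" and "trace_form (c (\<Psi>, d)) (pair_eisenstein k \<Psi>) = trace_form (c (\<Phi>, d)) (pair_eisenstein k \<Phi>)"
            using that by (auto simp: s' j')
          moreover have "(\<Psi>, d) \<in> idx" "c (\<Psi>, d) \<noteq> 0" using j j' \<open>c j \<noteq> 0\<close> \<open>e = d\<close> by auto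
          ultimately obtain \<sigma> where "\<sigma> \<in> galois_group (value_field \<Phi>)" "\<Psi> = conj_pair \<sigma> \<Phi>"
            using orbit_trace_coefficient[OF i(1) _ in_field] by metis
          then show False using False j' \<open>e = d\<close> by blast
        qed
        ultimately show ?thesis by (simp add: t_def)
      qed
    qed
    finally show ?thesis .
  qed
  then have "(\<Sum>(g, d)\<in>?S. shift d g) = (\<Sum>s\<in>?S. comb (t s))"
    by (intro sum.cong refl) (simp add: split_beta)
  also have "\<dots> = comb (\<lambda>i. \<Sum>s\<in>?S. t s i)"
    by (rule combination_sum[OF k \<eta> fin, symmetric])
  also have "\<dots> = comb c"
  proof (rule combination_cong[OF k \<eta>])
    fix i assume i: "i \<in> idx"
    have "(\<Sum>s\<in>?S. t s i) = (if orbit_trace i \<in> ?S then c i else 0)"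
      unfolding t_def using fin by (rule sum.delta)
    then show "(\<Sum>s\<in>?S. t s i) = c i" using i by auto
  qed
  finally show "comb c = (\<Sum>(g, d)\<in>?S. shift d g)" ..
qed

end

end

end

theorem theorem6p6:
  fixes k N :: nat and \<eta> :: "int \<Rightarrow> complex" and E :: "complex \<Rightarrow> complex"
  assumes "k \<ge> 2"
    and "dirichlet_char N \<eta>"
    and "E \<in> eisenstein_space k N \<eta>"
    and "\<forall>n. fourier_coeff E n \<in> \<rat>"
    and "E \<noteq> 0"
  shows "(principal_char \<eta> \<or> quadratic_char \<eta>) \<and> (\<exists>!S. decomposition k N \<eta> E S)"
proof
  obtain c where E: "E = combination k N \<eta> c" and c_0: "\<And>i. i \<notin> newform_indices k N \<eta> \<Longrightarrow> c i = 0"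
    using eisenstein_space_coefficients[OF assms(1-3)] by blast
  have rational: "fourier_coeff (combination k N \<eta> c) n \<in> \<rat>" for n
    using assms(4) E by blast
  have "\<exists>i\<in>newform_indices k N \<eta>. c i \<noteq> 0"
  proof (rule ccontr)
    assume "\<not> ?thesis"
    then have "E = combination k N \<eta> (\<lambda>_. 0)"
      unfolding E by (intro combination_cong[OF assms(1,2)]) auto
    then show False using combination_0[OF assms(1,2)] assms(5) by simp
  qed
  then obtain \<Phi> d where "(\<Phi>, d) \<in> newform_indices k N \<eta>" "c (\<Phi>, d) \<noteq> 0" by auto
  note \<eta>_rational = character_rational[OF assms(1,2) c_0 rational this]
  \<comment> \<open>A nonzero value is rational of absolute value \<open>1\<close>, hence
    \<open>1\<close> or \<open>- 1\<close>.\<close>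
  have "\<eta> a ^ 2 = 1" if "\<eta> a \<noteq> 0" for a
  proof -
    have "\<eta> a \<in> \<rat>"
      using \<eta>_rational dirichlet_char_nonzero_iff[OF assms(2)] that by blast
    then obtain p q :: int where "\<eta> a = of_int p / of_int q" by (metis Rats_cases')
    then have "\<eta> a = of_real (of_int p / of_int q)" by simp
    then obtain r :: real where r: "\<eta> a = of_real r" by blast
    then have "\<bar>r\<bar> = 1" using dirichlet_char_norm[OF assms(2) that] by simp
    then have "r = 1 \<or> r = - 1" by linarith
    then show ?thesis using r by auto
  qed
  then show "principal_char \<eta> \<or> quadratic_char \<eta>"
    by (auto simp: quadratic_char_def principal_char_def)
  show "\<exists>!S. decomposition k N \<eta> E S"
    unfolding E
    using decomposition_exists[OF assms(1,2) \<eta>_rational c_0 rational]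
      decomposition_unique[OF assms(1,2) \<eta>_rational c_0 rational]
    by blast
qed

end
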